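(* Let $G$ be a finite group and let $F(G)$ be its Fitting subgroup. Suppose that for every minimal subgroup $H$ of $G$, all maximal chains of $H$ in $G$ have the same length. Then: (1) $G$ is non-supersolvable if and only if $\Phi(G)=Z(G)=1$ and there is a subgroup $M$ of $G$ such that $G=F(G)\rtimes M$, where $M$ acts faithfully on $F(G)$, $F(G)$ is the unique minimal normal subgroup of $G$, $M$ is a supersolvable maximal subgroup of $G$, and $|F(G)|=p^n$ for some prime $p$ and some integer $n\ge 2$. (2) If $G$ is non-supersolvable, then $F(G)$ is a Sylow subgroup of $G'$. In particular, if (in addition) $Z(G')\neq 1$, then $F(G)=G'$.
   Context: For a subgroup $H$ of a finite group $G$, a maximal chain of $H$ in $G$ of length $r$ is a chain of subgroups $H=H_0<H_1<H_2<\cdots<H_r=G$ such that $H_i$ is a maximal subgroup of $H_{i+1}$ for every $0\le i\le r-1$. "All maximal chains of $H$ in $G$ have the same length" means that any two such chains starting at this $H$ have equal length (the common length may depend on $H$). A minimal subgroup of $G$ is a minimal nontrivial subgroup, i.e. a subgroup of prime order. $\Phi(G)$ denotes the Frattini subgroup, $Z(G)$ the center, and $G'$ the derived (commutator) subgroup of $G$. $G=F(G)\rtimes M$ denotes an internal semidirect product with $F(G)$ normal; $M$ acts on $F(G)$ by conjugation. *)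

theory Defs
  imports "HOL-Algebra.Algebra"
begin

(* A subgroup H of G, regarded as a group in its own right, is G\<lparr>carrier := H\<rparr>. *)

definition maximal_subgroup :: "'a set \<Rightarrow> ('a, 'b) monoid_scheme \<Rightarrow> bool"
  where "maximal_subgroup M G \<longleftrightarrow>
    subgroup M G \<and> M \<noteq> carrier G \<and>
    (\<forall>K. subgroup K G \<and> M \<subseteq> K \<longrightarrow> K = M \<or> K = carrier G)"

definition minimal_subgroup :: "'a set \<Rightarrow> ('a, 'b) monoid_scheme \<Rightarrow> bool"
  where "minimal_subgroup H G \<longleftrightarrow>
    subgroup H G \<and> H \<noteq> {\<one>\<^bsub>G\<^esub>} \<and>
    (\<forall>K. subgroup K G \<and> K \<subseteq> H \<longrightarrow> K = {\<one>\<^bsub>G\<^esub>} \<or> K = H)"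

definition minimal_normal_subgroup :: "'a set \<Rightarrow> ('a, 'b) monoid_scheme \<Rightarrow> bool"
  where "minimal_normal_subgroup N G \<longleftrightarrow>
    N \<lhd> G \<and> N \<noteq> {\<one>\<^bsub>G\<^esub>} \<and>
    (\<forall>K. K \<lhd> G \<and> K \<subseteq> N \<longrightarrow> K = {\<one>\<^bsub>G\<^esub>} \<or> K = N)"

(* H = C 0 < C 1 < ... < C r = G, of length r; the values C i with i > r are irrelevant. *)
definition maximal_chain ::
    "('a, 'b) monoid_scheme \<Rightarrow> 'a set \<Rightarrow> nat \<Rightarrow> (nat \<Rightarrow> 'a set) \<Rightarrow> bool"
  where "maximal_chain G H r C \<longleftrightarrow>
    C 0 = H \<and> C r = carrier G \<and> (\<forall>i\<le>r. subgroup (C i) G) \<and>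
    (\<forall>i<r. maximal_subgroup (C i) (G\<lparr>carrier := C (Suc i)\<rparr>))"

definition all_maximal_chains_same_length :: "('a, 'b) monoid_scheme \<Rightarrow> 'a set \<Rightarrow> bool"
  where "all_maximal_chains_same_length G H \<longleftrightarrow>
    (\<forall>r s C D. maximal_chain G H r C \<and> maximal_chain G H s D \<longrightarrow> r = s)"

(* The intersection with the carrier gives frattini G = carrier G
   when there are no maximal subgroups. *)
definition frattini :: "('a, 'b) monoid_scheme \<Rightarrow> 'a set"
  where "frattini G = carrier G \<inter> \<Inter>{M. maximal_subgroup M G}"

definition center :: "('a, 'b) monoid_scheme \<Rightarrow> 'a set"
  where "center G = {z \<in> carrier G. \<forall>g \<in> carrier G. z \<otimes>\<^bsub>G\<^esub> g = g \<otimes>\<^bsub>G\<^esub> z}"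

primrec lower_central :: "('a, 'b) monoid_scheme \<Rightarrow> nat \<Rightarrow> 'a set"
  where
    "lower_central G 0 = carrier G"
  | "lower_central G (Suc n) = generate G
      (\<Union>h \<in> lower_central G n. \<Union>g \<in> carrier G.
        {h \<otimes>\<^bsub>G\<^esub> g \<otimes>\<^bsub>G\<^esub> inv\<^bsub>G\<^esub> h \<otimes>\<^bsub>G\<^esub> inv\<^bsub>G\<^esub> g})"

definition nilpotent_group :: "('a, 'b) monoid_scheme \<Rightarrow> bool"
  where "nilpotent_group G \<longleftrightarrow> (\<exists>n. lower_central G n = {\<one>\<^bsub>G\<^esub>})"

definition fitting :: "('a, 'b) monoid_scheme \<Rightarrow> 'a set"
  where "fitting G = generate G (\<Union>{N. N \<lhd> G \<and> nilpotent_group (G\<lparr>carrier := N\<rparr>)})"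

(* The terms of the series are normal in the whole group,
   as opposed to being merely subnormal. *)
definition supersolvable :: "('a, 'b) monoid_scheme \<Rightarrow> bool"
  where "supersolvable G \<longleftrightarrow>
    (\<exists>r N. N 0 = {\<one>\<^bsub>G\<^esub>} \<and> N r = carrier G \<and> (\<forall>i\<le>r. N i \<lhd> G) \<and>
      (\<forall>i<r. N i \<subseteq> N (Suc i) \<and> cyclic_group ((G\<lparr>carrier := N (Suc i)\<rparr>) Mod N i)))"

definition internal_semidirect ::
    "('a, 'b) monoid_scheme \<Rightarrow> 'a set \<Rightarrow> 'a set \<Rightarrow> bool"
  where "internal_semidirect G N M \<longleftrightarrow>
    N \<lhd> G \<and> subgroup M G \<and> N \<inter> M = {\<one>\<^bsub>G\<^esub>} \<and> N <#>\<^bsub>G\<^esub> M = carrier G"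

definition acts_faithfully_by_conjugation ::
    "('a, 'b) monoid_scheme \<Rightarrow> 'a set \<Rightarrow> 'a set \<Rightarrow> bool"
  where "acts_faithfully_by_conjugation G M N \<longleftrightarrow>
    faithful_action (G\<lparr>carrier := M\<rparr>) N
      (\<lambda>m. \<lambda>x\<in>N. m \<otimes>\<^bsub>G\<^esub> x \<otimes>\<^bsub>G\<^esub> inv\<^bsub>G\<^esub> m)"

definition sylow_subgroup :: "nat \<Rightarrow> 'a set \<Rightarrow> ('a, 'b) monoid_scheme \<Rightarrow> bool"
  where "sylow_subgroup p P G \<longleftrightarrow>
    Factorial_Ring.prime p \<and> subgroup P G \<and> card P = p ^ multiplicity p (order G)"

abbreviation derived_group :: "('a, 'b) monoid_scheme \<Rightarrow> ('a, 'b) monoid_scheme"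
  where "derived_group G \<equiv> G\<lparr>carrier := derived G (carrier G)\<rparr>"

end

theory Submission
  imports Defs "HOL-Number_Theory.Residues"
begin

text \<open>
  By induction, a finite group with the chain property is supersolvable or is \<open>F \<rtimes> S\<close> with
  \<open>F\<close> the unique minimal normal subgroup, elementary abelian of rank at least two and
  self-centralizing, and \<open>S\<close> supersolvable of order prime to \<open>|F|\<close>. In a proper quotient all
  maximal chains from the trivial subgroup have the same length, and in \<open>F \<rtimes> S\<close> the chains
  through \<open>F\<close> and through \<open>S\<close> differ in length; so all proper quotients are supersolvable.

  If the group has a proper nontrivial normal subgroup, a minimal one \<open>N\<close> is elementary abelian
  and unique. A Frattini argument splits \<open>N\<close> off when it is self-centralizing; otherwise a chief
  factor above \<open>N\<close> inside its centralizer yields a normal subgroup of prime order, which would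
  make the group supersolvable.

  If the group is simple, let \<open>u\<close> be the least prime among the orders of the subgroups of prime
  order that start the shortest maximal chains. Normalizers of \<open>u\<close>-subgroups are then
  supersolvable with no smaller prime divisor, so a Sylow \<open>u\<close>-subgroup controls its own fusion
  (Frobenius), and the transfer produces a normal subgroup of index \<open>u\<close>.
\<close>

section \<open>Subgroups of a finite group\<close>

text \<open>The chain condition passes to a subgroup because all chains ending there can be
  prolonged by one fixed chain. For a quotient by \<open>N \<noteq> 1\<close> it grows stronger: a
  subgroup of prime order inside \<open>N\<close> starts chains through \<open>N\<close>, so even
  the trivial subgroup of the quotient has chains of one length only. Hence
  \<open>F \<rtimes> S\<close> may occur as a subgroup but not as a proper quotient: with
  \<open>|F| = f^n\<close>, the way through \<open>S\<close> adds one step above \<open>S\<close>,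
  the way through \<open>F\<close> adds \<open>n \<ge> 2\<close> steps below \<open>F\<close>, and
  the other steps agree in number. The same discrepancy \<open>n - 1\<close> guides the choice of
  \<open>u\<close>: a subgroup of order \<open>f\<close> in \<open>F\<close> starts longer chains
  than one of prime order in \<open>S\<close>, so a subgroup with shortest chains avoids
  \<open>F\<close>. The obstacle in the non-simple case is a chief factor \<open>T/N\<close> that
  centralizes \<open>N\<close> and belongs to the same prime \<open>r\<close>. Then \<open>T\<close>
  is a vector space over the field with \<open>r\<close> elements, and linear algebra decides: an
  element that induces one scalar on both \<open>N\<close> and \<open>T/N\<close> is a scalar or a
  Jordan block, and the \<open>(r - 1)\<close>-th power of a Jordan block is a transvection, which
  is excluded.\<close>

abbreviation prime_nat :: "nat \<Rightarrow> bool"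
  where "prime_nat \<equiv> Factorial_Ring.prime"

lemma card_uniform_fibres:
  assumes "finite A" "\<And>y. y \<in> f ` A \<Longrightarrow> card {x \<in> A. f x = y} = k"
  shows "card A = k * card (f ` A)"
proof -
  have "card A = (\<Sum>y\<in>f ` A. card {x \<in> A. f x = y})"
    using sum.image_gen[OF assms(1), of "\<lambda>_. 1::nat" f] by simp
  then show ?thesis using assms(2) by simp
qed

locale fin_group = group G for G (structure) +
  assumes fin: "finite (carrier G)"

context group
begin

text \<open>Once a word is associated to the right, an element and its inverse meet only in front of
  a remaining tail; these rules cancel such a pair. \<open>word_simps\<close> then verifies word
  identities by reducing both sides.\<close>

lemma cancel_inv:
  "\<lbrakk>x \<in> carrier G; y \<in> carrier G\<rbrakk> \<Longrightarrow> x \<otimes> (inv x \<otimes> y) = y"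
  "\<lbrakk>x \<in> carrier G; y \<in> carrier G\<rbrakk> \<Longrightarrow> inv x \<otimes> (x \<otimes> y) = y"
  by (simp_all flip: m_assoc)

lemmas word_simps = m_assoc inv_mult_group cancel_inv

text \<open>Normality is a relation between subsets of one ambient group. Intersections, products
  and conjugates then stay in a single lattice, with no change of group structure between
  levels.\<close>

definition normal_in :: "'a set \<Rightarrow> 'a set \<Rightarrow> bool"
  where "normal_in N Y \<longleftrightarrow> subgroup N G \<and> subgroup Y G \<and> N \<subseteq> Y \<and>
    (\<forall>x\<in>Y. \<forall>n\<in>N. x \<otimes> n \<otimes> inv x \<in> N)"

definition normalizer_in :: "'a set \<Rightarrow> 'a set \<Rightarrow> 'a set"
  where "normalizer_in Y H = {x \<in> Y. (\<forall>h\<in>H. x \<otimes> h \<otimes> inv x \<in> H) \<and> (\<forall>h\<in>H. inv x \<otimes> h \<otimes> x \<in> H)}"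

definition centralizer_in :: "'a set \<Rightarrow> 'a set \<Rightarrow> 'a set"
  where "centralizer_in Y H = {x \<in> Y. \<forall>h\<in>H. x \<otimes> h = h \<otimes> x}"

lemma normal_inD:
  assumes "normal_in N Y"
  shows "subgroup N G" "subgroup Y G" "N \<subseteq> Y"
    "\<And>x n. x \<in> Y \<Longrightarrow> n \<in> N \<Longrightarrow> x \<otimes> n \<otimes> inv x \<in> N"
  using assms by (auto simp: normal_in_def)

lemma normal_in_conj':
  assumes "normal_in N Y" "x \<in> Y" "n \<in> N"
  shows "inv x \<otimes> n \<otimes> x \<in> N"
proof -
  have "inv x \<in> Y" using assms by (simp add: normal_in_def subgroup.m_inv_closed)
  then have "inv x \<otimes> n \<otimes> inv (inv x) \<in> N" using assms by (auto simp: normal_in_def)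
  moreover have "x \<in> carrier G" using assms by (auto simp: normal_in_def subgroup.mem_carrier)
  ultimately show ?thesis by simp
qed

lemma normal_in_self: "subgroup Y G \<Longrightarrow> normal_in Y Y"
  by (simp add: normal_in_def subgroup.m_closed subgroup.m_inv_closed)

lemma normal_in_one: "subgroup Y G \<Longrightarrow> normal_in {\<one>} Y"
  by (auto simp: normal_in_def triv_subgroup subgroup.one_closed subgroup.mem_carrier)

lemma normal_in_Int:
  assumes "normal_in N Y" "normal_in M Y"
  shows "normal_in (N \<inter> M) Y"
  using assms by (auto simp: normal_in_def subgroups_Inter_pair)

lemma normal_in_mono: "normal_in N Y \<Longrightarrow> subgroup Z G \<Longrightarrow> N \<subseteq> Z \<Longrightarrow> Z \<subseteq> Y \<Longrightarrow> normal_in N Z"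
  by (auto simp: normal_in_def)

lemma normal_in_Int_subgroup:
  assumes "normal_in N Y" "subgroup Z G" "Z \<subseteq> Y"
  shows "normal_in (N \<inter> Z) Z"
  using assms by (auto simp: normal_in_def subgroups_Inter_pair subgroup.m_closed subgroup.m_inv_closed subsetD)

section \<open>Products of subgroups\<close>

lemma normal_in_prod_sym:
  assumes "normal_in N Y" "subgroup K G" "K \<subseteq> Y"
  shows "N <#> K = K <#> N"
proof
  have c: "x \<in> carrier G" if "x \<in> Y" for x using that assms(1) by (auto simp: normal_in_def subgroup.mem_carrier)
  show "N <#> K \<subseteq> K <#> N"
  proof
    fix z assume "z \<in> N <#> K"
    then obtain n k where z: "z = n \<otimes> k" "n \<in> N" "k \<in> K" by (auto simp: set_mult_def)
    then have "n \<in> Y" "k \<in> Y" using assms by (auto simp: normal_in_def)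
    then have "z = k \<otimes> (inv k \<otimes> n \<otimes> k)" "inv k \<otimes> n \<otimes> k \<in> N"
      using z c[of n] c[of k] assms normal_in_conj'[OF assms(1), of k n] by (auto simp: word_simps normal_in_def)
    then show "z \<in> K <#> N" using z(3) by (auto simp: set_mult_def)
  qed
  show "K <#> N \<subseteq> N <#> K"
  proof
    fix z assume "z \<in> K <#> N"
    then obtain n k where z: "z = k \<otimes> n" "n \<in> N" "k \<in> K" by (auto simp: set_mult_def)
    then have "n \<in> Y" "k \<in> Y" using assms by (auto simp: normal_in_def)
    then have "z = (k \<otimes> n \<otimes> inv k) \<otimes> k" "k \<otimes> n \<otimes> inv k \<in> N"
      using z c[of n] c[of k] normal_inD(4)[OF assms(1), of k n] by (simp_all add: word_simps)
    then show "z \<in> N <#> K" using z(3) by (auto simp: set_mult_def)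
  qed
qed

lemma set_mult_memI: "h \<in> H \<Longrightarrow> k \<in> K \<Longrightarrow> h \<otimes> k \<in> H <#> K"
  by (auto simp: set_mult_def)

lemma set_mult_superset:
  assumes "subgroup H G" "subgroup K G"
  shows "H \<subseteq> H <#> K" "K \<subseteq> H <#> K"
proof -
  show "H \<subseteq> H <#> K"
    using assms subgroup.one_closed[OF assms(2)] subgroup.mem_carrier[OF assms(1)]
    by (force simp: set_mult_def)
  show "K \<subseteq> H <#> K"
    using assms subgroup.one_closed[OF assms(1)] subgroup.mem_carrier[OF assms(2)]
    by (force simp: set_mult_def)
qed

lemma set_mult_subset:
  assumes "subgroup Y G" "H \<subseteq> Y" "K \<subseteq> Y"
  shows "H <#> K \<subseteq> Y"
  using assms by (auto simp: set_mult_def subgroup.m_closed subsetD)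

lemma subgroup_prod:
  assumes "normal_in N Y" "subgroup K G" "K \<subseteq> Y"
  shows "subgroup (N <#> K) G"
proof (rule subgroupI)
  note d = normal_inD[OF assms(1)]
  have c: "x \<in> carrier G" if "x \<in> Y" for x using that d by (auto simp: subgroup.mem_carrier)
  show "N <#> K \<subseteq> carrier G" using set_mult_subset[OF d(2,3) assms(3)] c by blast
  show "N <#> K \<noteq> {}" using d assms(2) subgroup.one_closed by (fastforce simp: set_mult_def)
  show "inv a \<in> N <#> K" if "a \<in> N <#> K" for a
  proof -
    from that obtain n k where a: "a = n \<otimes> k" "n \<in> N" "k \<in> K" by (auto simp: set_mult_def)
    then have "n \<in> carrier G" "k \<in> carrier G" using c d(3) assms(3) by auto
    then have "inv a = inv k \<otimes> inv n" using a by (simp add: inv_mult_group)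
    then have "inv a \<in> K <#> N" using a d(1) assms(2) by (auto intro!: set_mult_memI subgroup.m_inv_closed)
    then show ?thesis using normal_in_prod_sym[OF assms] by simp
  qed
  show "a \<otimes> b \<in> N <#> K" if "a \<in> N <#> K" "b \<in> N <#> K" for a b
  proof -
    from that obtain n k n' k' where a: "a = n \<otimes> k" "n \<in> N" "k \<in> K" "b = n' \<otimes> k'" "n' \<in> N" "k' \<in> K"
      by (auto simp: set_mult_def)
    then have x: "n \<in> carrier G" "k \<in> carrier G" "n' \<in> carrier G" "k' \<in> carrier G" using c d(3) assms(3) by auto
    have "a \<otimes> b = (n \<otimes> (k \<otimes> n' \<otimes> inv k)) \<otimes> (k \<otimes> k')" using a x by (simp add: word_simps)
    moreover have "n \<otimes> (k \<otimes> n' \<otimes> inv k) \<in> N"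
      using a assms(3) by (auto intro!: subgroup.m_closed[OF d(1)] d(4))
    moreover have "k \<otimes> k' \<in> K" using a assms(2) by (simp add: subgroup.m_closed)
    ultimately show ?thesis by (simp add: set_mult_memI)
  qed
qed

lemma normal_in_prod:
  assumes "normal_in N Y" "normal_in K Y"
  shows "normal_in (N <#> K) Y"
proof -
  note d = normal_inD[OF assms(1)] and e = normal_inD[OF assms(2)]
  have c: "x \<in> carrier G" if "x \<in> Y" for x using that d by (auto simp: subgroup.mem_carrier)
  have "x \<otimes> a \<otimes> inv x \<in> N <#> K" if "x \<in> Y" "a \<in> N <#> K" for x a
  proof -
    from that obtain n k where a: "a = n \<otimes> k" "n \<in> N" "k \<in> K" by (auto simp: set_mult_def)
    then have x: "n \<in> carrier G" "k \<in> carrier G" "x \<in> carrier G" using c d(3) e(3) that by auto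
    have "x \<otimes> a \<otimes> inv x = (x \<otimes> n \<otimes> inv x) \<otimes> (x \<otimes> k \<otimes> inv x)" using a x by (simp add: word_simps)
    then show ?thesis using a that d(4) e(4) by (auto intro!: set_mult_memI)
  qed
  then show ?thesis unfolding normal_in_def
    using subgroup_prod[OF assms(1) e(1,3)] d e set_mult_subset[OF d(2,3) e(3)] by auto
qed

text \<open>If \<open>n \<otimes> s\<close> and \<open>n\<close> lie in \<open>L\<close>, so does
  \<open>s\<close>. The modular law brings a prime step found above \<open>N\<close> back down into
  a supplement of \<open>N\<close>.\<close>

lemma dedekind_prod:
  assumes "subgroup N G" "subgroup S G" "subgroup L G" "N \<subseteq> L" "L \<subseteq> N <#> S"
  shows "L = N <#> (L \<inter> S)"
proof
  show "N <#> (L \<inter> S) \<subseteq> L" using set_mult_subset[OF assms(3,4)] by simp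
  show "L \<subseteq> N <#> (L \<inter> S)"
  proof
    fix x assume x: "x \<in> L"
    then obtain n s where ns: "x = n \<otimes> s" "n \<in> N" "s \<in> S" using assms(5) by (auto simp: set_mult_def)
    have c: "n \<in> carrier G" "s \<in> carrier G" using ns assms(1,2) by (auto simp: subgroup.mem_carrier)
    have "inv n \<otimes> x \<in> L"
      using x ns(2) assms by (auto intro!: subgroup.m_closed[OF assms(3)] subgroup.m_inv_closed[OF assms(3)])
    then have "s \<in> L" using ns c by (simp add: cancel_inv)
    then show "x \<in> N <#> (L \<inter> S)" using ns by (auto simp: set_mult_def)
  qed
qed

lemma l_coset_eq_iff:
  assumes "subgroup K G" "x \<in> carrier G" "y \<in> carrier G"
  shows "x <# K = y <# K \<longleftrightarrow> inv x \<otimes> y \<in> K"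
proof
  assume e: "x <# K = y <# K"
  have "y \<in> y <# K" using assms subgroup.one_closed[OF assms(1)] by (force simp: l_coset_def)
  then obtain k where "k \<in> K" "y = x \<otimes> k" using e by (auto simp: l_coset_def)
  then show "inv x \<otimes> y \<in> K" using assms by (simp add: cancel_inv subgroup.mem_carrier)
next
  assume k: "inv x \<otimes> y \<in> K"
  have cK: "k \<in> carrier G" if "k \<in> K" for k using that assms(1) by (simp add: subgroup.mem_carrier)
  have "y <# K \<subseteq> x <# K"
  proof
    fix z assume "z \<in> y <# K"
    then obtain l where l: "l \<in> K" "z = y \<otimes> l" by (auto simp: l_coset_def)
    then have "z = x \<otimes> (inv x \<otimes> y \<otimes> l)" using assms cK[of l] by (simp add: word_simps)
    moreover have "inv x \<otimes> y \<otimes> l \<in> K" using k l assms(1) by (simp add: subgroup.m_closed)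
    ultimately show "z \<in> x <# K" by (auto simp: l_coset_def)
  qed
  moreover have "x <# K \<subseteq> y <# K"
  proof
    fix z assume "z \<in> x <# K"
    then obtain l where l: "l \<in> K" "z = x \<otimes> l" by (auto simp: l_coset_def)
    then have "z = y \<otimes> (inv (inv x \<otimes> y) \<otimes> l)" using assms cK[of l] by (simp add: word_simps)
    moreover have "inv (inv x \<otimes> y) \<otimes> l \<in> K"
      using k l assms(1) subgroup.m_closed[OF assms(1)] subgroup.m_inv_closed[OF assms(1)] by blast
    ultimately show "z \<in> y <# K" by (auto simp: l_coset_def)
  qed
  ultimately show "x <# K = y <# K" by blast
qed

end

section \<open>Counting by cosets\<close>

context fin_group
begin

lemma subgroup_finite: "subgroup H G \<Longrightarrow> finite H"
  using fin finite_subset subgroup.subset by blast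

lemma subgroup_card_pos: "subgroup H G \<Longrightarrow> card H > 0"
  using subgroup_finite subgroup_nonempty card_gt_0_iff subgroup.one_closed by (metis empty_iff)

lemma subgroup_finI:
  assumes "H \<subseteq> carrier G" "\<one> \<in> H" "\<And>x y. x \<in> H \<Longrightarrow> y \<in> H \<Longrightarrow> x \<otimes> y \<in> H"
  shows "subgroup H G"
proof (rule subgroupI)
  show "H \<subseteq> carrier G" "H \<noteq> {}" "\<And>x y. x \<in> H \<Longrightarrow> y \<in> H \<Longrightarrow> x \<otimes> y \<in> H" using assms by auto
  fix a assume a: "a \<in> H"
  then have ac: "a \<in> carrier G" using assms by auto
  have f: "finite H" using assms(1) fin finite_subset by blast
  have "inj_on ((\<otimes>) a) H" using assms(1) ac by (auto simp: inj_on_def subset_iff)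
  moreover have "(\<otimes>) a ` H \<subseteq> H" using a assms(3) by auto
  ultimately have "(\<otimes>) a ` H = H" using f by (simp add: endo_inj_surj)
  then obtain b where b: "b \<in> H" "a \<otimes> b = \<one>" using assms(2) by (metis imageE)
  then have "inv a = b" using ac assms(1) by (metis inv_comm inv_equality subsetD)
  then show "inv a \<in> H" using b by simp
qed

text \<open>Lagrange's theorem for any map whose fibres are left cosets of \<open>K\<close>; the
  values need carry no group structure. Coset maps, orbit maps, power maps, commutators with a fixed
  element and the transfer modulo \<open>p\<close> are all counted in this way.\<close>

lemma card_fibres_subgroup:
  assumes "subgroup A G" "subgroup K G" "K \<subseteq> A"
    "\<And>x y. x \<in> A \<Longrightarrow> y \<in> A \<Longrightarrow> f x = f y \<longleftrightarrow> inv x \<otimes> y \<in> K"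
  shows "card A = card K * card (f ` A)"
proof (rule card_uniform_fibres)
  show "finite A" using assms(1) subgroup_finite by blast
  fix y assume "y \<in> f ` A"
  then obtain x where x: "x \<in> A" "y = f x" by auto
  have c: "a \<in> carrier G" if "a \<in> A" for a using that assms(1) by (simp add: subgroup.mem_carrier)
  have "{z \<in> A. f z = y} = (\<otimes>) x ` K"
  proof
    show "(\<otimes>) x ` K \<subseteq> {z \<in> A. f z = y}"
    proof
      fix z assume "z \<in> (\<otimes>) x ` K"
      then obtain k where k: "k \<in> K" "z = x \<otimes> k" by auto
      then have "z \<in> A" using x(1) assms(3) subgroup.m_closed[OF assms(1)] by blast
      moreover have "inv x \<otimes> z \<in> K" using k x c assms(3) by (auto simp: cancel_inv)
      ultimately show "z \<in> {z \<in> A. f z = y}" using assms(4)[of x z] x by auto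
    qed
    show "{z \<in> A. f z = y} \<subseteq> (\<otimes>) x ` K"
    proof
      fix z assume z: "z \<in> {z \<in> A. f z = y}"
      then have "inv x \<otimes> z \<in> K" using assms(4)[of x z] x by auto
      moreover have "z = x \<otimes> (inv x \<otimes> z)" using z x c by (simp add: cancel_inv)
      ultimately show "z \<in> (\<otimes>) x ` K" by blast
    qed
  qed
  moreover have "inj_on ((\<otimes>) x) K" using c x assms(3) by (auto simp: inj_on_def subset_iff)
  ultimately show "card {z \<in> A. f z = y} = card K" by (simp add: card_image)
qed

lemma card_cosets_subgroup:
  assumes "subgroup A G" "subgroup K G" "K \<subseteq> A"
  shows "card A = card K * card ((\<lambda>x. x <# K) ` A)"
  by (rule card_fibres_subgroup[OF assms]) (use assms in \<open>auto simp: l_coset_eq_iff subgroup.mem_carrier\<close>)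

lemma card_subgroup_dvd:
  assumes "subgroup K G" "subgroup A G" "K \<subseteq> A"
  shows "card K dvd card A"
  using card_cosets_subgroup[OF assms(2,1,3)] by simp

text \<open>The cosets \<open>h <# K\<close> with \<open>h \<in> H\<close> are exactly the left
  cosets of \<open>K\<close> inside the product. They are counted once from \<open>H\<close>, with
  fibres of size \<open>card (H \<inter> K)\<close>, and once from the product, with fibres of size
  \<open>card K\<close>; the product itself may fail to be a subgroup.\<close>

lemma card_set_mult:
  assumes "subgroup H G" "subgroup K G"
  shows "card (H <#> K) * card (H \<inter> K) = card H * card K"
proof -
  have c: "a \<in> carrier G" if "a \<in> H \<union> K" for a using that assms by (auto simp: subgroup.mem_carrier)
  have 1: "card H = card (H \<inter> K) * card ((\<lambda>x. x <# K) ` H)"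
    by (rule card_fibres_subgroup)
      (use assms c in \<open>auto simp: l_coset_eq_iff subgroups_Inter_pair subgroup.m_closed subgroup.m_inv_closed\<close>)
  have sub: "H <#> K \<subseteq> carrier G" using c by (auto simp: set_mult_def)
  have 2: "card (H <#> K) = card K * card ((\<lambda>x. x <# K) ` (H <#> K))"
  proof (rule card_uniform_fibres)
    show "finite (H <#> K)" using sub fin finite_subset by blast
    fix y assume "y \<in> (\<lambda>x. x <# K) ` (H <#> K)"
    then obtain h k where x: "h \<in> H" "k \<in> K" "y = (h \<otimes> k) <# K" by (auto simp: set_mult_def)
    then have "inv h \<otimes> (h \<otimes> k) \<in> K" using c by (simp add: cancel_inv)
    then have y: "y = h <# K" using x c l_coset_eq_iff[OF assms(2), of h "h \<otimes> k"] by auto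
    have "{z \<in> H <#> K. z <# K = y} = h <# K"
    proof
      show "{z \<in> H <#> K. z <# K = y} \<subseteq> h <# K"
      proof
        fix z assume z: "z \<in> {z \<in> H <#> K. z <# K = y}"
        have "z \<in> carrier G" using z sub by auto
        then have "z \<in> z <# K" using subgroup.one_closed[OF assms(2)] by (force simp: l_coset_def)
        then show "z \<in> h <# K" using z y by simp
      qed
      show "h <# K \<subseteq> {z \<in> H <#> K. z <# K = y}"
      proof
        fix z assume "z \<in> h <# K"
        then obtain l where l: "l \<in> K" "z = h \<otimes> l" by (auto simp: l_coset_def)
        then have "inv h \<otimes> z \<in> K" using x c by (simp add: cancel_inv)
        then have "z <# K = y" using y l_coset_eq_iff[OF assms(2), of h z] l c x by auto
        then show "z \<in> {z \<in> H <#> K. z <# K = y}" using l x by (auto simp: set_mult_def)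
      qed
    qed
    moreover have "h <# K = (\<otimes>) h ` K" by (auto simp: l_coset_def)
    moreover have "inj_on ((\<otimes>) h) K" using c x by (auto simp: inj_on_def)
    ultimately show "card {z \<in> H <#> K. z <# K = y} = card K" by (simp add: card_image)
  qed
  have 3: "(\<lambda>x. x <# K) ` (H <#> K) = (\<lambda>x. x <# K) ` H"
  proof
    show "(\<lambda>x. x <# K) ` H \<subseteq> (\<lambda>x. x <# K) ` (H <#> K)" using set_mult_superset(1)[OF assms] by blast
    show "(\<lambda>x. x <# K) ` (H <#> K) \<subseteq> (\<lambda>x. x <# K) ` H"
    proof
      fix y assume "y \<in> (\<lambda>x. x <# K) ` (H <#> K)"
      then obtain h k where x: "h \<in> H" "k \<in> K" "y = (h \<otimes> k) <# K" by (auto simp: set_mult_def)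
      then have "inv h \<otimes> (h \<otimes> k) \<in> K" using c by (simp add: cancel_inv)
      then have "y = h <# K" using x c l_coset_eq_iff[OF assms(2), of h "h \<otimes> k"] by auto
      then show "y \<in> (\<lambda>x. x <# K) ` H" using x by auto
    qed
  qed
  show ?thesis using 1 2 3 by simp
qed

lemma card_set_mult_trivial:
  assumes "subgroup H G" "subgroup K G" "H \<inter> K = {\<one>}"
  shows "card (H <#> K) = card H * card K"
  using card_set_mult[OF assms(1,2)] assms(3) by simp

lemma subgroup_eq_card: "subgroup H G \<Longrightarrow> K \<subseteq> H \<Longrightarrow> card K = card H \<Longrightarrow> K = H"
  using subgroup_finite card_subset_eq by blast

lemma subgroup_normalizer_in:
  assumes "subgroup Y G" "subgroup H G"
  shows "subgroup (normalizer_in Y H) G"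
proof (rule subgroup_finI)
  note cY = subgroup.mem_carrier[OF assms(1)] and cH = subgroup.mem_carrier[OF assms(2)]
  show "normalizer_in Y H \<subseteq> carrier G" using cY by (auto simp: normalizer_in_def)
  show "\<one> \<in> normalizer_in Y H" using assms cH by (auto simp: normalizer_in_def subgroup.one_closed)
  fix x y assume x: "x \<in> normalizer_in Y H" and y: "y \<in> normalizer_in Y H"
  have xy: "x \<in> carrier G" "y \<in> carrier G" using x y cY by (auto simp: normalizer_in_def)
  have "x \<otimes> y \<otimes> h \<otimes> inv (x \<otimes> y) \<in> H" if "h \<in> H" for h
  proof -
    have "x \<otimes> (y \<otimes> h \<otimes> inv y) \<otimes> inv x \<in> H" using x y that by (auto simp: normalizer_in_def)
    then show ?thesis using xy cH[OF that] by (simp add: word_simps)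
  qed
  moreover have "inv (x \<otimes> y) \<otimes> h \<otimes> (x \<otimes> y) \<in> H" if "h \<in> H" for h
  proof -
    have "inv y \<otimes> (inv x \<otimes> h \<otimes> x) \<otimes> y \<in> H" using x y that by (auto simp: normalizer_in_def)
    then show ?thesis using xy cH[OF that] by (simp add: word_simps)
  qed
  ultimately show "x \<otimes> y \<in> normalizer_in Y H"
    using x y assms(1) by (auto simp: normalizer_in_def subgroup.m_closed)
qed

lemma normal_in_normalizer:
  assumes "subgroup Y G" "subgroup H G" "H \<subseteq> Y"
  shows "normal_in H (normalizer_in Y H)"
proof -
  have "H \<subseteq> normalizer_in Y H"
    using assms by (auto simp: normalizer_in_def subgroup.m_closed subgroup.m_inv_closed)
  then show ?thesis unfolding normal_in_def
    using subgroup_normalizer_in[OF assms(1,2)] assms(2) by (auto simp: normalizer_in_def)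
qed

lemma normal_in_le_normalizer: "normal_in H Z \<Longrightarrow> Z \<subseteq> Y \<Longrightarrow> Z \<subseteq> normalizer_in Y H"
  by (auto simp: normalizer_in_def normal_in_conj' normal_inD(4))

text \<open>Conjugation by \<open>x\<close> is an injective self-map of the finite set
  \<open>H\<close>, hence onto. One inclusion thus yields both conditions in
  \<open>normalizer_in\<close>.\<close>

lemma normal_conj_bij:
  assumes "subgroup H G" "x \<in> carrier G" "\<And>h. h \<in> H \<Longrightarrow> x \<otimes> h \<otimes> inv x \<in> H" "h \<in> H"
  shows "inv x \<otimes> h \<otimes> x \<in> H"
proof -
  note c = subgroup.mem_carrier[OF assms(1)]
  have "inj_on (\<lambda>h. x \<otimes> h \<otimes> inv x) H" using c assms(2) by (auto simp: inj_on_def)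
  moreover have "(\<lambda>h. x \<otimes> h \<otimes> inv x) ` H \<subseteq> H" using assms(3) by auto
  ultimately have "(\<lambda>h. x \<otimes> h \<otimes> inv x) ` H = H" using subgroup_finite[OF assms(1)] by (simp add: endo_inj_surj)
  then have "h \<in> (\<lambda>h. x \<otimes> h \<otimes> inv x) ` H" using assms(4) by simp
  then obtain k where "k \<in> H" "h = x \<otimes> k \<otimes> inv x" by blast
  then show ?thesis using c assms(2) by (simp add: word_simps)
qed

lemma subgroup_centralizer_in:
  assumes "subgroup Y G" "H \<subseteq> carrier G"
  shows "subgroup (centralizer_in Y H) G"
proof (rule subgroup_finI)
  note cY = subgroup.mem_carrier[OF assms(1)]
  show "centralizer_in Y H \<subseteq> carrier G" using cY by (auto simp: centralizer_in_def)
  show "\<one> \<in> centralizer_in Y H" using assms by (auto simp: centralizer_in_def subgroup.one_closed)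
  fix x y assume x: "x \<in> centralizer_in Y H" and y: "y \<in> centralizer_in Y H"
  have "x \<otimes> y \<otimes> h = h \<otimes> (x \<otimes> y)" if "h \<in> H" for h
  proof -
    have cc: "h \<in> carrier G" "x \<in> carrier G" "y \<in> carrier G" using that assms(2) x y cY by (auto simp: centralizer_in_def)
    have "x \<otimes> y \<otimes> h = x \<otimes> (h \<otimes> y)" using y that cc by (simp add: centralizer_in_def m_assoc)
    also have "\<dots> = h \<otimes> x \<otimes> y" using x that cc by (simp add: centralizer_in_def flip: m_assoc)
    finally show ?thesis using cc by (simp add: m_assoc)
  qed
  then show "x \<otimes> y \<in> centralizer_in Y H"
    using x y assms(1) by (auto simp: centralizer_in_def subgroup.m_closed)
qed

lemma normal_in_centralizer:
  assumes "normal_in H Y"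
  shows "normal_in (centralizer_in Y H) Y"
proof -
  note d = normal_inD[OF assms]
  have c: "x \<in> carrier G" if "x \<in> Y" for x using that d by (auto simp: subgroup.mem_carrier)
  have "x \<otimes> z \<otimes> inv x \<in> centralizer_in Y H" if x: "x \<in> Y" and z: "z \<in> centralizer_in Y H" for x z
  proof -
    have zX: "z \<in> Y" using z by (auto simp: centralizer_in_def)
    have "x \<otimes> z \<otimes> inv x \<otimes> h = h \<otimes> (x \<otimes> z \<otimes> inv x)" if h: "h \<in> H" for h
    proof -
      have hx: "h \<in> Y" using h d by auto
      have "z \<otimes> (inv x \<otimes> h \<otimes> x) = (inv x \<otimes> h \<otimes> x) \<otimes> z"
        using z normal_in_conj'[OF assms x h] by (simp add: centralizer_in_def)
      then have "x \<otimes> (z \<otimes> (inv x \<otimes> h \<otimes> x)) \<otimes> inv x = x \<otimes> ((inv x \<otimes> h \<otimes> x) \<otimes> z) \<otimes> inv x" by simp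
      then show ?thesis using c[OF x] c[OF zX] c[OF hx] by (simp add: word_simps)
    qed
    moreover have "x \<otimes> z \<otimes> inv x \<in> Y" using x zX d(2) by (simp add: subgroup.m_closed subgroup.m_inv_closed)
    ultimately show ?thesis by (auto simp: centralizer_in_def)
  qed
  then show ?thesis unfolding normal_in_def
    using subgroup_centralizer_in[OF d(2)] d c by (auto simp: centralizer_in_def subset_iff)
qed

section \<open>Actions of \<open>p\<close>-groups and Sylow theory\<close>

text \<open>An orbit outside the fixed points has as size a power of \<open>p\<close> other than 1.
  The action is a bare function constrained only on \<open>H\<close> and \<open>S\<close>, so that
  translation of cosets, conjugation, and conjugation of cosets fit without a homomorphism into a
  permutation group.\<close>

lemma card_fixed_points_cong:
  assumes "subgroup H G" "card H = p ^ k" "prime_nat p" "finite S"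
    and one: "\<And>x. x \<in> S \<Longrightarrow> act \<one> x = x"
    and closed: "\<And>h x. h \<in> H \<Longrightarrow> x \<in> S \<Longrightarrow> act h x \<in> S"
    and mult: "\<And>g h x. g \<in> H \<Longrightarrow> h \<in> H \<Longrightarrow> x \<in> S \<Longrightarrow> act (g \<otimes> h) x = act g (act h x)"
  shows "p dvd card S \<longleftrightarrow> p dvd card {x \<in> S. \<forall>h\<in>H. act h x = x}"
proof -
  define Fix where "Fix = {x \<in> S. \<forall>h\<in>H. act h x = x}"
  define orb where "orb x = (\<lambda>h. act h x) ` H" for x
  note H = subgroup.one_closed[OF assms(1)] subgroup.m_closed[OF assms(1)] subgroup.m_inv_closed[OF assms(1)]
    subgroup.mem_carrier[OF assms(1)]
  have self: "x \<in> orb x" if "x \<in> S" for x using one[OF that] H by (force simp: orb_def)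
  have orbS: "orb x \<subseteq> S" if "x \<in> S" for x using closed that by (auto simp: orb_def)
  have inv_act: "act (inv h) (act h x) = x" if "h \<in> H" "x \<in> S" for h x
    using mult[of "inv h" h x] that H one[of x] by simp
  have orb_sub: "orb y \<subseteq> orb x" if "x \<in> S" "y \<in> orb x" for x y
  proof
    fix z assume "z \<in> orb y"
    with that obtain g h where "g \<in> H" "h \<in> H" "y = act h x" "z = act g y" by (auto simp: orb_def)
    then have "z = act (g \<otimes> h) x" "g \<otimes> h \<in> H" using mult that H by auto
    then show "z \<in> orb x" by (auto simp: orb_def)
  qed
  have orb_eq: "orb y = orb x" if "x \<in> S" "y \<in> orb x" for x y
  proof -
    from that obtain h where "h \<in> H" "y = act h x" by (auto simp: orb_def)
    then have "x = act (inv h) y" "inv h \<in> H" using inv_act that H by auto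
    then have "x \<in> orb y" by (auto simp: orb_def)
    then show ?thesis using orb_sub that orbS by blast
  qed
  have dvd: "p dvd card (orb x)" if x: "x \<in> S - Fix" for x
  proof -
    define K where "K = {h \<in> H. act h x = x}"
    have K: "subgroup K G"
      by (rule subgroup_finI) (use x H mult[of _ _ x] one in \<open>auto simp: K_def\<close>)
    have "card H = card K * card (orb x)"
      unfolding orb_def
    proof (rule card_fibres_subgroup[OF assms(1) K])
      show "K \<subseteq> H" by (auto simp: K_def)
      fix g h assume gh: "g \<in> H" "h \<in> H"
      have "act (inv g \<otimes> h) x = act (inv g) (act h x)" using mult gh x H by auto
      moreover have "act h x = act g (act (inv g) (act h x))"
        using mult[of g "inv g" "act h x"] gh x H closed[of h x] one by simp
      ultimately show "act g x = act h x \<longleftrightarrow> inv g \<otimes> h \<in> K"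
        using gh x H inv_act[of g x] unfolding K_def by auto
    qed
    then have "card (orb x) dvd p ^ k" using assms(2) by simp
    then obtain j where j: "card (orb x) = p ^ j" using divides_primepow_nat[OF assms(3)] by blast
    have "card (orb x) \<noteq> 1"
    proof
      assume "card (orb x) = 1"
      then obtain y where "orb x = {y}" by (rule card_1_singletonE)
      then have "orb x = {x}" using self[of x] x by auto
      then show False using x by (auto simp: orb_def Fix_def)
    qed
    then show ?thesis using j by (cases j) auto
  qed
  have "p dvd card (\<Union> (orb ` (S - Fix)))"
  proof (rule dvd_partition)
    show "finite (\<Union> (orb ` (S - Fix)))"
      using orbS assms(4) by (meson DiffD1 UN_least finite_subset)
    show "\<forall>c\<in>orb ` (S - Fix). p dvd card c" using dvd by auto
    show "\<forall>c1\<in>orb ` (S - Fix). \<forall>c2\<in>orb ` (S - Fix). c1 \<noteq> c2 \<longrightarrow> c1 \<inter> c2 = {}"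
    proof (intro ballI impI)
      fix c1 c2 assume "c1 \<in> orb ` (S - Fix)" "c2 \<in> orb ` (S - Fix)" "c1 \<noteq> c2"
      then show "c1 \<inter> c2 = {}" using orb_eq by (metis DiffD1 disjoint_iff imageE)
    qed
  qed
  moreover have "\<Union> (orb ` (S - Fix)) = S - Fix"
  proof
    show "S - Fix \<subseteq> \<Union> (orb ` (S - Fix))" using self by auto
    show "\<Union> (orb ` (S - Fix)) \<subseteq> S - Fix"
    proof
      fix y assume "y \<in> \<Union> (orb ` (S - Fix))"
      then obtain x where x: "x \<in> S - Fix" "y \<in> orb x" by auto
      have "y \<notin> Fix"
      proof
        assume "y \<in> Fix"
        then have "orb y \<subseteq> {y}" by (auto simp: orb_def Fix_def)
        moreover have "x \<in> orb y" using x orb_eq self by auto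
        ultimately show False using x \<open>y \<in> Fix\<close> by auto
      qed
      then show "y \<in> S - Fix" using x orbS by auto
    qed
  qed
  ultimately have "p dvd card (S - Fix)" by simp
  moreover have "card S = card (S - Fix) + card Fix"
    using card_Int_Diff[OF assms(4), of Fix] by (simp add: Int_absorb1 Fix_def)
  ultimately have "p dvd card S \<longleftrightarrow> p dvd card Fix" by (simp add: dvd_add_right_iff)
  then show ?thesis unfolding Fix_def .
qed

section \<open>Sylow subgroups through fixed cosets\<close>

lemma left_coset_action:
  fixes P :: "'a set"
  assumes "subgroup Y G" "subgroup P G" "P \<subseteq> Y" "subgroup H G" "H \<subseteq> Y"
  defines "S \<equiv> (\<lambda>x. x <# P) ` Y"
  shows "\<And>c. c \<in> S \<Longrightarrow> \<one> <# c = c"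
    "\<And>h c. h \<in> H \<Longrightarrow> c \<in> S \<Longrightarrow> h <# c \<in> S"
    "\<And>g h c. g \<in> H \<Longrightarrow> h \<in> H \<Longrightarrow> c \<in> S \<Longrightarrow> (g \<otimes> h) <# c = g <# (h <# c)"
proof -
  have c: "P \<subseteq> carrier G" "\<And>x. x \<in> Y \<Longrightarrow> x \<in> carrier G" "\<And>x. x \<in> H \<Longrightarrow> x \<in> carrier G"
    using assms by (auto simp: subgroup.mem_carrier)
  have sc: "x <# P \<subseteq> carrier G" if "x \<in> Y" for x using c that by (auto simp: l_coset_def)
  show "\<And>c. c \<in> S \<Longrightarrow> \<one> <# c = c" using sc by (auto simp: S_def lcos_mult_one)
  show "h <# c \<in> S" if "h \<in> H" "c \<in> S" for h c
  proof -
    from that obtain x where x: "x \<in> Y" "c = x <# P" by (auto simp: S_def)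
    then have "h <# c = (h \<otimes> x) <# P" using c that by (simp add: lcos_m_assoc)
    moreover have "h \<otimes> x \<in> Y" using x that assms by (simp add: subgroup.m_closed subsetD)
    ultimately show ?thesis by (simp add: S_def)
  qed
  show "(g \<otimes> h) <# c = g <# (h <# c)" if "g \<in> H" "h \<in> H" "c \<in> S" for g h c
    using that c sc by (auto simp: S_def lcos_m_assoc)
qed

lemma coset_fixed_iff:
  assumes "subgroup P G" "x \<in> carrier G" "h \<in> carrier G"
  shows "h <# (x <# P) = x <# P \<longleftrightarrow> inv x \<otimes> h \<otimes> x \<in> P"
proof -
  have "P \<subseteq> carrier G" using assms(1) by (simp add: subgroup.subset)
  then have "h <# (x <# P) = (h \<otimes> x) <# P" using assms by (simp add: lcos_m_assoc)
  then have "h <# (x <# P) = x <# P \<longleftrightarrow> x <# P = (h \<otimes> x) <# P" by auto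
  then show ?thesis using assms by (simp add: l_coset_eq_iff m_assoc)
qed

text \<open>A subgroup of order \<open>p\<close> of the factor group \<open>Y/H\<close> is a set of
  cosets; their union is the subgroup sought.\<close>

lemma cauchy_quotient:
  assumes "normal_in H Y" "prime_nat p" "p * card H dvd card Y"
  shows "\<exists>K. subgroup K G \<and> H \<subseteq> K \<and> K \<subseteq> Y \<and> card K = p * card H"
proof -
  note d = normal_inD[OF assms(1)]
  let ?Y = "G\<lparr>carrier := Y\<rparr>"
  interpret Y: group ?Y using d by (simp add: subgroup_imp_group)
  have HY: "H \<lhd> ?Y"
    unfolding Y.normal_inv_iff using d subgroup_incl by auto
  interpret n: normal H ?Y by (rule HY)
  have fY: "finite Y" using d subgroup_finite by blast
  have Hpos: "card H > 0" using d subgroup_card_pos by blast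
  have ord: "order (?Y Mod H) * card H = card Y"
    using Y.lagrange[OF n.is_subgroup] by (simp add: order_def FactGroup_def)
  then have "p dvd order (?Y Mod H)" using assms(3) Hpos by (simp flip: ord)
  then obtain m where m: "order (?Y Mod H) = p ^ 1 * m" by (auto elim: dvdE)
  have "finite (carrier (?Y Mod H))" using fY by (simp add: carrier_FactGroup)
  then obtain Q where Q: "subgroup Q (?Y Mod H)" "card Q = p"
    using sylow_thm[OF assms(2) n.factorgroup_is_group m] by auto
  have QK: "subgroup (\<Union>Q) ?Y" using n.factgroup_subgroup_union_subgroup[OF Q(1)] by simp
  have cos: "c \<in> rcosets\<^bsub>?Y\<^esub> H" if "c \<in> Q" for c
    using subgroup.subset[OF Q(1)] that by (auto simp: FactGroup_def)
  have "card (\<Union>Q) = p * card H"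
  proof -
    have "card H * card Q = card (\<Union>Q)"
    proof (rule card_partition)
      show "finite Q" using Q(2) prime_gt_0_nat[OF assms(2)] by (simp add: card_ge_0_finite)
      show "finite (\<Union>Q)" using fY subgroup.subset[OF QK] finite_subset by auto
      show "card c = card H" if "c \<in> Q" for c
        using Y.card_cosets_equal[OF cos[OF that]] n.subset by (auto dest: bij_betw_same_card)
      show "c \<inter> c' = {}" if "c \<in> Q" "c' \<in> Q" "c \<noteq> c'" for c c'
        using Y.rcos_disjoint[OF n.is_subgroup] cos that by (auto simp: pairwise_def disjnt_def)
    qed
    then show ?thesis using Q by (simp add: mult.commute)
  qed
  moreover have "H \<subseteq> \<Union>Q" using subgroup.one_closed[OF Q(1)] by auto
  moreover have "subgroup (\<Union>Q) G" using QK d(2) incl_subgroup by blast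
  moreover have "\<Union>Q \<subseteq> Y" using subgroup.subset[OF QK] by simp
  ultimately show ?thesis by blast
qed

text \<open>The cosets of \<open>H\<close> in \<open>Y\<close> that \<open>H\<close> fixes are those
  inside its normalizer, so \<open>p\<close> divides their number too, and Cauchy's theorem applies
  to the normalizer modulo \<open>H\<close>. For trivial \<open>H\<close> this is Cauchy's theorem
  again; iterated, it yields Sylow subgroups and chains in \<open>p\<close>-groups.\<close>

lemma p_subgroup_extend:
  assumes "subgroup Y G" "subgroup H G" "H \<subseteq> Y" "card H = p ^ k" "prime_nat p" "p * card H dvd card Y"
  shows "\<exists>K. normal_in H K \<and> K \<subseteq> Y \<and> card K = p * card H"
proof -
  define S where "S = (\<lambda>x. x <# H) ` Y"
  define N where "N = normalizer_in Y H"
  have c: "\<And>x. x \<in> Y \<Longrightarrow> x \<in> carrier G" "\<And>x. x \<in> H \<Longrightarrow> x \<in> carrier G"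
    using assms by (auto simp: subgroup.mem_carrier)
  have NH: "normal_in H N" unfolding N_def using normal_in_normalizer assms by blast
  have Ns: "subgroup N G" "H \<subseteq> N" "N \<subseteq> Y" using NH by (auto simp: normal_in_def N_def normalizer_in_def)
  have pos: "card H > 0" using assms subgroup_card_pos by blast
  have fin: "finite S" using assms(1) subgroup_finite by (auto simp: S_def)
  have "card Y = card H * card S" unfolding S_def using card_cosets_subgroup[OF assms(1-3)] .
  then have "p dvd card S" using assms(6) pos by (simp add: mult.commute)
  then have "p dvd card {x \<in> S. \<forall>h\<in>H. h <# x = x}"
    using card_fixed_points_cong[OF assms(2,4,5) fin, of "l_coset G"]
      left_coset_action[OF assms(1-3,2,3)] unfolding S_def by blast
  moreover have "{x \<in> S. \<forall>h\<in>H. h <# x = x} = (\<lambda>x. x <# H) ` N"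
  proof -
    have "(\<forall>h\<in>H. h <# (x <# H) = x <# H) \<longleftrightarrow> x \<in> N" if x: "x \<in> Y" for x
    proof
      assume "\<forall>h\<in>H. h <# (x <# H) = x <# H"
      then have *: "\<forall>h\<in>H. inv x \<otimes> h \<otimes> x \<in> H" using coset_fixed_iff[OF assms(2)] c x by blast
      have "x \<otimes> h \<otimes> inv x \<in> H" if "h \<in> H" for h
        using normal_conj_bij[OF assms(2), of "inv x" h] * c x that by simp
      then show "x \<in> N" using * x by (auto simp: N_def normalizer_in_def)
    next
      assume "x \<in> N"
      then show "\<forall>h\<in>H. h <# (x <# H) = x <# H"
        using coset_fixed_iff[OF assms(2)] c x by (auto simp: N_def normalizer_in_def)
    qed
    then show ?thesis using Ns(3) by (auto simp: S_def)
  qed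
  moreover have "card N = card H * card ((\<lambda>x. x <# H) ` N)"
    using card_cosets_subgroup[OF Ns(1) assms(2) Ns(2)] .
  ultimately have "p * card H dvd card N" by simp
  then obtain K where "subgroup K G" "H \<subseteq> K" "K \<subseteq> N" "card K = p * card H"
    using cauchy_quotient[OF NH assms(5)] by blast
  then show ?thesis using normal_in_mono[OF NH] Ns by blast
qed

lemma cauchy_subgroup:
  assumes "subgroup Y G" "prime_nat p" "p dvd card Y"
  shows "\<exists>K. subgroup K G \<and> K \<subseteq> Y \<and> card K = p"
  using p_subgroup_extend[OF assms(1) triv_subgroup, of p 0] assms subgroup.one_closed[OF assms(1)]
  by (auto dest: normal_inD)

text \<open>The extension step stops exactly when \<open>p * card P\<close> no longer divides
  \<open>card Y\<close>. For a \<open>p\<close>-group \<open>P\<close> this non-divisibility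
  expresses that \<open>P\<close> is a Sylow subgroup without naming the exponent of
  \<open>p\<close> in \<open>card Y\<close>.\<close>

lemma p_subgroup_in_sylow:
  assumes "subgroup Y G" "subgroup H G" "H \<subseteq> Y" "card H = p ^ k" "prime_nat p"
  shows "\<exists>P j. subgroup P G \<and> H \<subseteq> P \<and> P \<subseteq> Y \<and> card P = p ^ j \<and> \<not> p * card P dvd card Y"
  using assms(2-4)
proof (induction "card Y - card H" arbitrary: H k rule: less_induct)
  case less
  show ?case
  proof (cases "p * card H dvd card Y")
    case False
    then show ?thesis using less by blast
  next
    case True
    then obtain K where K: "normal_in H K" "K \<subseteq> Y" "card K = p * card H"
      using p_subgroup_extend[OF assms(1) less.prems(1,2,3) assms(5)] by blast
    note d = normal_inD[OF K(1)]
    have "card H < card K" using K(3) subgroup_card_pos[OF d(1)] prime_gt_1_nat[OF assms(5)] by simp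
    moreover have "card K \<le> card Y" using K(2) subgroup_finite[OF assms(1)] card_mono by blast
    ultimately have "card Y - card K < card Y - card H" by linarith
    then obtain P j where "subgroup P G" "K \<subseteq> P" "P \<subseteq> Y" "card P = p ^ j" "\<not> p * card P dvd card Y"
      using less.hyps[of K "Suc k"] d(2) K less.prems by auto
    then show ?thesis using d(3) by blast
  qed
qed

text \<open>The number of cosets of \<open>P\<close> is not divisible by \<open>p\<close>, so
  \<open>H\<close> fixes some coset \<open>x <# P\<close>, and being fixed means being conjugated
  into \<open>P\<close> by \<open>inv x\<close>.\<close>

lemma p_subgroup_conj_sylow:
  assumes "subgroup Y G" "subgroup P G" "P \<subseteq> Y" "\<not> p * card P dvd card Y"
    "subgroup H G" "H \<subseteq> Y" "card H = p ^ k" "prime_nat p"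
  shows "\<exists>x\<in>Y. \<forall>h\<in>H. inv x \<otimes> h \<otimes> x \<in> P"
proof -
  define S where "S = (\<lambda>x. x <# P) ` Y"
  have c: "\<And>x. x \<in> Y \<Longrightarrow> x \<in> carrier G" using assms by (auto simp: subgroup.mem_carrier)
  have fin: "finite S" using assms(1) subgroup_finite by (auto simp: S_def)
  have "card Y = card P * card S" unfolding S_def using card_cosets_subgroup[OF assms(1-3)] .
  then have "\<not> p dvd card S" using assms(4) by (metis mult.commute mult_dvd_mono dvd_refl)
  then have "\<not> p dvd card {x \<in> S. \<forall>h\<in>H. h <# x = x}"
    using card_fixed_points_cong[OF assms(5,7,8) fin, of "l_coset G"]
      left_coset_action[OF assms(1-3,5,6)] unfolding S_def by blast
  then have "{x \<in> S. \<forall>h\<in>H. h <# x = x} \<noteq> {}" by (metis card.empty dvd_0_right)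
  then obtain x where "x \<in> Y" "\<forall>h\<in>H. h <# (x <# P) = x <# P" by (auto simp: S_def)
  then show ?thesis using coset_fixed_iff[OF assms(2)] c assms(6) by blast
qed

text \<open>The action of \<open>L\<close> on \<open>N\<close> by conjugation has a number of fixed
  points divisible by \<open>p\<close>. The identity is one of them, so there is another.\<close>

lemma p_group_fixed_point:
  assumes "normal_in N Y" "subgroup L G" "L \<subseteq> Y" "card L = p ^ k" "prime_nat p" "p dvd card N"
  shows "\<exists>n\<in>N. n \<noteq> \<one> \<and> (\<forall>l\<in>L. l \<otimes> n = n \<otimes> l)"
proof -
  note d = normal_inD[OF assms(1)]
  have c: "\<And>x. x \<in> Y \<Longrightarrow> x \<in> carrier G" using d by (auto simp: subgroup.mem_carrier)
  have fin: "finite N" using d(1) subgroup_finite by blast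
  let ?F = "{x \<in> N. \<forall>h\<in>L. h \<otimes> x \<otimes> inv h = x}"
  have "p dvd card ?F"
  proof (rule iffD1[OF card_fixed_points_cong[OF assms(2,4,5) fin]])
    show "\<And>x. x \<in> N \<Longrightarrow> \<one> \<otimes> x \<otimes> inv \<one> = x" using c d by auto
    show "\<And>h x. h \<in> L \<Longrightarrow> x \<in> N \<Longrightarrow> h \<otimes> x \<otimes> inv h \<in> N" using d assms(3) by auto
    show "g \<otimes> h \<otimes> x \<otimes> inv (g \<otimes> h) = g \<otimes> (h \<otimes> x \<otimes> inv h) \<otimes> inv g" if "g \<in> L" "h \<in> L" "x \<in> N" for g h x
    proof -
      have "g \<in> carrier G" "h \<in> carrier G" "x \<in> carrier G" using that c d assms(3) by auto
      then show ?thesis by (simp add: word_simps)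
    qed
  qed (rule assms(6))
  moreover have "\<one> \<in> ?F" using d(1) c assms(3) by (auto simp: subgroup.one_closed)
  moreover have "finite ?F" using fin by auto
  ultimately have "card ?F \<noteq> 1" "card ?F \<noteq> card {}" using prime_gt_1_nat[OF assms(5)] by auto
  then have "?F \<noteq> {\<one>}" "?F \<noteq> {}" by (metis (no_types, lifting) is_singletonI is_singleton_altdef, metis)
  then have "\<not> ?F \<subseteq> {\<one>}" by (meson subset_singletonD)
  then obtain n where n: "n \<in> N" "n \<noteq> \<one>" "\<forall>h\<in>L. h \<otimes> n \<otimes> inv h = n" by auto
  have "l \<otimes> n = n \<otimes> l" if "l \<in> L" for l
  proof -
    have cc: "l \<in> carrier G" "n \<in> carrier G" using that n c d assms(3) by auto
    then have "l \<otimes> n = (l \<otimes> n \<otimes> inv l) \<otimes> l" by (simp add: word_simps)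
    then show ?thesis using n(3) that by simp
  qed
  then show ?thesis using n by blast
qed

end

section \<open>Maximal chains and supersolvability\<close>

text \<open>Prime divisors counted with multiplicity: the length of a chain in which every step has
  prime index.\<close>

definition Omega :: "nat \<Rightarrow> nat"
  where "Omega n = size (prime_factorization n)"

lemma Omega_1 [simp]: "Omega 1 = 0" "Omega (Suc 0) = 0"
  by (simp_all add: Omega_def)

lemma Omega_prime_mult: "prime_nat p \<Longrightarrow> n > 0 \<Longrightarrow> Omega (p * n) = Suc (Omega n)"
  by (simp add: Omega_def prime_factorization_mult prime_factorization_prime)

context group
begin

definition maximal_in :: "'a set \<Rightarrow> 'a set \<Rightarrow> bool"
  where "maximal_in M K \<longleftrightarrow> subgroup M G \<and> subgroup K G \<and> M \<subset> K \<and>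
    (\<forall>L. subgroup L G \<and> M \<subseteq> L \<and> L \<subseteq> K \<longrightarrow> L = M \<or> L = K)"

text \<open>Only the length of a chain is recorded, and chains grow at the upper end; concatenation
  is then an induction without indexed families.\<close>

inductive chain_len :: "'a set \<Rightarrow> 'a set \<Rightarrow> nat \<Rightarrow> bool" for H
  where
    chain_refl: "subgroup H G \<Longrightarrow> chain_len H H 0"
  | chain_step: "chain_len H K n \<Longrightarrow> maximal_in K L \<Longrightarrow> chain_len H L (Suc n)"

definition uniform_chains :: "'a set \<Rightarrow> 'a set \<Rightarrow> bool"
  where "uniform_chains H K \<longleftrightarrow> (\<forall>m n. chain_len H K m \<longrightarrow> chain_len H K n \<longrightarrow> m = n)"

definition minimal_uniform :: "'a set \<Rightarrow> bool"
  where "minimal_uniform Y \<longleftrightarrow> subgroup Y G \<and>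
    (\<forall>U. subgroup U G \<and> U \<subseteq> Y \<and> prime_nat (card U) \<longrightarrow> uniform_chains U Y)"

text \<open>For \<open>N\<close> normal in \<open>Y\<close> this is supersolvability of \<open>Y/N\<close>, expressed by normal
  subgroups of \<open>Y\<close>. Asking for a step of prime index inside every interval \<open>K \<subset> W\<close>, instead of
  for one series, makes the notion inherited by larger \<open>N\<close> by definition.\<close>

definition supersolvable_over :: "'a set \<Rightarrow> 'a set \<Rightarrow> bool"
  where "supersolvable_over N Y \<longleftrightarrow> normal_in N Y \<and>
    (\<forall>K W. normal_in K Y \<and> normal_in W Y \<and> N \<subseteq> K \<and> K \<subset> W \<longrightarrow>
      (\<exists>L p. normal_in L Y \<and> K \<subseteq> L \<and> L \<subseteq> W \<and> prime_nat p \<and> card L = p * card K))"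

lemma chain_trans: "chain_len K L n \<Longrightarrow> chain_len H K m \<Longrightarrow> chain_len H L (m + n)"
  by (induction rule: chain_len.induct) (auto intro: chain_step)

lemma chain_maximal: "maximal_in M K \<Longrightarrow> chain_len M K 1"
  using chain_step[OF chain_refl, of M K] by (simp add: maximal_in_def)

text \<open>Chains from \<open>L\<close> to \<open>K\<close>, prolonged downwards by one fixed chain
  from \<open>H\<close> to \<open>L\<close>, become chains from \<open>H\<close>. This rule carries
  the hypothesis to quotients, its dual below carries it to subgroups.\<close>

lemma uniform_chains_above:
  assumes "uniform_chains H K" "chain_len H L m"
  shows "uniform_chains L K"
  using assms chain_trans unfolding uniform_chains_def by (meson add_left_cancel)

lemma uniform_chains_below:
  assumes "uniform_chains H K" "chain_len L K m"
  shows "uniform_chains H L"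
  using assms chain_trans unfolding uniform_chains_def by (meson add_right_cancel)

lemma supersolvable_overD:
  assumes "supersolvable_over N Y" "normal_in K Y" "normal_in W Y" "N \<subseteq> K" "K \<subset> W"
  shows "\<exists>L p. normal_in L Y \<and> K \<subseteq> L \<and> L \<subseteq> W \<and> prime_nat p \<and> card L = p * card K"
  using assms unfolding supersolvable_over_def by blast

lemma supersolvable_over_mono:
  "supersolvable_over N Y \<Longrightarrow> normal_in K Y \<Longrightarrow> N \<subseteq> K \<Longrightarrow> supersolvable_over K Y"
  unfolding supersolvable_over_def by (meson order_trans)

section \<open>Conjugate subgroups\<close>

definition conj_set :: "'a \<Rightarrow> 'a set \<Rightarrow> 'a set"
  where "conj_set x H = (\<lambda>h. x \<otimes> h \<otimes> inv x) ` H"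

lemma subgroup_conj_set:
  assumes "x \<in> carrier G" "subgroup H G"
  shows "subgroup (conj_set x H) G"
proof (rule subgroupI)
  note c = subgroup.mem_carrier[OF assms(2)]
  show "conj_set x H \<subseteq> carrier G" using c assms(1) by (auto simp: conj_set_def)
  show "conj_set x H \<noteq> {}" using subgroup.one_closed[OF assms(2)] by (auto simp: conj_set_def)
  fix a assume "a \<in> conj_set x H"
  then obtain h where h: "h \<in> H" "a = x \<otimes> h \<otimes> inv x" by (auto simp: conj_set_def)
  have "inv a = x \<otimes> inv h \<otimes> inv x" using h c assms(1) by (simp add: word_simps)
  then show "inv a \<in> conj_set x H"
    using subgroup.m_inv_closed[OF assms(2) h(1)] by (auto simp: conj_set_def)
  fix b assume "b \<in> conj_set x H"
  then obtain k where k: "k \<in> H" "b = x \<otimes> k \<otimes> inv x" by (auto simp: conj_set_def)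
  have "a \<otimes> b = x \<otimes> (h \<otimes> k) \<otimes> inv x" using h k c assms(1) by (simp add: word_simps)
  then show "a \<otimes> b \<in> conj_set x H"
    using subgroup.m_closed[OF assms(2) h(1) k(1)] by (auto simp: conj_set_def)
qed

lemma card_conj_set:
  assumes "x \<in> carrier G" "H \<subseteq> carrier G"
  shows "card (conj_set x H) = card H"
  unfolding conj_set_def by (rule card_image) (use assms in \<open>auto simp: inj_on_def subset_iff\<close>)

lemma conj_set_inv:
  assumes "x \<in> carrier G" "H \<subseteq> carrier G"
  shows "conj_set (inv x) (conj_set x H) = H"
proof -
  have "(\<lambda>h. inv x \<otimes> (x \<otimes> h \<otimes> inv x) \<otimes> inv (inv x)) ` H = (\<lambda>h. h) ` H"
    by (rule image_cong) (use assms in \<open>auto simp: word_simps subset_iff\<close>)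
  then show ?thesis by (simp add: conj_set_def image_image)
qed

lemma conj_set_self:
  assumes "subgroup Y G" "x \<in> Y"
  shows "conj_set x Y = Y"
proof
  note c = subgroup.mem_carrier[OF assms(1)]
  have 1: "conj_set y Y \<subseteq> Y" if "y \<in> Y" for y
    using that assms(1) by (auto simp: conj_set_def subgroup.m_closed subgroup.m_inv_closed)
  show "conj_set x Y \<subseteq> Y" using 1 assms by blast
  have "conj_set (inv x) Y \<subseteq> Y" using 1 assms by (simp add: subgroup.m_inv_closed)
  then have "conj_set (inv (inv x)) (conj_set (inv x) Y) \<subseteq> conj_set (inv (inv x)) Y"
    unfolding conj_set_def by blast
  then show "Y \<subseteq> conj_set x Y"
    using conj_set_inv[of "inv x" Y] c assms by (simp add: subgroup.subset)
qed

lemma conj_set_mono: "H \<subseteq> K \<Longrightarrow> conj_set x H \<subseteq> conj_set x K"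
  by (auto simp: conj_set_def)

lemma maximal_in_conj:
  assumes "maximal_in M K" "x \<in> carrier G"
  shows "maximal_in (conj_set x M) (conj_set x K)"
proof -
  have s: "subgroup M G" "subgroup K G" "M \<subset> K"
    and m: "\<And>L. subgroup L G \<Longrightarrow> M \<subseteq> L \<Longrightarrow> L \<subseteq> K \<Longrightarrow> L = M \<or> L = K"
    using assms(1) by (auto simp: maximal_in_def)
  have c: "M \<subseteq> carrier G" "K \<subseteq> carrier G" using s by (auto simp: subgroup.subset)
  have ne: "conj_set x M \<noteq> conj_set x K" using conj_set_inv[OF assms(2)] c s(3) by (metis order_less_irrefl)
  have "L = conj_set x M \<or> L = conj_set x K"
    if L: "subgroup L G" "conj_set x M \<subseteq> L" "L \<subseteq> conj_set x K" for L
  proof -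
    have "M \<subseteq> conj_set (inv x) L" "conj_set (inv x) L \<subseteq> K"
      using conj_set_mono[OF L(2), of "inv x"] conj_set_mono[OF L(3), of "inv x"] conj_set_inv[OF assms(2)] c by auto
    then have "conj_set (inv x) L = M \<or> conj_set (inv x) L = K"
      using m[of "conj_set (inv x) L"] subgroup_conj_set[OF _ L(1)] assms(2) by auto
    moreover have "conj_set x (conj_set (inv x) L) = L"
      using conj_set_inv[of "inv x" L] assms(2) L(1) by (simp add: subgroup.subset)
    ultimately show ?thesis by metis
  qed
  then show ?thesis
    unfolding maximal_in_def using s ne subgroup_conj_set[OF assms(2)] conj_set_mono[of M K x] by blast
qed

lemma chain_len_conj:
  "chain_len H K n \<Longrightarrow> x \<in> carrier G \<Longrightarrow> chain_len (conj_set x H) (conj_set x K) n"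
  by (induction rule: chain_len.induct)
    (auto intro: chain_len.intros subgroup_conj_set maximal_in_conj)

end

context fin_group
begin

lemma maximal_in_prime_index:
  assumes "subgroup M G" "subgroup K G" "M \<subseteq> K" "card K = p * card M" "prime_nat p"
  shows "maximal_in M K"
proof -
  have pos: "card M > 0" using assms subgroup_card_pos by blast
  then have "M \<noteq> K" using assms(4) prime_gt_1_nat[OF assms(5)] by auto
  moreover have "L = M \<or> L = K" if L: "subgroup L G" "M \<subseteq> L" "L \<subseteq> K" for L
  proof -
    obtain j where j: "card L = card M * j" using card_subgroup_dvd[OF assms(1) L(1,2)] by (auto elim: dvdE)
    have "card L dvd card K" using card_subgroup_dvd[OF L(1) assms(2) L(3)] .
    then have "j dvd p" using j assms(4) pos by simp
    then have "j = 1 \<or> j = p" using assms(5) prime_nat_iff by blast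
    then have "card M = card L \<or> card L = card K" using j assms(4) by auto
    then show ?thesis using subgroup_eq_card[OF L(1,2)] subgroup_eq_card[OF assms(2) L(3)] by auto
  qed
  ultimately show ?thesis using assms by (auto simp: maximal_in_def)
qed

lemma chain_exists:
  assumes "subgroup H G" "subgroup K G" "H \<subseteq> K"
  shows "\<exists>n. chain_len H K n"
  using assms
proof (induction "card K" arbitrary: K rule: less_induct)
  case less
  show ?case
  proof (cases "H = K")
    case True
    then show ?thesis using chain_refl less by blast
  next
    case False
    let ?S = "{M. subgroup M G \<and> H \<subseteq> M \<and> M \<subset> K}"
    have K: "finite K" using less subgroup_finite by blast
    have fin: "finite ?S" by (rule finite_subset[of _ "Pow K"]) (use K in auto)
    moreover have "H \<in> ?S" using less False by auto
    ultimately obtain M where M: "M \<in> ?S" "\<forall>L\<in>?S. M \<subseteq> L \<longrightarrow> M = L"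
      using finite_has_maximal[of ?S] by blast
    have "maximal_in M K"
      unfolding maximal_in_def using M less.prems by blast
    moreover have "card M < card K" using M K by (auto intro: psubset_card_mono)
    then obtain n where "chain_len H M n" using less.hyps[of M] M less.prems by blast
    ultimately show ?thesis using chain_step by blast
  qed
qed

lemma minimal_uniform_subgroup:
  assumes "minimal_uniform Y" "subgroup Z G" "Z \<subseteq> Y"
  shows "minimal_uniform Z"
proof -
  obtain m where "chain_len Z Y m" using chain_exists[OF assms(2) _ assms(3)] assms(1) by (auto simp: minimal_uniform_def)
  then show ?thesis using assms uniform_chains_below unfolding minimal_uniform_def by (meson order_trans)
qed

lemma prime_index_Int:
  assumes "subgroup N0 G" "subgroup N1 G" "N0 \<subseteq> N1" "card N1 = p * card N0" "prime_nat p"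
    "subgroup K G" "N0 \<subseteq> K"
  shows "N1 \<subseteq> K \<or> N1 \<inter> K = N0"
proof -
  have "maximal_in N0 N1" using maximal_in_prime_index assms by blast
  moreover have "subgroup (N1 \<inter> K) G" using assms by (simp add: subgroups_Inter_pair)
  ultimately show ?thesis using assms(3,7) unfolding maximal_in_def by (metis Int_greatest Int_lower1 inf.absorb_iff1)
qed

lemma card_prod_prime_index:
  assumes "subgroup N0 G" "subgroup N1 G" "card N1 = p * card N0" "subgroup K G" "N1 \<inter> K = N0"
  shows "card (N1 <#> K) = p * card K"
proof -
  have "card (N1 <#> K) * card N0 = p * card N0 * card K"
    using card_set_mult[OF assms(2,4)] assms(3,5) by simp
  then show ?thesis using subgroup_card_pos[OF assms(1)] by (simp add: mult.commute mult.left_commute)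
qed

text \<open>For a prime step \<open>L\<close> above \<open>N\<close>, either \<open>L\<close>
  already lies in \<open>H\<close> and replaces \<open>N\<close>, or \<open>L <#> H\<close> is a
  prime step above \<open>H\<close>. All steps of the resulting chain have prime index, so its
  length depends only on the index of \<open>H\<close>.\<close>

lemma supersolvable_chain:
  assumes "supersolvable_over N Y" "subgroup H G" "N \<subseteq> H" "H \<subseteq> Y"
  shows "chain_len H Y (Omega (card Y div card H))"
  using assms
proof (induction "card Y - card N" arbitrary: N H rule: less_induct)
  case less
  have n: "normal_in N Y" using less.prems by (simp add: supersolvable_over_def)
  note d = normal_inD[OF n]
  have posY: "card Y > 0" and posH: "card H > 0" and posN: "card N > 0"
    using d less.prems subgroup_card_pos by auto
  show ?case
  proof (cases "N = Y")
    case True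
    then have "H = Y" using less.prems by auto
    then show ?thesis using chain_refl d posY by simp
  next
    case False
    then obtain L p where L: "normal_in L Y" "N \<subseteq> L" "prime_nat p" "card L = p * card N"
      using supersolvable_overD[OF less.prems(1) n normal_in_self[OF d(2)] subset_refl] d(3) by blast
    note dL = normal_inD[OF L(1)]
    have ss: "supersolvable_over L Y" using supersolvable_over_mono less.prems L by blast
    have "card L \<le> card Y" using dL subgroup_finite card_mono by blast
    moreover have "card N < card L" using L posN prime_gt_1_nat[OF L(3)] by simp
    ultimately have lt: "card Y - card L < card Y - card N" by linarith
    show ?thesis
    proof (cases "L \<subseteq> H")
      case True
      then show ?thesis using less.hyps[OF lt ss less.prems(2)] less.prems by blast
    next
      case F: False
      then have LH: "L \<inter> H = N" using prime_index_Int[OF d(1) dL(1) L(2,4,3) less.prems(2,3)] by blast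
      have sub: "subgroup (L <#> H) G" using subgroup_prod[OF L(1) less.prems(2,4)] .
      have sup: "L \<subseteq> L <#> H" "H \<subseteq> L <#> H" using set_mult_superset dL less.prems by auto
      have le: "L <#> H \<subseteq> Y" using set_mult_subset dL less.prems by auto
      have c: "card (L <#> H) = p * card H" using card_prod_prime_index[OF d(1) dL(1) L(4) less.prems(2) LH] .
      have "maximal_in H (L <#> H)" using maximal_in_prime_index[OF less.prems(2) sub sup(2) c L(3)] .
      then have "chain_len H (L <#> H) 1" by (rule chain_maximal)
      moreover have "chain_len (L <#> H) Y (Omega (card Y div card (L <#> H)))"
        using less.hyps[OF lt ss sub sup(1) le] .
      ultimately have "chain_len H Y (1 + Omega (card Y div card (L <#> H)))" using chain_trans by blast
      moreover obtain r where r: "card Y = p * card H * r"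
        using card_subgroup_dvd[OF sub d(2) le] c by (auto elim: dvdE)
      then have "r > 0" using posY by (cases r) auto
      moreover have "card Y div card H = p * r" "card Y div card (L <#> H) = r"
        using r c posH prime_gt_0_nat[OF L(3)] by auto
      ultimately show ?thesis using Omega_prime_mult[OF L(3)] by simp
    qed
  qed
qed

text \<open>The interval from \<open>K\<close> to \<open>W\<close> is shifted by \<open>N1\<close>.
  If \<open>N1\<close> lies in \<open>W\<close> but not in \<open>K\<close>, then
  \<open>N1 <#> K\<close> is itself the step; if it lies in neither, a step \<open>L\<close> between
  \<open>N1 <#> K\<close> and \<open>N1 <#> W\<close> is intersected with \<open>W\<close>, and the
  modular law keeps its index.\<close>

lemma supersolvable_over_prime_index:
  assumes "normal_in N0 Y" "supersolvable_over N1 Y" "N0 \<subseteq> N1" "card N1 = p * card N0" "prime_nat p"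
  shows "supersolvable_over N0 Y"
  unfolding supersolvable_over_def
proof (intro conjI allI impI, rule assms(1), elim conjE)
  fix K W assume K: "normal_in K Y" "N0 \<subseteq> K" and W: "normal_in W Y" "K \<subset> W"
  have N1: "normal_in N1 Y" using assms(2) by (simp add: supersolvable_over_def)
  note d0 = normal_inD[OF assms(1)] and d1 = normal_inD[OF N1] and dK = normal_inD[OF K(1)] and dW = normal_inD[OF W(1)]
  show "\<exists>L q. normal_in L Y \<and> K \<subseteq> L \<and> L \<subseteq> W \<and> prime_nat q \<and> card L = q * card K"
  proof (cases "N1 \<subseteq> K")
    case True
    then show ?thesis using supersolvable_overD[OF assms(2) K(1) W(1)] W(2) by metis
  next
    case False
    then have NK: "N1 \<inter> K = N0" using prime_index_Int[OF d0(1) d1(1) assms(3-5) dK(1) K(2)] by blast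
    have cNK: "card (N1 <#> K) = p * card K" using card_prod_prime_index[OF d0(1) d1(1) assms(4) dK(1) NK] .
    have nNK: "normal_in (N1 <#> K) Y" using normal_in_prod[OF N1 K(1)] .
    have KNK: "K \<subseteq> N1 <#> K" "N1 \<subseteq> N1 <#> K" using set_mult_superset d1 dK by auto
    show ?thesis
    proof (cases "N1 \<subseteq> W")
      case True
      then have "N1 <#> K \<subseteq> W" using set_mult_subset[OF dW(1)] W(2) by auto
      then show ?thesis using nNK cNK assms(5) KNK by blast
    next
      case False
      then have NW: "N1 \<inter> W = N0" using prime_index_Int[OF d0(1) d1(1) assms(3-5) dW(1)] W(2) K(2) by blast
      have cNW: "card (N1 <#> W) = p * card W" using card_prod_prime_index[OF d0(1) d1(1) assms(4) dW(1) NW] .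
      have nNW: "normal_in (N1 <#> W) Y" using normal_in_prod[OF N1 W(1)] .
      have "card K < card W" using W(2) dW(1) subgroup_finite psubset_card_mono by blast
      then have "N1 <#> K \<noteq> N1 <#> W" using cNK cNW prime_gt_0_nat[OF assms(5)] by auto
      moreover have "N1 <#> K \<subseteq> N1 <#> W" using mono_set_mult[of N1 N1 K W G] W(2) by auto
      ultimately obtain L q where L: "normal_in L Y" "N1 <#> K \<subseteq> L" "L \<subseteq> N1 <#> W" "prime_nat q" "card L = q * card (N1 <#> K)"
        using supersolvable_overD[OF assms(2) nNK nNW KNK(2)] by blast
      note dL = normal_inD[OF L(1)]
      have LW: "normal_in (L \<inter> W) Y" using normal_in_Int L W by blast
      have "L = N1 <#> (L \<inter> W)" using dedekind_prod[OF d1(1) dW(1) dL(1) _ L(3)] KNK L(2) by blast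
      moreover have "N1 \<inter> (L \<inter> W) = N0" using NW KNK L(2) by blast
      then have "card (N1 <#> (L \<inter> W)) = p * card (L \<inter> W)"
        using card_prod_prime_index[OF d0(1) d1(1) assms(4)] normal_inD[OF LW] by blast
      ultimately have "card L = p * card (L \<inter> W)" by metis
      then have "p * card (L \<inter> W) = p * (q * card K)" unfolding L(5) cNK by (metis mult.left_commute)
      then have "card (L \<inter> W) = q * card K" by (simp only: nat_mult_eq_cancel1[OF prime_gt_0_nat[OF assms(5)]])
      moreover have "K \<subseteq> L \<inter> W" using L(2) KNK W(2) by blast
      ultimately show ?thesis using LW L(4) by blast
    qed
  qed
qed

lemma p_group_chain:
  assumes "prime_nat p" "subgroup P G" "card P = p ^ k" "subgroup H G" "H \<subseteq> P" "card H = p ^ j"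
  shows "chain_len H P (k - j)"
  using assms(4-)
proof (induction "k - j" arbitrary: H j)
  case 0
  have "p ^ j \<le> p ^ k" using 0 assms card_mono[OF subgroup_finite[OF assms(2)], of H] by simp
  then have "j \<le> k" using prime_gt_1_nat[OF assms(1)] by (simp add: power_increasing_iff)
  then have "H = P" using 0 subgroup_eq_card[OF assms(2)] assms(3) by simp
  then show ?case using 0 chain_refl by simp
next
  case (Suc m)
  have "p * card H = p ^ Suc j" using Suc by simp
  then have "p * card H dvd card P" using Suc.hyps(2) assms(3) by (simp add: le_imp_power_dvd del: power_Suc)
  then obtain K where K: "normal_in H K" "K \<subseteq> P" "card K = p * card H"
    using p_subgroup_extend[OF assms(2) Suc.prems assms(1)] by blast
  note d = normal_inD[OF K(1)]
  have "chain_len K P (k - Suc j)" using Suc.hyps(1)[of "Suc j" K] Suc.hyps(2) Suc.prems d K by simp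
  moreover have "chain_len H K 1" using chain_maximal[OF maximal_in_prime_index[OF d(1-3) K(3) assms(1)]] .
  ultimately have "chain_len H P (1 + (k - Suc j))" using chain_trans by blast
  moreover have "1 + (k - Suc j) = k - j" using Suc.hyps(2) by linarith
  ultimately show ?case by simp
qed

end

section \<open>Quotients\<close>

text \<open>The quotient \<open>Y/N\<close> enters only through a surjection with kernel
  \<open>N\<close>, so the lattice correspondence does not depend on how its elements are
  represented.\<close>

locale quotient_map = fin_group G + Q: fin_group Q
  for G (structure) and Q (structure) +
  fixes Y :: "'a set" and h :: "'a \<Rightarrow> 'c" and N :: "'a set"
  assumes Y: "subgroup Y G"
    and h_mult: "\<And>x y. x \<in> Y \<Longrightarrow> y \<in> Y \<Longrightarrow> h (x \<otimes> y) = h x \<otimes>\<^bsub>Q\<^esub> h y"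
    and h_image: "h ` Y = carrier Q"
    and h_ker: "N = {x \<in> Y. h x = \<one>\<^bsub>Q\<^esub>}"
begin

lemma Yc: "x \<in> Y \<Longrightarrow> x \<in> carrier G"
  using Y by (simp add: subgroup.mem_carrier)

lemma Y_closed: "\<one> \<in> Y" "x \<in> Y \<Longrightarrow> y \<in> Y \<Longrightarrow> x \<otimes> y \<in> Y" "x \<in> Y \<Longrightarrow> inv x \<in> Y"
  using Y by (auto simp: subgroup.one_closed subgroup.m_closed subgroup.m_inv_closed)

lemma h_in: "x \<in> Y \<Longrightarrow> h x \<in> carrier Q"
  using h_image by blast

lemma h_one: "h \<one> = \<one>\<^bsub>Q\<^esub>"
proof -
  have "h \<one> \<otimes>\<^bsub>Q\<^esub> h \<one> = h \<one>" using h_mult[of \<one> \<one>] Y_closed(1) by simp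
  then show ?thesis using h_in Y_closed(1) Q.l_cancel_one by blast
qed

lemma h_inv: "x \<in> Y \<Longrightarrow> h (inv x) = inv\<^bsub>Q\<^esub> (h x)"
  using h_mult[of "inv x" x] h_in h_one Y_closed Yc by (simp add: Q.inv_equality)

definition pre :: "'c set \<Rightarrow> 'a set"
  where "pre A = {x \<in> Y. h x \<in> A}"

lemma pre_subset: "pre A \<subseteq> Y"
  by (auto simp: pre_def)

lemma pre_mono: "A \<subseteq> B \<Longrightarrow> pre A \<subseteq> pre B"
  by (auto simp: pre_def)

lemma pre_carrier: "pre (carrier Q) = Y"
  using h_in by (auto simp: pre_def)

lemma pre_one: "pre {\<one>\<^bsub>Q\<^esub>} = N"
  by (auto simp: pre_def h_ker)

lemma image_pre: "A \<subseteq> carrier Q \<Longrightarrow> h ` pre A = A"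
  using h_image by (auto simp: pre_def)

lemma pre_subgroup:
  assumes "subgroup A Q"
  shows "subgroup (pre A) G"
  by (rule subgroup_finI)
    (use assms Yc in \<open>auto simp: pre_def Y_closed h_one h_mult subgroup.one_closed subgroup.m_closed\<close>)

lemma N_subgroup: "subgroup N G"
  using pre_subgroup[OF Q.triv_subgroup] pre_one by simp

lemma N_sub_pre: "subgroup A Q \<Longrightarrow> N \<subseteq> pre A"
  by (auto simp: h_ker pre_def subgroup.one_closed)

lemma image_subgroup:
  assumes "subgroup L G" "L \<subseteq> Y"
  shows "subgroup (h ` L) Q"
proof (rule Q.subgroup_finI)
  show "h ` L \<subseteq> carrier Q" using assms h_in by auto
  show "\<one>\<^bsub>Q\<^esub> \<in> h ` L" using h_one subgroup.one_closed[OF assms(1)] by (metis imageI)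
  fix a b assume "a \<in> h ` L" "b \<in> h ` L"
  then obtain x y where xy: "x \<in> L" "y \<in> L" "a = h x" "b = h y" by auto
  then have "a \<otimes>\<^bsub>Q\<^esub> b = h (x \<otimes> y)" using h_mult[of x y] subsetD[OF assms(2)] by auto
  then show "a \<otimes>\<^bsub>Q\<^esub> b \<in> h ` L" using xy subgroup.m_closed[OF assms(1)] by blast
qed

lemma pre_image:
  assumes "subgroup L G" "N \<subseteq> L" "L \<subseteq> Y"
  shows "pre (h ` L) = L"
proof
  show "L \<subseteq> pre (h ` L)" using assms by (auto simp: pre_def)
  show "pre (h ` L) \<subseteq> L"
  proof
    fix x assume "x \<in> pre (h ` L)"
    then obtain y where x: "x \<in> Y" "y \<in> L" "h x = h y" by (auto simp: pre_def)
    then have y: "y \<in> Y" using assms by auto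
    then have "h (x \<otimes> inv y) = \<one>\<^bsub>Q\<^esub>" using x by (simp add: h_mult h_inv h_in Y_closed)
    then have "x \<otimes> inv y \<in> L" using assms(2) x y Y_closed by (auto simp: h_ker)
    then have "x \<otimes> inv y \<otimes> y \<in> L" using x(2) subgroup.m_closed[OF assms(1)] by blast
    then show "x \<in> L" using x y Yc by (simp add: m_assoc)
  qed
qed

lemma pre_normal:
  assumes "Q.normal_in A (carrier Q)"
  shows "normal_in (pre A) Y"
proof -
  note d = Q.normal_inD[OF assms]
  have "x \<otimes> n \<otimes> inv x \<in> pre A" if "x \<in> Y" "n \<in> pre A" for x n
    using that d(4)[of "h x" "h n"] h_in by (auto simp: pre_def Y_closed h_mult h_inv)
  then show ?thesis using pre_subgroup[OF d(1)] Y pre_subset by (auto simp: normal_in_def)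
qed

lemma image_normal:
  assumes "normal_in L Y"
  shows "Q.normal_in (h ` L) (carrier Q)"
proof -
  note d = normal_inD[OF assms]
  have "x \<otimes>\<^bsub>Q\<^esub> n \<otimes>\<^bsub>Q\<^esub> inv\<^bsub>Q\<^esub> x \<in> h ` L" if x: "x \<in> carrier Q" and n: "n \<in> h ` L" for x n
  proof -
    have "x \<in> h ` Y" using x h_image by simp
    then obtain a l where al: "a \<in> Y" "x = h a" "l \<in> L" "n = h l" using n by blast
    then have "x \<otimes>\<^bsub>Q\<^esub> n \<otimes>\<^bsub>Q\<^esub> inv\<^bsub>Q\<^esub> x = h (a \<otimes> l \<otimes> inv a)"
      using d(3) by (auto simp: h_mult h_inv Y_closed subset_iff)
    then show ?thesis using d(4) al by auto
  qed
  then show ?thesis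
    using image_subgroup[OF d(1,3)] Q.subgroup_self subgroup.subset[OF image_subgroup[OF d(1,3)]]
    by (simp add: Q.normal_in_def)
qed

lemma card_pre:
  assumes "subgroup A Q"
  shows "card (pre A) = card N * card A"
proof -
  have "card (pre A) = card N * card (h ` pre A)"
  proof (rule card_fibres_subgroup[OF pre_subgroup[OF assms] N_subgroup N_sub_pre[OF assms]])
    fix x y assume "x \<in> pre A" "y \<in> pre A"
    then have xy: "x \<in> Y" "y \<in> Y" by (auto simp: pre_def)
    have hx: "h x \<in> carrier Q" "h y \<in> carrier Q" using h_in xy by auto
    have "h (inv x \<otimes> y) = inv\<^bsub>Q\<^esub> (h x) \<otimes>\<^bsub>Q\<^esub> h y" using xy by (simp add: h_mult h_inv Y_closed)
    then have "h (inv x \<otimes> y) = \<one>\<^bsub>Q\<^esub> \<longleftrightarrow> h x = h y"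
      using Q.inv_solve_left'[of "\<one>\<^bsub>Q\<^esub>" "h x" "h y"] hx by auto
    then show "h x = h y \<longleftrightarrow> inv x \<otimes> y \<in> N" using xy Y_closed by (auto simp: h_ker)
  qed
  then show ?thesis using image_pre assms by (simp add: subgroup.subset)
qed

lemma maximal_in_pre:
  assumes "Q.maximal_in A B"
  shows "maximal_in (pre A) (pre B)"
proof -
  have s: "subgroup A Q" "subgroup B Q" "A \<subset> B"
    and m: "\<And>L. subgroup L Q \<Longrightarrow> A \<subseteq> L \<Longrightarrow> L \<subseteq> B \<Longrightarrow> L = A \<or> L = B"
    using assms by (auto simp: Q.maximal_in_def)
  have c: "A \<subseteq> carrier Q" "B \<subseteq> carrier Q" using s by (auto simp: subgroup.subset)
  have "pre A \<noteq> pre B"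
  proof
    assume "pre A = pre B"
    then have "h ` pre A = h ` pre B" by (rule arg_cong)
    then have "A = B" unfolding image_pre[OF c(1)] image_pre[OF c(2)] .
    then show False using s(3) by simp
  qed
  moreover have "L = pre A \<or> L = pre B" if L: "subgroup L G" "pre A \<subseteq> L" "L \<subseteq> pre B" for L
  proof -
    have "L \<subseteq> Y" "N \<subseteq> L" using L pre_subset N_sub_pre[OF s(1)] by blast+
    then have "pre (h ` L) = L" "subgroup (h ` L) Q" using pre_image image_subgroup L(1) by auto
    moreover have "A \<subseteq> h ` L" using image_mono[OF L(2), of h] image_pre c by simp
    moreover have "h ` L \<subseteq> B" using image_mono[OF L(3), of h] image_pre c by simp
    ultimately show ?thesis using m by metis
  qed
  ultimately show ?thesis
    unfolding maximal_in_def using pre_subgroup s pre_mono[of A B] by blast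
qed

lemma chain_len_pre: "Q.chain_len A B n \<Longrightarrow> chain_len (pre A) (pre B) n"
  by (induction rule: Q.chain_len.induct) (auto intro: chain_len.intros pre_subgroup maximal_in_pre)

text \<open>\<open>pre\<close> and the image under \<open>h\<close> are inverse to each other on
  normal subgroups above \<open>N\<close>, and \<open>pre\<close> multiplies orders by
  \<open>card N\<close>; a prime step in \<open>Q\<close> pulls back to a step with the same
  prime.\<close>

lemma supersolvable_pullback:
  assumes "Q.supersolvable_over {\<one>\<^bsub>Q\<^esub>} (carrier Q)"
  shows "supersolvable_over N Y"
  unfolding supersolvable_over_def
proof (intro conjI allI impI)
  show "normal_in N Y" using pre_normal[OF Q.normal_in_one[OF Q.subgroup_self]] pre_one by simp
  fix K W assume "normal_in K Y \<and> normal_in W Y \<and> N \<subseteq> K \<and> K \<subset> W"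
  then have a: "normal_in K Y" "normal_in W Y" "N \<subseteq> K" "K \<subset> W" by auto
  note dK = normal_inD[OF a(1)] and dW = normal_inD[OF a(2)]
  have p: "pre (h ` K) = K" "pre (h ` W) = W"
    using pre_image[OF dK(1) a(3) dK(3)] pre_image[OF dW(1) _ dW(3)] a(3,4) by blast+
  have "h ` K \<noteq> h ` W"
  proof
    assume "h ` K = h ` W"
    then have "pre (h ` K) = pre (h ` W)" by (rule arg_cong)
    then have "K = W" unfolding p .
    then show False using a(4) by simp
  qed
  then have "h ` K \<subset> h ` W" using image_mono[of K W h] a(4) by (simp add: psubset_eq)
  moreover have "{\<one>\<^bsub>Q\<^esub>} \<subseteq> h ` K" using subgroup.one_closed[OF image_subgroup[OF dK(1,3)]] by auto
  ultimately obtain L q where L: "Q.normal_in L (carrier Q)" "h ` K \<subseteq> L" "L \<subseteq> h ` W" "prime_nat q" "card L = q * card (h ` K)"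
    using Q.supersolvable_overD[OF assms image_normal[OF a(1)] image_normal[OF a(2)]] by blast
  have "card (pre L) = q * card K"
    using card_pre[OF Q.normal_inD(1)[OF L(1)]] card_pre[OF image_subgroup[OF dK(1,3)]] L(5) p by simp
  moreover have "K \<subseteq> pre L" "pre L \<subseteq> W" using pre_mono[OF L(2)] pre_mono[OF L(3)] unfolding p by simp_all
  ultimately show "\<exists>L p. normal_in L Y \<and> K \<subseteq> L \<and> L \<subseteq> W \<and> prime_nat p \<and> card L = p * card K"
    using pre_normal[OF L(1)] L(4) by blast
qed

text \<open>A subgroup \<open>U\<close> of prime order inside \<open>N\<close> starts chains through
  \<open>N\<close>. Its uniformity descends to chains from \<open>N\<close>, which are the chains of
  \<open>Q\<close> from the trivial subgroup, and from there to every other starting point in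
  \<open>Q\<close>.\<close>

lemma quotient_minimal_uniform:
  assumes "minimal_uniform Y" "N \<noteq> {\<one>}"
  shows "Q.uniform_chains {\<one>\<^bsub>Q\<^esub>} (carrier Q)" "Q.minimal_uniform (carrier Q)"
proof -
  have N: "N \<subseteq> Y" by (auto simp: h_ker)
  have "card N \<noteq> 1"
    using assms(2) subgroup.one_closed[OF N_subgroup] by (auto simp: card_1_singleton_iff)
  then obtain p where "prime_nat p" "p dvd card N" using prime_factor_nat by blast
  then obtain U where U: "subgroup U G" "U \<subseteq> N" "card U = p" "prime_nat p" using cauchy_subgroup[OF N_subgroup] by blast
  obtain m where "chain_len U N m" using chain_exists[OF U(1) N_subgroup U(2)] by blast
  moreover have "uniform_chains U Y" using assms(1) U N by (auto simp: minimal_uniform_def)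
  ultimately have "uniform_chains N Y" using uniform_chains_above by blast
  then show u: "Q.uniform_chains {\<one>\<^bsub>Q\<^esub>} (carrier Q)"
    using chain_len_pre[of "{\<one>\<^bsub>Q\<^esub>}" "carrier Q"] unfolding uniform_chains_def Q.uniform_chains_def pre_one pre_carrier by blast
  have "Q.uniform_chains V (carrier Q)" if V: "subgroup V Q" "prime_nat (card V)" for V
  proof -
    have "Q.maximal_in {\<one>\<^bsub>Q\<^esub>} V"
      by (rule Q.maximal_in_prime_index[OF Q.triv_subgroup V(1)]) (use V subgroup.one_closed in auto)
    then show ?thesis using Q.uniform_chains_above[OF u Q.chain_maximal] by blast
  qed
  then show "Q.minimal_uniform (carrier Q)" by (simp add: Q.minimal_uniform_def Q.subgroup_self)
qed

end

context fin_group
begin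

text \<open>The quotient is realised on coset representatives, so that it has the same type as \<open>G\<close>
  and inductive hypotheses about groups of that type apply to it.\<close>

lemma quotient_same_type:
  assumes "normal_in N Y"
  shows "\<exists>Q :: ('a, 'b) monoid_scheme. \<exists>h. quotient_map G Q Y h N \<and> card (carrier Q) * card N = card Y"
proof -
  note d = normal_inD[OF assms]
  have c: "x \<in> Y \<Longrightarrow> x \<in> carrier G" for x using d(2) by (simp add: subgroup.mem_carrier)
  note Yc = subgroup.m_closed[OF d(2)] subgroup.m_inv_closed[OF d(2)] subgroup.one_closed[OF d(2)]
  define r where "r x = (SOME y. y \<in> x <# N)" for x
  have r: "r x \<in> x <# N" if "x \<in> Y" for x
  proof -
    have "x \<in> x <# N" using c[OF that] subgroup.one_closed[OF d(1)] by (force simp: l_coset_def)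
    then show ?thesis unfolding r_def by (rule someI[of "\<lambda>y. y \<in> x <# N"])
  qed
  have r': "r x \<in> Y" "inv x \<otimes> r x \<in> N" if x: "x \<in> Y" for x
  proof -
    obtain n where n: "n \<in> N" "r x = x \<otimes> n" using r[OF x] by (auto simp: l_coset_def)
    then show "r x \<in> Y" using x Yc d(3) by auto
    show "inv x \<otimes> r x \<in> N" using n c x d(3) by (auto simp: cancel_inv)
  qed
  have req: "r x = r y \<longleftrightarrow> inv x \<otimes> y \<in> N" if "x \<in> Y" "y \<in> Y" for x y
  proof
    assume "inv x \<otimes> y \<in> N"
    then have "x <# N = y <# N" using l_coset_eq_iff[OF d(1)] c that by auto
    then show "r x = r y" by (simp add: r_def)
  next
    assume e: "r x = r y"
    have "inv x \<otimes> y = (inv x \<otimes> r x) \<otimes> inv (inv y \<otimes> r x)"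
      using c that r' by (simp add: word_simps)
    moreover have "inv (inv y \<otimes> r x) \<in> N" using r'[OF that(2)] e subgroup.m_inv_closed[OF d(1)] by simp
    ultimately show "inv x \<otimes> y \<in> N" using r'[OF that(1)] subgroup.m_closed[OF d(1)] by simp
  qed
  have rmult: "r (r x \<otimes> r y) = r (x \<otimes> y)" if "x \<in> Y" "y \<in> Y" for x y
  proof -
    have cc: "x \<in> carrier G" "y \<in> carrier G" "r x \<in> carrier G" "r y \<in> carrier G"
      using c that r' by auto
    have "inv (x \<otimes> y) \<otimes> (r x \<otimes> r y) = (inv y \<otimes> (inv x \<otimes> r x) \<otimes> y) \<otimes> (inv y \<otimes> r y)"
      using cc by (simp add: word_simps)
    moreover have "\<dots> \<in> N"
      by (rule subgroup.m_closed[OF d(1) normal_in_conj'[OF assms that(2) r'(2)[OF that(1)]] r'(2)[OF that(2)]])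
    ultimately have "r (x \<otimes> y) = r (r x \<otimes> r y)" using req[of "x \<otimes> y" "r x \<otimes> r y"] that r' Yc by auto
    then show ?thesis by simp
  qed
  \<comment> \<open>Updating three fields of \<open>G\<close> keeps the record extension and hence
    the type; inverses are determined by the multiplication.\<close>
  define Q where "Q = G\<lparr>carrier := r ` Y, mult := (\<lambda>x y. r (x \<otimes> y)), one := r \<one>\<rparr>"
  have sel: "carrier Q = r ` Y" "x \<otimes>\<^bsub>Q\<^esub> y = r (x \<otimes> y)" "\<one>\<^bsub>Q\<^esub> = r \<one>" for x y
    by (simp_all add: Q_def)
  have "group Q"
  proof (rule groupI)
    show "\<one>\<^bsub>Q\<^esub> \<in> carrier Q" using Yc by (simp add: sel)
    fix x assume "x \<in> carrier Q"
    then obtain a where a: "a \<in> Y" "x = r a" by (auto simp: sel)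
    show "\<one>\<^bsub>Q\<^esub> \<otimes>\<^bsub>Q\<^esub> x = x" using a rmult[of \<one> a] Yc c by (simp add: sel)
    have "r (inv a) \<otimes>\<^bsub>Q\<^esub> x = \<one>\<^bsub>Q\<^esub>" using a rmult[of "inv a" a] Yc c by (simp add: sel)
    then show "\<exists>y\<in>carrier Q. y \<otimes>\<^bsub>Q\<^esub> x = \<one>\<^bsub>Q\<^esub>" using a Yc by (auto simp: sel)
    fix y assume "y \<in> carrier Q"
    then obtain b where b: "b \<in> Y" "y = r b" by (auto simp: sel)
    show "x \<otimes>\<^bsub>Q\<^esub> y \<in> carrier Q" using a b Yc r' by (auto simp: sel)
    fix z assume "z \<in> carrier Q"
    then obtain e where e: "e \<in> Y" "z = r e" by (auto simp: sel)
    have "x \<otimes>\<^bsub>Q\<^esub> y \<otimes>\<^bsub>Q\<^esub> z = r (a \<otimes> b \<otimes> e)" using a b e rmult Yc by (simp add: sel)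
    also have "\<dots> = x \<otimes>\<^bsub>Q\<^esub> (y \<otimes>\<^bsub>Q\<^esub> z)" using a b e rmult Yc c by (simp add: sel m_assoc)
    finally show "x \<otimes>\<^bsub>Q\<^esub> y \<otimes>\<^bsub>Q\<^esub> z = x \<otimes>\<^bsub>Q\<^esub> (y \<otimes>\<^bsub>Q\<^esub> z)" .
  qed
  moreover have "finite (carrier Q)" using subgroup_finite[OF d(2)] by (simp add: sel)
  ultimately interpret Q: fin_group Q by (simp add: fin_group_def fin_group_axioms_def)
  have ker: "r x = \<one>\<^bsub>Q\<^esub> \<longleftrightarrow> x \<in> N" if "x \<in> Y" for x
    using req[OF Yc(3) that] c[OF that] by (auto simp: sel)
  have "N = {x \<in> Y. r x = \<one>\<^bsub>Q\<^esub>}" using ker d(3) by blast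
  then have "quotient_map G Q Y r N"
    by (intro quotient_map.intro quotient_map_axioms.intro fin_group_axioms Q.fin_group_axioms)
      (use d(2) rmult in \<open>simp_all add: sel\<close>)
  moreover have "card Y = card N * card (carrier Q)"
    unfolding sel(1) by (rule card_fibres_subgroup[OF d(2,1,3)]) (use req in auto)
  ultimately show ?thesis by (metis mult.commute)
qed

end

section \<open>A unique minimal normal subgroup\<close>

context group
begin

lemma conj_pow:
  assumes "y \<in> carrier G" "z \<in> carrier G"
  shows "y \<otimes> z [^] (n::nat) \<otimes> inv y = (y \<otimes> z \<otimes> inv y) [^] n"
proof (induction n)
  case (Suc n)
  have "y \<otimes> z [^] Suc n \<otimes> inv y = (y \<otimes> z [^] n \<otimes> inv y) \<otimes> (y \<otimes> z \<otimes> inv y)"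
    using assms by (simp add: word_simps)
  then show ?case using Suc by simp
qed (use assms in simp)

lemma subgroup_nat_pow_closed: "subgroup H G \<Longrightarrow> x \<in> H \<Longrightarrow> x [^] (n::nat) \<in> H"
  by (induction n) (auto simp: subgroup.one_closed subgroup.m_closed)

text \<open>By Bezout, \<open>x\<close> is a product of powers of \<open>x [^] k\<close> and
  \<open>x [^] r\<close>. With trivial \<open>H\<close>, an element annihilated by two coprime
  exponents is the identity.\<close>

lemma pow_coprime_mem:
  assumes "subgroup H G" "x \<in> carrier G" "x [^] (k::nat) \<in> H" "x [^] (r::nat) \<in> H" "coprime k r"
  shows "x \<in> H"
proof -
  obtain i j where ij: "i * int k + j * int r = 1"
    using assms(5) bezout_int[of "int k" "int r"] by (auto simp: coprime_iff_gcd_eq_1)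
  have "x [^] (int k * i) \<in> H" "x [^] (int r * j) \<in> H"
    using subgroup_int_pow_closed[OF assms(1,3), of i] subgroup_int_pow_closed[OF assms(1,4), of j] assms(2)
    by (simp_all add: int_pow_int flip: int_pow_pow)
  then have "x [^] (int k * i) \<otimes> x [^] (int r * j) \<in> H" using subgroup.m_closed[OF assms(1)] by blast
  then have "x [^] (int k * i + int r * j) \<in> H" using assms(2) by (simp add: int_pow_mult)
  moreover have "int k * i + int r * j = 1" using ij by (simp add: mult.commute)
  ultimately show ?thesis using assms(2) by simp
qed

lemma pow_cong_exponent:
  assumes "x \<in> carrier G" "x [^] (r::nat) = \<one>" "[m = k] (mod r)"
  shows "x [^] (m::nat) = x [^] k"
proof -
  have *: "x [^] (l + r * q) = x [^] l" for l q :: nat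
    using assms(1,2) by (simp add: nat_pow_mult[symmetric] nat_pow_pow[symmetric])
  have "x [^] l = x [^] (l mod r)" for l
    using *[of "l mod r" "l div r"] by simp
  then show ?thesis using assms(3) by (simp add: cong_def) (metis)
qed

end

context fin_group
begin

lemma pow_card_subgroup:
  assumes "subgroup H G" "x \<in> H"
  shows "x [^] card H = \<one>"
proof -
  interpret H: group "G\<lparr>carrier := H\<rparr>" using assms by (simp add: subgroup_imp_group)
  have "x [^]\<^bsub>G\<lparr>carrier := H\<rparr>\<^esub> order (G\<lparr>carrier := H\<rparr>) = \<one>"
    using H.pow_order_eq_1[of x] assms by simp
  then show ?thesis by (simp add: order_def nat_pow_consistent[symmetric])
qed

lemma coprime_Int_trivial:
  assumes "subgroup H G" "subgroup K G" "coprime (card H) (card K)"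
  shows "H \<inter> K = {\<one>}"
proof -
  have "x = \<one>" if "x \<in> H" "x \<in> K" for x
    using pow_coprime_mem[OF triv_subgroup, of x "card H" "card K"] pow_card_subgroup that assms
    by (auto simp: subgroup.mem_carrier)
  then show ?thesis using subgroup.one_closed assms by blast
qed

lemma nontrivial_card:
  assumes "subgroup H G" "H \<noteq> {\<one>}"
  shows "card H > 1"
proof -
  have "card H \<noteq> 1" using assms subgroup.one_closed[OF assms(1)] by (auto simp: card_1_singleton_iff)
  then show ?thesis using subgroup_card_pos[OF assms(1)] by linarith
qed

text \<open>A prime \<open>q \<noteq> r\<close> dividing the order would, by Cauchy's theorem, give
  a subgroup of order \<open>q\<close> whose elements are annihilated by both \<open>q\<close> and
  \<open>r\<close>.\<close>

lemma exponent_prime_card: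
  assumes "subgroup H G" "prime_nat r" "\<And>x. x \<in> H \<Longrightarrow> x [^] r = \<one>"
  shows "\<exists>n. card H = r ^ n"
proof -
  have "q = r" if q: "prime_nat q" "q dvd card H" for q
  proof (rule ccontr)
    assume "q \<noteq> r"
    then have "coprime q r" using q assms(2) primes_coprime by blast
    obtain U where U: "subgroup U G" "U \<subseteq> H" "card U = q" using cauchy_subgroup[OF assms(1) q] by blast
    have "x = \<one>" if "x \<in> U" for x
      using pow_coprime_mem[OF triv_subgroup, of x q r] pow_card_subgroup[OF U(1) that] assms(3)[of x] U that
        \<open>coprime q r\<close> by (auto simp: subgroup.mem_carrier)
    then have "U = {\<one>}" using subgroup.one_closed[OF U(1)] by blast
    then show False using U(3) prime_gt_1_nat[OF q(1)] by auto
  qed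
  then have "prime_factors (card H) \<subseteq> {r}" by (auto simp: prime_factors_dvd)
  moreover have "card H \<noteq> 0" using subgroup_card_pos[OF assms(1)] by simp
  ultimately have "card H = r ^ multiplicity r (card H)"
  proof -
    assume a: "prime_factors (card H) \<subseteq> {r}" and "card H \<noteq> 0"
    then have "card H = (\<Prod>p\<in>prime_factors (card H). p ^ multiplicity p (card H))"
      by (simp add: prime_factorization_nat)
    also have "\<dots> = (\<Prod>p\<in>{r}. p ^ multiplicity p (card H))"
      using a assms(2) by (intro prod.mono_neutral_left) (auto simp: prime_factors_multiplicity not_dvd_imp_multiplicity_0)
    finally show ?thesis by simp
  qed
  then show ?thesis by blast
qed

text \<open>Primitive groups with abelian socle \<open>F\<close> and point stabilizer
  \<open>S\<close>. Supersolvability of \<open>S\<close>, an order of \<open>S\<close> prime to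
  \<open>f\<close> and the bound \<open>2 \<le> n\<close> single out the non-supersolvable
  alternative.\<close>

definition primitive_type :: "'a set \<Rightarrow> 'a set \<Rightarrow> 'a set \<Rightarrow> nat \<Rightarrow> nat \<Rightarrow> bool"
  where "primitive_type Y F S f n \<longleftrightarrow>
    normal_in F Y \<and> subgroup S G \<and> S \<subseteq> Y \<and> F \<inter> S = {\<one>} \<and> F <#> S = Y \<and>
    prime_nat f \<and> card F = f ^ n \<and> 2 \<le> n \<and> \<not> f dvd card S \<and> S \<noteq> {\<one>} \<and>
    (\<forall>K. normal_in K Y \<and> K \<noteq> {\<one>} \<longrightarrow> F \<subseteq> K) \<and> centralizer_in Y F = F \<and>
    supersolvable_over F Y \<and> supersolvable_over {\<one>} S \<and> maximal_in S Y"

end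

text \<open>The chain condition is not part of this setting: a maximal supersolvable complement of
  \<open>N\<close> is obtained from the quotients alone. Chain lengths come in at the end, to make
  the order of the complement prime to \<open>r\<close>.\<close>

locale minimal_nonsupersolvable = fin_group +
  fixes Y N :: "'a set" and r n :: nat
  assumes N: "normal_in N Y"
    and quot: "\<And>K. normal_in K Y \<Longrightarrow> K \<noteq> {\<one>} \<Longrightarrow> supersolvable_over K Y"
    and nss: "\<not> supersolvable_over {\<one>} Y"
    and minimal: "\<And>K. normal_in K Y \<Longrightarrow> K \<subseteq> N \<Longrightarrow> K = {\<one>} \<or> K = N"
    and nontriv: "N \<noteq> {\<one>}"
    and r: "prime_nat r"
    and N_comm: "\<And>x y. x \<in> N \<Longrightarrow> y \<in> N \<Longrightarrow> x \<otimes> y = y \<otimes> x"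
    and N_exponent: "\<And>x. x \<in> N \<Longrightarrow> x [^] r = \<one>"
    and card_N: "card N = r ^ n"
begin

lemma Y_subgroup: "subgroup Y G" and subN: "subgroup N G" and N_Y: "N \<subseteq> Y"
  using normal_inD[OF N] by auto

lemma Yc [simp]: "x \<in> Y \<Longrightarrow> x \<in> carrier G"
  using Y_subgroup by (simp add: subgroup.mem_carrier)

lemma Nc [simp]: "x \<in> N \<Longrightarrow> x \<in> Y"
  using N_Y by auto

lemma Y_closed [simp]: "\<one> \<in> Y" "x \<in> Y \<Longrightarrow> y \<in> Y \<Longrightarrow> x \<otimes> y \<in> Y" "x \<in> Y \<Longrightarrow> inv x \<in> Y"
  using Y_subgroup by (auto simp: subgroup.one_closed subgroup.m_closed subgroup.m_inv_closed)

lemma N_closed [simp]: "\<one> \<in> N" "x \<in> N \<Longrightarrow> y \<in> N \<Longrightarrow> x \<otimes> y \<in> N" "x \<in> N \<Longrightarrow> inv x \<in> N"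
  using subN by (auto simp: subgroup.one_closed subgroup.m_closed subgroup.m_inv_closed)

lemma n_pos: "n > 0"
  using card_N nontrivial_card[OF subN nontriv] by (cases n) auto

lemma r_dvd_N: "r dvd card N"
  using card_N n_pos by simp

text \<open>The quotient by such a \<open>K\<close> is supersolvable, and a bottom step of prime
  order would carry this to \<open>Y\<close>. Most contradictions about \<open>Y\<close> are reached
  by exhibiting such a \<open>K\<close>.\<close>

lemma no_prime_normal: "normal_in K Y \<Longrightarrow> \<not> prime_nat (card K)"
proof
  assume K: "normal_in K Y" "prime_nat (card K)"
  then have "K \<noteq> {\<one>}" by auto
  then have "supersolvable_over {\<one>} Y"
    using supersolvable_over_prime_index[OF normal_in_one[OF Y_subgroup] quot[OF K(1)], of "card K"] K
      subgroup.one_closed[OF normal_inD(1)[OF K(1)]] by auto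
  then show False using nss by simp
qed

text \<open>If \<open>K\<close> met \<open>N\<close> trivially, a prime step above \<open>N\<close>
  inside \<open>N <#> K\<close>, intersected with \<open>K\<close>, would be a normal subgroup of
  prime order.\<close>

lemma N_unique:
  assumes K: "normal_in K Y" "K \<noteq> {\<one>}"
  shows "N \<subseteq> K"
proof (rule ccontr)
  assume "\<not> N \<subseteq> K"
  then have NK: "N \<inter> K = {\<one>}" using minimal[OF normal_in_Int[OF N K(1)]] by blast
  note dK = normal_inD[OF K(1)]
  have "N \<subseteq> N <#> K" using set_mult_superset subN dK by auto
  moreover have "card (N <#> K) = card N * card K" using card_set_mult_trivial[OF subN dK(1) NK] .
  then have "N \<noteq> N <#> K" using nontrivial_card[OF dK(1) K(2)] subgroup_card_pos[OF subN] by auto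
  ultimately have "N \<subset> N <#> K" by blast
  then obtain L p where L: "normal_in L Y" "N \<subseteq> L" "L \<subseteq> N <#> K" "prime_nat p" "card L = p * card N"
    using supersolvable_overD[OF quot[OF N nontriv] N normal_in_prod[OF N K(1)] subset_refl] by blast
  have LK: "normal_in (L \<inter> K) Y" using normal_in_Int L K by blast
  have "L = N <#> (L \<inter> K)" using dedekind_prod[OF subN dK(1) normal_inD(1)[OF L(1)] L(2,3)] .
  then have "card L = card (N <#> (L \<inter> K))" by (rule arg_cong)
  moreover have "N \<inter> (L \<inter> K) = {\<one>}" using NK L(2) by blast
  ultimately have "card L = card N * card (L \<inter> K)"
    using card_set_mult_trivial[OF subN normal_inD(1)[OF LK]] by simp
  then have "card (L \<inter> K) = p" using L(5) subgroup_card_pos[OF subN] by simp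
  then show False using no_prime_normal[OF LK] L(4) by simp
qed

lemma prime_subgroup_N: "\<exists>U. subgroup U G \<and> U \<subseteq> N \<and> card U = r"
  using cauchy_subgroup[OF subN r r_dvd_N] .

lemma N_neq_Y: "N \<noteq> Y"
proof
  assume e: "N = Y"
  obtain U where U: "subgroup U G" "U \<subseteq> N" "card U = r" using prime_subgroup_N by blast
  have "x \<otimes> u \<otimes> inv x \<in> U" if "x \<in> Y" "u \<in> U" for x u
  proof -
    have "u \<in> N" "x \<in> N" using that U e by auto
    then have "x \<otimes> u \<otimes> inv x = u" using N_comm[of x u] by (simp add: m_assoc)
    then show ?thesis using that by simp
  qed
  then have "normal_in U Y" using U Y_subgroup e by (auto simp: normal_in_def)
  then show False using no_prime_normal U(3) r by blast
qed

text \<open>\<open>S\<close> normalizes the intersection because \<open>N\<close> is normal, and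
  \<open>N\<close> centralizes it because \<open>N\<close> is abelian; every element of
  \<open>Y\<close> is a product of two such factors.\<close>

lemma normal_Int_supplement:
  assumes subS: "subgroup S G" "S \<subseteq> Y" and NS: "N <#> S = Y"
  shows "normal_in (N \<inter> S) Y"
proof -
  have "y \<otimes> z \<otimes> inv y \<in> N \<inter> S" if y: "y \<in> Y" and z: "z \<in> N \<inter> S" for y z
  proof -
    obtain m k where mk: "m \<in> N" "k \<in> S" "y = m \<otimes> k" using y NS by (auto simp: set_mult_def)
    have k: "k \<in> Y" using mk subS by auto
    define w where "w = k \<otimes> z \<otimes> inv k"
    have w: "w \<in> N" "w \<in> S" unfolding w_def
      using normal_inD(4)[OF N k] z mk(2) subgroup.m_closed[OF subS(1)] subgroup.m_inv_closed[OF subS(1)] by auto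
    have "y \<otimes> z \<otimes> inv y = m \<otimes> w \<otimes> inv m"
      unfolding mk w_def using mk k z by (simp add: word_simps)
    also have "\<dots> = w" using N_comm[OF mk(1) w(1)] mk w by (simp add: m_assoc)
    finally show ?thesis using w by simp
  qed
  then show ?thesis using subN subS Y_subgroup by (auto simp: normal_in_def subgroups_Inter_pair)
qed

text \<open>The complement is the normalizer of a subgroup \<open>S1\<close> of order
  \<open>s\<close> in a prime step \<open>L\<close> above \<open>N\<close>. As
  \<open>s \<noteq> r\<close>, \<open>S1\<close> is a Sylow subgroup of \<open>L\<close>, and its
  conjugates in \<open>Y\<close> are already conjugate under \<open>N\<close>. If the normalizer
  contained \<open>N\<close>, then \<open>S1\<close> would be normal in \<open>Y\<close>.\<close>

lemma complement_exists:
  assumes cent: "centralizer_in Y N = N"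
  shows "\<exists>S. subgroup S G \<and> S \<subseteq> Y \<and> N \<inter> S = {\<one>} \<and> N <#> S = Y"
proof -
  have "N \<subset> Y" using N_Y N_neq_Y by blast
  then obtain L s where L: "normal_in L Y" "N \<subseteq> L" "prime_nat s" "card L = s * card N"
    using supersolvable_overD[OF quot[OF N nontriv] N normal_in_self[OF Y_subgroup] subset_refl] by blast
  note dL = normal_inD[OF L(1)]
  have cNpos: "card N > 0" using subgroup_card_pos[OF subN] .
  \<comment> \<open>Otherwise \<open>L\<close> is an \<open>r\<close>-group and centralizes a
    nontrivial element of \<open>N\<close>. The part of \<open>N\<close> centralized by
    \<open>L\<close> is normal in \<open>Y\<close>, hence all of \<open>N\<close>, against
    \<open>cent\<close>.\<close>
  have "s \<noteq> r"
  proof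
    assume "s = r"
    then have cL: "card L = r ^ Suc n" using L(4) card_N by simp
    obtain z where z: "z \<in> N" "z \<noteq> \<one>" "\<forall>l\<in>L. l \<otimes> z = z \<otimes> l"
      using p_group_fixed_point[OF N dL(1,3) cL r r_dvd_N] by blast
    have "normal_in (N \<inter> centralizer_in Y L) Y" using normal_in_Int[OF N normal_in_centralizer[OF L(1)]] .
    moreover have "z \<in> N \<inter> centralizer_in Y L" using z by (auto simp: centralizer_in_def)
    ultimately have "N \<subseteq> centralizer_in Y L" using minimal[of "N \<inter> centralizer_in Y L"] z(2) by blast
    then have "L \<subseteq> centralizer_in Y N" using dL(3) by (fastforce simp: centralizer_in_def)
    then have "L = N" using cent L(2) by simp
    then show False using L(4) cNpos prime_gt_1_nat[OF L(3)] by simp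
  qed
  then have cop: "coprime s (card N)" using L(3) r card_N primes_coprime[of s r] by simp
  obtain S1 where S1: "subgroup S1 G" "S1 \<subseteq> L" "card S1 = s" using cauchy_subgroup[OF dL(1) L(3)] L(4) by auto
  have S1Y: "S1 \<subseteq> Y" using S1(2) dL(3) by auto
  have "N \<inter> S1 = {\<one>}" using coprime_Int_trivial[OF subN S1(1)] cop S1(3) by (simp add: coprime_commute)
  then have "card (N <#> S1) = card L" using card_set_mult_trivial[OF subN S1(1)] S1(3) L(4) by simp
  moreover have "N <#> S1 \<subseteq> L" using set_mult_subset[OF dL(1) L(2) S1(2)] .
  ultimately have NS1: "N <#> S1 = L" using subgroup_eq_card[OF dL(1)] by blast
  have syl: "\<not> s * card S1 dvd card L"
  proof
    assume "s * card S1 dvd card L"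
    then have "s dvd card N" using S1(3) L(4) prime_gt_0_nat[OF L(3)] by simp
    then have "s dvd 1" using cop by (metis coprime_absorb_left dvd_refl coprime_def)
    then show False using L(3) by simp
  qed
  define S where "S = normalizer_in Y S1"
  have subS: "subgroup S G" "S \<subseteq> Y"
    unfolding S_def using subgroup_normalizer_in[OF Y_subgroup S1(1)] by (auto simp: normalizer_in_def)
  have frattini: "g \<in> N <#> S" if g: "g \<in> Y" for g
  proof -
    have "conj_set g S1 \<subseteq> L" using g S1(2) dL(4) by (auto simp: conj_set_def)
    moreover have "card (conj_set g S1) = s ^ 1"
      using card_conj_set[of g S1] g S1 by (simp add: subgroup.subset)
    ultimately obtain x where x: "x \<in> L" "\<forall>k\<in>conj_set g S1. inv x \<otimes> k \<otimes> x \<in> S1"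
      using p_subgroup_conj_sylow[OF dL(1) S1(1,2) syl subgroup_conj_set[OF Yc[OF g] S1(1)] _ _ L(3)] by blast
    obtain m s1 where ms: "m \<in> N" "s1 \<in> S1" "x = m \<otimes> s1" using x(1) NS1 by (auto simp: set_mult_def)
    have c: "g \<in> carrier G" "m \<in> carrier G" "s1 \<in> carrier G" using g ms S1Y by auto
    have "inv m \<otimes> g \<otimes> u \<otimes> inv (inv m \<otimes> g) \<in> S1" if u: "u \<in> S1" for u
    proof -
      have uc: "u \<in> carrier G" using u S1Y by auto
      have "inv x \<otimes> (g \<otimes> u \<otimes> inv g) \<otimes> x \<in> S1" using x(2) u by (auto simp: conj_set_def)
      \<comment> \<open>The factor \<open>s1\<close> of \<open>x\<close> normalizes
        \<open>S1\<close> and can be undone; what remains is conjugation by the factor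
        \<open>m\<close> in \<open>N\<close>.\<close>
      then have "s1 \<otimes> (inv x \<otimes> (g \<otimes> u \<otimes> inv g) \<otimes> x) \<otimes> inv s1 \<in> S1"
        using ms(2) subgroup.m_closed[OF S1(1)] subgroup.m_inv_closed[OF S1(1)] by blast
      then show ?thesis using ms(3) c uc by (simp add: word_simps)
    qed
    moreover from this have "inv (inv m \<otimes> g) \<otimes> u \<otimes> (inv m \<otimes> g) \<in> S1" if "u \<in> S1" for u
      using normal_conj_bij[OF S1(1), of "inv m \<otimes> g" u] that c by auto
    ultimately have "inv m \<otimes> g \<in> S" using g ms by (auto simp: S_def normalizer_in_def)
    moreover have "g = m \<otimes> (inv m \<otimes> g)" using c by (simp add: cancel_inv)
    ultimately show ?thesis using ms(1) by (auto simp: set_mult_def)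
  qed
  then have NS: "N <#> S = Y" using set_mult_subset[OF Y_subgroup N_Y subS(2)] by blast
  have "normal_in (N \<inter> S) Y" using normal_Int_supplement[OF subS NS] .
  moreover have "N \<inter> S \<noteq> N"
  proof
    assume "N \<inter> S = N"
    then have "Y \<subseteq> S" using NS set_mult_subset[OF subS(1)] by blast
    then have "Y = S" using subS by blast
    then have "normal_in S1 Y" using normal_in_normalizer[OF Y_subgroup S1(1) S1Y] unfolding S_def by simp
    then show False using no_prime_normal S1(3) L(3) by blast
  qed
  ultimately have "N \<inter> S = {\<one>}" using minimal[of "N \<inter> S"] by blast
  then show ?thesis using subS NS by blast
qed

end

text \<open>Here \<open>T/N\<close> is a chief factor of prime order inside the centralizer of \<open>N\<close>; this
  configuration is contradictory.\<close>

locale central_extension = minimal_nonsupersolvable +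
  fixes T :: "'a set" and t :: 'a
  assumes T: "normal_in T Y"
    and N_T: "N \<subseteq> T"
    and N_max_T: "maximal_in N T"
    and T_central: "\<And>x z. x \<in> N \<Longrightarrow> z \<in> T \<Longrightarrow> x \<otimes> z = z \<otimes> x"
    and t: "t \<in> T" "t \<notin> N"
begin

lemma subT: "subgroup T G" and T_Y: "T \<subseteq> Y"
  using normal_inD[OF T] by auto

lemma Tc [simp]: "x \<in> T \<Longrightarrow> x \<in> Y"
  using T_Y by auto

lemma NT [simp]: "x \<in> N \<Longrightarrow> x \<in> T"
  using N_T by auto

lemma T_closed [simp]: "x \<in> T \<Longrightarrow> y \<in> T \<Longrightarrow> x \<otimes> y \<in> T" "x \<in> T \<Longrightarrow> inv x \<in> T"
    "x \<in> T \<Longrightarrow> x [^] (k::nat) \<in> T"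
  using subT by (auto simp: subgroup.m_closed subgroup.m_inv_closed subgroup_nat_pow_closed)

lemma N_pow [simp]: "x \<in> N \<Longrightarrow> x [^] (k::nat) \<in> N"
  using subN by (simp add: subgroup_nat_pow_closed)

lemma T_conj [simp]: "y \<in> Y \<Longrightarrow> x \<in> T \<Longrightarrow> y \<otimes> x \<otimes> inv y \<in> T"
  using normal_inD(4)[OF T] by blast

lemma N_conj [simp]: "y \<in> Y \<Longrightarrow> x \<in> N \<Longrightarrow> y \<otimes> x \<otimes> inv y \<in> N"
  using normal_inD(4)[OF N] by blast

text \<open>\<open>N\<close> is maximal in \<open>T\<close>, so \<open>N\<close> and
  \<open>t\<close> generate \<open>T\<close>, and by finiteness closure under products suffices.
  Statements about \<open>T\<close> thereby reduce to \<open>N\<close> and the single element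
  \<open>t\<close>.\<close>

lemma T_induct:
  assumes "M \<subseteq> T" "N \<subseteq> M" "t \<in> M" "\<And>x y. x \<in> M \<Longrightarrow> y \<in> M \<Longrightarrow> x \<otimes> y \<in> M"
  shows "M = T"
proof -
  have "subgroup M G" by (rule subgroup_finI) (use assms in \<open>auto simp: subset_iff\<close>)
  then show ?thesis using N_max_T assms(1,2,3) t(2) unfolding maximal_in_def by blast
qed

text \<open>The generators commute: \<open>T\<close> centralizes \<open>N\<close>, and
  \<open>t\<close> commutes with itself.\<close>

lemma T_comm: "x \<in> T \<Longrightarrow> y \<in> T \<Longrightarrow> x \<otimes> y = y \<otimes> x"
proof -
  have comm_closed: "x \<otimes> y \<otimes> z = z \<otimes> (x \<otimes> y)"
    if "x \<in> T" "y \<in> T" "z \<in> T" "x \<otimes> z = z \<otimes> x" "y \<otimes> z = z \<otimes> y" for x y z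
  proof -
    have "x \<otimes> y \<otimes> z = x \<otimes> z \<otimes> y" using that(1,2,3,5) by (simp add: m_assoc)
    also have "\<dots> = z \<otimes> x \<otimes> y" using that by simp
    finally show ?thesis using that by (simp add: m_assoc)
  qed
  have "{x \<in> T. x \<otimes> t = t \<otimes> x} = T"
    by (rule T_induct) (use t comm_closed T_central in auto)
  then have tc: "x \<otimes> t = t \<otimes> x" if "x \<in> T" for x using that by blast
  have "{x \<in> T. \<forall>z\<in>T. x \<otimes> z = z \<otimes> x} = T"
  proof (rule T_induct)
    show "t \<in> {x \<in> T. \<forall>z\<in>T. x \<otimes> z = z \<otimes> x}" using t(1) tc[symmetric] by blast
    show "x \<otimes> y \<in> {x \<in> T. \<forall>z\<in>T. x \<otimes> z = z \<otimes> x}"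
      if "x \<in> {x \<in> T. \<forall>z\<in>T. x \<otimes> z = z \<otimes> x}" "y \<in> {x \<in> T. \<forall>z\<in>T. x \<otimes> z = z \<otimes> x}" for x y
      using that by (intro CollectI conjI ballI comm_closed T_closed(1)) blast+
    show "N \<subseteq> {x \<in> T. \<forall>z\<in>T. x \<otimes> z = z \<otimes> x}" using N_T T_central by blast
  qed blast
  then show "x \<in> T \<Longrightarrow> y \<in> T \<Longrightarrow> x \<otimes> y = y \<otimes> x" by blast
qed

lemma T_pow_mult: "x \<in> T \<Longrightarrow> y \<in> T \<Longrightarrow> (x \<otimes> y) [^] (k::nat) = x [^] k \<otimes> y [^] k"
  by (rule pow_mult_distrib) (auto intro: T_comm)

lemma power_kernel_normal: "normal_in {x \<in> T. x [^] (k::nat) = \<one>} Y"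
proof -
  have "subgroup {x \<in> T. x [^] k = \<one>} G"
    by (rule subgroup_finI) (use T_pow_mult subgroup.one_closed[OF subT] in auto)
  then show ?thesis using Y_subgroup T_conj by (auto simp: normal_in_def simp flip: conj_pow)
qed

text \<open>For \<open>s \<noteq> r\<close> the elements of \<open>T\<close> annihilated by
  \<open>s\<close> would form a nontrivial normal subgroup, which contains \<open>N\<close> by
  uniqueness although \<open>N\<close> has exponent \<open>r\<close>.\<close>

lemma index_T_prime:
  assumes "prime_nat s" "card T = s * card N"
  shows "s = r"
proof (rule ccontr)
  assume "s \<noteq> r"
  obtain U where U: "subgroup U G" "U \<subseteq> T" "card U = s"
    using cauchy_subgroup[OF subT assms(1)] assms(2) by auto
  have "U \<noteq> {\<one>}" using U(3) prime_gt_1_nat[OF assms(1)] by auto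
  then obtain u where "u \<in> U" "u \<noteq> \<one>" using subgroup.one_closed[OF U(1)] by blast
  then have "{x \<in> T. x [^] s = \<one>} \<noteq> {\<one>}" using U pow_card_subgroup[OF U(1)] by auto
  then have "N \<subseteq> {x \<in> T. x [^] s = \<one>}" using N_unique[OF power_kernel_normal] by blast
  moreover obtain x where "x \<in> N" "x \<noteq> \<one>" using nontriv N_closed(1) by blast
  ultimately have "x = \<one>"
    using pow_coprime_mem[OF triv_subgroup, of x s r] N_exponent[of x] primes_coprime[OF assms(1) r \<open>s \<noteq> r\<close>] by auto
  then show False using \<open>x \<noteq> \<one>\<close> by simp
qed

text \<open>The elements annihilated by \<open>r\<close> form \<open>N\<close> or \<open>T\<close>.
  In the first case the \<open>r\<close>-th powers would form a normal subgroup with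
  \<open>|T| / |N| = r\<close> elements. So \<open>T\<close> is a vector space over the field with
  \<open>r\<close> elements.\<close>

lemma T_exponent:
  assumes "card T = r * card N" "x \<in> T"
  shows "x [^] r = \<one>"
proof -
  define K where "K = {x \<in> T. x [^] r = \<one>}"
  have K: "normal_in K Y" unfolding K_def by (rule power_kernel_normal)
  have "N \<subseteq> K" using N_exponent by (auto simp: K_def)
  then have "K = N \<or> K = T"
    using N_max_T normal_inD(1)[OF K] unfolding maximal_in_def by (auto simp: K_def)
  moreover have "K \<noteq> N"
  proof
    assume e: "K = N"
    define P where "P = (\<lambda>x. x [^] r) ` T"
    have "card T = card K * card P" unfolding P_def
    proof (rule card_fibres_subgroup[OF subT])
      show "subgroup K G" "K \<subseteq> T" using normal_inD(1)[OF K] by (auto simp: K_def)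
      fix x y assume xy: "x \<in> T" "y \<in> T"
      have "(inv x \<otimes> y) [^] r = inv (x [^] r) \<otimes> y [^] r"
        using xy T_pow_mult[of "inv x" y] by (simp add: nat_pow_inv)
      then have "(inv x \<otimes> y) [^] r = \<one> \<longleftrightarrow> y [^] r = x [^] r"
        using inv_solve_left'[of \<one> "x [^] r" "y [^] r"] xy by simp
      then show "x [^] r = y [^] r \<longleftrightarrow> inv x \<otimes> y \<in> K" using xy by (auto simp: K_def)
    qed
    then have "card P = r" using assms(1) e subgroup_card_pos[OF subN] by simp
    moreover have "normal_in P Y"
    proof -
      have "subgroup P G"
      proof (rule subgroup_finI)
        show "P \<subseteq> carrier G" by (auto simp: P_def)
        show "\<one> \<in> P" unfolding P_def using subgroup.one_closed[OF subT] by (metis nat_pow_one imageI)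
        fix a b assume "a \<in> P" "b \<in> P"
        then obtain x y where "x \<in> T" "y \<in> T" "a = x [^] r" "b = y [^] r" by (auto simp: P_def)
        then have "a \<otimes> b = (x \<otimes> y) [^] r" "x \<otimes> y \<in> T" by (auto simp: T_pow_mult)
        then show "a \<otimes> b \<in> P" by (auto simp: P_def)
      qed
      moreover have "y \<otimes> a \<otimes> inv y \<in> P" if ya: "y \<in> Y" "a \<in> P" for y a
      proof -
        from ya obtain x where x: "x \<in> T" "a = x [^] r" by (auto simp: P_def)
        then have "y \<otimes> a \<otimes> inv y = (y \<otimes> x \<otimes> inv y) [^] r" using ya conj_pow[of y x r] by simp
        then show ?thesis using x ya(1) by (auto simp: P_def)
      qed
      ultimately show ?thesis using Y_subgroup by (auto simp: normal_in_def P_def)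
    qed
    ultimately show False using no_prime_normal r by blast
  qed
  ultimately show ?thesis using assms(2) by (auto simp: K_def)
qed

lemma pow_in_N_dvd:
  assumes "card T = r * card N" "t [^] (k::nat) \<in> N"
  shows "r dvd k"
proof (rule ccontr)
  assume "\<not> r dvd k"
  then have "coprime k r" using r prime_imp_coprime coprime_commute by blast
  moreover have "t [^] r \<in> N" using T_exponent[OF assms(1)] t by simp
  ultimately have "t \<in> N" using pow_coprime_mem[OF subN _ assms(2)] t by simp
  then show False using t by simp
qed

text \<open>The elements acting trivially on \<open>N\<close> and \<open>T/N\<close> form a normal
  subgroup \<open>D\<close> above the centralizer \<open>C\<close> of \<open>T\<close>. A prime step
  \<open>L\<close> above \<open>C\<close> inside \<open>D\<close> embeds modulo \<open>C\<close>
  into \<open>N\<close> by taking commutators with \<open>t\<close>, and the image is normal of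
  prime order. So \<open>Y\<close> induces no transvection with hyperplane \<open>N\<close>.\<close>

lemma trivial_on_factors:
  assumes "card T = r * card N"
    and g: "g \<in> Y" "\<And>x. x \<in> N \<Longrightarrow> g \<otimes> x = x \<otimes> g" "\<And>x. x \<in> T \<Longrightarrow> g \<otimes> x \<otimes> inv g \<otimes> inv x \<in> N"
    and "x \<in> T"
  shows "g \<otimes> x = x \<otimes> g"
proof -
  define D where "D = {g \<in> centralizer_in Y N. \<forall>x\<in>T. g \<otimes> x \<otimes> inv g \<otimes> inv x \<in> N}"
  define C where "C = centralizer_in Y T"
  have D_Y: "D \<subseteq> Y" by (auto simp: D_def centralizer_in_def)
  have cent: "normal_in (centralizer_in Y N) Y" using normal_in_centralizer[OF N] .
  have C: "normal_in C Y" unfolding C_def using normal_in_centralizer[OF T] .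
  have CD: "C \<subseteq> D"
  proof
    fix c assume c: "c \<in> C"
    then have cY: "c \<in> Y" "\<And>x. x \<in> T \<Longrightarrow> c \<otimes> x = x \<otimes> c" by (auto simp: C_def centralizer_in_def)
    have "c \<otimes> x \<otimes> inv c \<otimes> inv x \<in> N" if "x \<in> T" for x
      using cY(1) cY(2)[OF that] that by (simp add: m_assoc)
    then show "c \<in> D" using cY by (auto simp: D_def centralizer_in_def)
  qed
  have D: "normal_in D Y"
  proof -
    have "subgroup D G"
    proof (rule subgroup_finI)
      show "D \<subseteq> carrier G" using D_Y by auto
      show "\<one> \<in> D" using CD subgroup.one_closed[OF normal_inD(1)[OF C]] by blast
      fix g h assume gh: "g \<in> D" "h \<in> D"
      have c: "g \<in> Y" "h \<in> Y" using gh D_Y by auto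
      have "g \<otimes> h \<otimes> x \<otimes> inv (g \<otimes> h) \<otimes> inv x \<in> N" if x: "x \<in> T" for x
      proof -
        have "g \<otimes> (h \<otimes> x \<otimes> inv h \<otimes> inv x) \<otimes> inv g \<otimes> (g \<otimes> x \<otimes> inv g \<otimes> inv x) \<in> N"
          using N_closed(2)[OF N_conj[OF c(1), of "h \<otimes> x \<otimes> inv h \<otimes> inv x"]] gh x by (auto simp: D_def)
        then show ?thesis using c x by (simp add: word_simps)
      qed
      moreover have "g \<otimes> h \<in> centralizer_in Y N"
        using gh subgroup.m_closed[OF normal_inD(1)[OF cent]] by (auto simp: D_def)
      ultimately show "g \<otimes> h \<in> D" by (simp add: D_def)
    qed
    moreover have "y \<otimes> g \<otimes> inv y \<in> D" if y: "y \<in> Y" and g: "g \<in> D" for y g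
    proof -
      have gY: "g \<in> Y" using g D_Y by auto
      have "y \<otimes> g \<otimes> inv y \<otimes> x \<otimes> inv (y \<otimes> g \<otimes> inv y) \<otimes> inv x \<in> N" if x: "x \<in> T" for x
      proof -
        have "inv y \<otimes> x \<otimes> y \<in> T" using normal_in_conj'[OF T y x] .
        then have "y \<otimes> (g \<otimes> (inv y \<otimes> x \<otimes> y) \<otimes> inv g \<otimes> inv (inv y \<otimes> x \<otimes> y)) \<otimes> inv y \<in> N"
          using g y by (intro N_conj) (auto simp: D_def)
        then show ?thesis using y gY x by (simp add: word_simps)
      qed
      moreover have "y \<otimes> g \<otimes> inv y \<in> centralizer_in Y N"
        using g normal_inD(4)[OF cent y] by (auto simp: D_def)
      ultimately show ?thesis by (simp add: D_def)
    qed
    ultimately show ?thesis using Y_subgroup D_Y by (auto simp: normal_in_def)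
  qed
  have "D = C"
  proof (rule ccontr)
    assume "D \<noteq> C"
    then have "C \<subset> D" using CD by blast
    moreover have NC: "N \<subseteq> C" using T_central by (auto simp: C_def centralizer_in_def)
    ultimately obtain L p where L: "normal_in L Y" "C \<subseteq> L" "L \<subseteq> D" "prime_nat p" "card L = p * card C"
      using supersolvable_overD[OF quot[OF N nontriv] C D] by blast
    note dL = normal_inD[OF L(1)]
    have LY [simp]: "x \<in> L \<Longrightarrow> x \<in> Y" for x using dL(3) by auto
    have LN: "x \<otimes> z = z \<otimes> x" if "x \<in> L" "z \<in> N" for x z
      using that L(3) by (auto simp: D_def centralizer_in_def)
    have LT: "x \<otimes> z \<otimes> inv x \<otimes> inv z \<in> N" if "x \<in> L" "z \<in> T" for x z
      using that L(3) by (auto simp: D_def)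
    define \<phi> where "\<phi> x = x \<otimes> t \<otimes> inv x \<otimes> inv t" for x
    have phiN: "\<phi> x \<in> N" if "x \<in> L" for x using LT that t by (simp add: \<phi>_def)
    define P where "P = \<phi> ` L"
    have PN: "P \<subseteq> N" using phiN by (auto simp: P_def)
    \<comment> \<open>\<open>L\<close> centralizes \<open>N\<close>, so an element of
      \<open>L\<close> that commutes with \<open>t\<close> centralizes \<open>T\<close>; this makes
      the fibres of \<open>\<phi>\<close> cosets of \<open>C\<close>.\<close>
    have cent_t: "x \<in> C" if x: "x \<in> L" "x \<otimes> t = t \<otimes> x" for x
    proof -
      have "{z \<in> T. x \<otimes> z = z \<otimes> x} = T"
      proof (rule T_induct)
        show "N \<subseteq> {z \<in> T. x \<otimes> z = z \<otimes> x}" using LN x by auto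
        show "t \<in> {z \<in> T. x \<otimes> z = z \<otimes> x}" using x t by auto
        fix a b assume ab: "a \<in> {z \<in> T. x \<otimes> z = z \<otimes> x}" "b \<in> {z \<in> T. x \<otimes> z = z \<otimes> x}"
        have "x \<otimes> (a \<otimes> b) = a \<otimes> x \<otimes> b" using ab x by (simp flip: m_assoc)
        also have "\<dots> = a \<otimes> b \<otimes> x" using ab x by (simp add: m_assoc)
        finally show "a \<otimes> b \<in> {z \<in> T. x \<otimes> z = z \<otimes> x}" using ab by simp
      qed auto
      then show ?thesis using x by (auto simp: C_def centralizer_in_def)
    qed
    have "card L = card C * card P" unfolding P_def
    proof (rule card_fibres_subgroup[OF dL(1) normal_inD(1)[OF C] L(2)])
      fix x y assume xy: "x \<in> L" "y \<in> L"
      have m: "inv x \<otimes> y \<in> L" using xy subgroup.m_closed[OF dL(1)] subgroup.m_inv_closed[OF dL(1)] by blast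
      have "\<phi> x = \<phi> y \<longleftrightarrow> x \<otimes> t \<otimes> inv x = y \<otimes> t \<otimes> inv y" using xy t by (simp add: \<phi>_def)
      also have "\<dots> \<longleftrightarrow> inv x \<otimes> (x \<otimes> t \<otimes> inv x) \<otimes> y = inv x \<otimes> (y \<otimes> t \<otimes> inv y) \<otimes> y"
        using xy t by simp
      also have "\<dots> \<longleftrightarrow> t \<otimes> (inv x \<otimes> y) = inv x \<otimes> y \<otimes> t" using xy t by (simp add: word_simps)
      also have "\<dots> \<longleftrightarrow> inv x \<otimes> y \<in> C" using cent_t[OF m] t by (auto simp: C_def centralizer_in_def)
      finally show "\<phi> x = \<phi> y \<longleftrightarrow> inv x \<otimes> y \<in> C" .
    qed
    then have cP: "card P = p" using L(5) subgroup_card_pos[OF normal_inD(1)[OF C]] by simp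
    \<comment> \<open>\<open>L\<close> centralizes \<open>N\<close>, which contains
      \<open>\<phi> y\<close>, so the commutator is multiplicative up to the order of the
      factors.\<close>
    have phi_mult: "\<phi> (x \<otimes> y) = \<phi> y \<otimes> \<phi> x" if "x \<in> L" "y \<in> L" for x y
    proof -
      have "\<phi> (x \<otimes> y) = x \<otimes> \<phi> y \<otimes> t \<otimes> inv x \<otimes> inv t"
        using that t by (simp add: \<phi>_def word_simps)
      also have "x \<otimes> \<phi> y = \<phi> y \<otimes> x" using LN[OF that(1) phiN[OF that(2)]] .
      finally show ?thesis using that t phiN[OF that(2)] by (simp add: \<phi>_def[of x] m_assoc)
    qed
    have subP: "subgroup P G"
    proof (rule subgroup_finI)
      show "P \<subseteq> carrier G" using PN by auto
      have "\<phi> \<one> = \<one>" using t by (simp add: \<phi>_def)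
      then show "\<one> \<in> P" unfolding P_def using subgroup.one_closed[OF dL(1)] by (metis imageI)
      fix a b assume "a \<in> P" "b \<in> P"
      then obtain x y where "x \<in> L" "y \<in> L" "a = \<phi> x" "b = \<phi> y" by (auto simp: P_def)
      then have "a \<otimes> b = \<phi> (y \<otimes> x)" "y \<otimes> x \<in> L" using phi_mult subgroup.m_closed[OF dL(1)] by auto
      then show "a \<otimes> b \<in> P" by (auto simp: P_def)
    qed
    \<comment> \<open>\<open>P\<close> contains the commutators of \<open>L\<close> with all of
      \<open>T\<close>. This frees it from the choice of \<open>t\<close>, and conjugation by
      \<open>Y\<close> preserves it.\<close>
    have comm_P: "x \<otimes> z \<otimes> inv x \<otimes> inv z \<in> P" if x: "x \<in> L" and z: "z \<in> T" for x z
    proof -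
      have "{z \<in> T. x \<otimes> z \<otimes> inv x \<otimes> inv z \<in> P} = T"
      proof (rule T_induct)
        show "N \<subseteq> {z \<in> T. x \<otimes> z \<otimes> inv x \<otimes> inv z \<in> P}"
          using LN[OF x] x subgroup.one_closed[OF subP] by (auto simp: m_assoc)
        show "t \<in> {z \<in> T. x \<otimes> z \<otimes> inv x \<otimes> inv z \<in> P}" using x t by (auto simp: P_def \<phi>_def)
        fix a b assume ab: "a \<in> {z \<in> T. x \<otimes> z \<otimes> inv x \<otimes> inv z \<in> P}" "b \<in> {z \<in> T. x \<otimes> z \<otimes> inv x \<otimes> inv z \<in> P}"
        define w where "w = x \<otimes> b \<otimes> inv x \<otimes> inv b"
        have w: "w \<in> P" "w \<in> N" using ab LT x by (auto simp: w_def)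
        have "x \<otimes> (a \<otimes> b) \<otimes> inv x \<otimes> inv (a \<otimes> b) = x \<otimes> a \<otimes> inv x \<otimes> (w \<otimes> inv a)"
          using ab x by (simp add: w_def word_simps)
        also have "w \<otimes> inv a = inv a \<otimes> w" using T_central[OF w(2)] ab by simp
        finally have "x \<otimes> (a \<otimes> b) \<otimes> inv x \<otimes> inv (a \<otimes> b) = (x \<otimes> a \<otimes> inv x \<otimes> inv a) \<otimes> w"
          using ab x w by (simp add: m_assoc)
        then show "a \<otimes> b \<in> {z \<in> T. x \<otimes> z \<otimes> inv x \<otimes> inv z \<in> P}"
          using ab w subgroup.m_closed[OF subP] by auto
      qed auto
      then show ?thesis using z by blast
    qed
    have "normal_in P Y"
    proof -
      have "y \<otimes> a \<otimes> inv y \<in> P" if ya: "y \<in> Y" "a \<in> P" for y a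
      proof -
        from ya obtain x where x: "x \<in> L" "a = \<phi> x" by (auto simp: P_def)
        have "y \<otimes> a \<otimes> inv y = (y \<otimes> x \<otimes> inv y) \<otimes> (y \<otimes> t \<otimes> inv y) \<otimes> inv (y \<otimes> x \<otimes> inv y) \<otimes> inv (y \<otimes> t \<otimes> inv y)"
          using x ya t by (simp add: \<phi>_def word_simps)
        then show ?thesis using comm_P dL(4)[OF ya(1) x(1)] ya(1) t by simp
      qed
      then show ?thesis using subP Y_subgroup PN by (auto simp: normal_in_def)
    qed
    then show False using no_prime_normal cP L(4) by blast
  qed
  moreover have "g \<in> D" using g by (auto simp: D_def centralizer_in_def)
  ultimately show ?thesis using assms(5) by (auto simp: C_def centralizer_in_def)
qed

lemma T_lcomm: "x \<in> T \<Longrightarrow> y \<in> T \<Longrightarrow> z \<in> T \<Longrightarrow> x \<otimes> (y \<otimes> z) = y \<otimes> (x \<otimes> z)"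
  using T_comm[of x y] by (simp flip: m_assoc)

lemmas T_ac = m_assoc T_comm T_lcomm

lemma conj_mult: "g \<in> Y \<Longrightarrow> x \<in> T \<Longrightarrow> y \<in> T \<Longrightarrow> g \<otimes> (x \<otimes> y) \<otimes> inv g = (g \<otimes> x \<otimes> inv g) \<otimes> (g \<otimes> y \<otimes> inv g)"
  by (simp add: word_simps)

text \<open>\<open>T/N\<close> is cyclic, so every \<open>g\<close> acts on it as a power map \<open>x \<mapsto> x\<^sup>a\<close>.\<close>

definition acts_mod :: "'a \<Rightarrow> nat \<Rightarrow> bool"
  where "acts_mod g a \<longleftrightarrow> (\<forall>x\<in>T. g \<otimes> x \<otimes> inv g \<otimes> inv (x [^] a) \<in> N)"

lemma quot_mult:
  assumes "x \<in> T" "y \<in> T" "u \<in> T" "v \<in> T" "x \<otimes> inv u \<in> N" "y \<otimes> inv v \<in> N"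
  shows "x \<otimes> y \<otimes> inv (u \<otimes> v) \<in> N"
proof -
  have "x \<otimes> y \<otimes> inv (u \<otimes> v) = (x \<otimes> inv u) \<otimes> (y \<otimes> inv v)"
    using assms(1-4) by (simp add: inv_mult_group T_ac)
  then show ?thesis using assms by simp
qed

lemma acts_mod_exists:
  assumes g: "g \<in> Y"
  shows "\<exists>a. acts_mod g a"
proof -
  have "{x \<in> T. \<exists>k::nat. x \<otimes> inv (t [^] k) \<in> N} = T"
  proof (rule T_induct)
    show "N \<subseteq> {x \<in> T. \<exists>k::nat. x \<otimes> inv (t [^] k) \<in> N}" by (auto intro!: exI[of _ "0::nat"])
    have "t \<otimes> inv (t [^] (1::nat)) \<in> N" using t by simp
    then show "t \<in> {x \<in> T. \<exists>k::nat. x \<otimes> inv (t [^] k) \<in> N}" using t by blast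
    fix x y assume "x \<in> {x \<in> T. \<exists>k::nat. x \<otimes> inv (t [^] k) \<in> N}" "y \<in> {x \<in> T. \<exists>k::nat. x \<otimes> inv (t [^] k) \<in> N}"
    then obtain k l :: nat where "x \<in> T" "y \<in> T" "x \<otimes> inv (t [^] k) \<in> N" "y \<otimes> inv (t [^] l) \<in> N" by auto
    then have "x \<otimes> y \<otimes> inv (t [^] (k + l)) \<in> N" "x \<otimes> y \<in> T"
      using quot_mult[of x y "t [^] k" "t [^] l"] t by (simp_all add: nat_pow_mult)
    then show "x \<otimes> y \<in> {x \<in> T. \<exists>k::nat. x \<otimes> inv (t [^] k) \<in> N}" by blast
  qed blast
  moreover have "g \<otimes> t \<otimes> inv g \<in> T" using g t by simp
  ultimately obtain a :: nat where a: "g \<otimes> t \<otimes> inv g \<otimes> inv (t [^] a) \<in> N" by blast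
  have "{x \<in> T. g \<otimes> x \<otimes> inv g \<otimes> inv (x [^] a) \<in> N} = T"
  proof (rule T_induct)
    show "N \<subseteq> {x \<in> T. g \<otimes> x \<otimes> inv g \<otimes> inv (x [^] a) \<in> N}" using g by auto
    show "t \<in> {x \<in> T. g \<otimes> x \<otimes> inv g \<otimes> inv (x [^] a) \<in> N}" using a t by simp
    fix x y assume "x \<in> {x \<in> T. g \<otimes> x \<otimes> inv g \<otimes> inv (x [^] a) \<in> N}" "y \<in> {x \<in> T. g \<otimes> x \<otimes> inv g \<otimes> inv (x [^] a) \<in> N}"
    then have xy: "x \<in> T" "y \<in> T" "g \<otimes> x \<otimes> inv g \<otimes> inv (x [^] a) \<in> N" "g \<otimes> y \<otimes> inv g \<otimes> inv (y [^] a) \<in> N" by auto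
    have "(g \<otimes> x \<otimes> inv g) \<otimes> (g \<otimes> y \<otimes> inv g) \<otimes> inv (x [^] a \<otimes> y [^] a) \<in> N"
      by (rule quot_mult) (use xy g in simp_all)
    then show "x \<otimes> y \<in> {x \<in> T. g \<otimes> x \<otimes> inv g \<otimes> inv (x [^] a) \<in> N}"
      using xy g by (simp only: conj_mult T_pow_mult mem_Collect_eq T_closed simp_thms)
  qed blast
  then show ?thesis unfolding acts_mod_def by blast
qed

lemma acts_mod_unique:
  assumes "card T = r * card N" "acts_mod g a" "acts_mod g b" "g \<in> Y"
  shows "[a = b] (mod r)"
proof -
  have aux: "[a = b] (mod r)" if le: "a \<le> b" and ab: "acts_mod g a" "acts_mod g b" for a b
  proof -
    define w where "w = g \<otimes> t \<otimes> inv g"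
    have w: "w \<in> T" using assms(4) t by (simp add: w_def)
    have wa: "w \<otimes> inv (t [^] a) \<in> N" and wb: "w \<otimes> inv (t [^] b) \<in> N"
      using ab t by (auto simp: acts_mod_def w_def)
    have b: "t [^] b = t [^] a \<otimes> t [^] (b - a)" using le t by (simp add: nat_pow_mult)
    have "inv (w \<otimes> inv (t [^] b)) \<otimes> (w \<otimes> inv (t [^] a)) = t [^] b \<otimes> inv (t [^] a)"
      using w t by (simp add: word_simps)
    also have "\<dots> = t [^] (b - a)"
      using t by (simp add: b T_ac) (simp add: cancel_inv T_lcomm[of "inv (t [^] a)"] T_lcomm[of "t [^] a"] T_comm[of "t [^] (b - a)"])
    finally have "t [^] (b - a) \<in> N" using wa wb N_closed by metis
    then have "r dvd b - a" using pow_in_N_dvd[OF assms(1)] by blast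
    then have "[b = a] (mod r)" using le by (simp add: cong_altdef_nat)
    then show ?thesis by (rule cong_sym)
  qed
  show ?thesis
  proof (cases "a \<le> b")
    case True
    then show ?thesis using aux assms by blast
  next
    case False
    then show ?thesis using aux[of b a] assms by (simp add: cong_sym)
  qed
qed

text \<open>With \<open>T\<close> read as a vector space over the field with \<open>r\<close>
  elements, these elements induce scalar multiplications; the exponent \<open>a\<close> is the
  scalar.\<close>

definition scalars :: "'a set"
  where "scalars = {g \<in> Y. \<exists>a::nat. \<forall>x\<in>T. g \<otimes> x \<otimes> inv g = x [^] a}"

lemma normal_scalars: "normal_in scalars Y"
proof -
  have "subgroup scalars G"
  proof (rule subgroup_finI)
    show "scalars \<subseteq> carrier G" by (auto simp: scalars_def)
    have "\<forall>x\<in>T. \<one> \<otimes> x \<otimes> inv \<one> = x [^] (1::nat)" by simp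
    then show "\<one> \<in> scalars" unfolding scalars_def using Y_closed(1) by blast
    fix g h assume "g \<in> scalars" "h \<in> scalars"
    then obtain a b :: nat where gh: "g \<in> Y" "h \<in> Y" "\<And>x. x \<in> T \<Longrightarrow> g \<otimes> x \<otimes> inv g = x [^] a"
      "\<And>x. x \<in> T \<Longrightarrow> h \<otimes> x \<otimes> inv h = x [^] b" by (auto simp: scalars_def)
    have "g \<otimes> h \<otimes> x \<otimes> inv (g \<otimes> h) = x [^] (b * a)" if x: "x \<in> T" for x
    proof -
      have "g \<otimes> h \<otimes> x \<otimes> inv (g \<otimes> h) = g \<otimes> (h \<otimes> x \<otimes> inv h) \<otimes> inv g" using gh(1,2) x by (simp add: word_simps)
      also have "\<dots> = (x [^] b) [^] a" using gh x by simp
      finally show ?thesis using x by (simp add: nat_pow_pow)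
    qed
    then show "g \<otimes> h \<in> scalars" using gh by (auto simp: scalars_def)
  qed
  moreover have "y \<otimes> g \<otimes> inv y \<in> scalars" if y: "y \<in> Y" and g: "g \<in> scalars" for y g
  proof -
    from g obtain a :: nat where a: "g \<in> Y" "\<And>x. x \<in> T \<Longrightarrow> g \<otimes> x \<otimes> inv g = x [^] a" by (auto simp: scalars_def)
    have "(y \<otimes> g \<otimes> inv y) \<otimes> x \<otimes> inv (y \<otimes> g \<otimes> inv y) = x [^] a" if x: "x \<in> T" for x
    proof -
      define z where "z = inv y \<otimes> x \<otimes> y"
      have z: "z \<in> T" unfolding z_def using normal_in_conj'[OF T y x] .
      have "(y \<otimes> g \<otimes> inv y) \<otimes> x \<otimes> inv (y \<otimes> g \<otimes> inv y) = y \<otimes> (g \<otimes> z \<otimes> inv g) \<otimes> inv y"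
        using y a(1) x by (simp add: z_def word_simps)
      also have "\<dots> = (y \<otimes> z \<otimes> inv y) [^] a" using a(2)[OF z] conj_pow[of y z a] y z by simp
      also have "y \<otimes> z \<otimes> inv y = x" using x y by (simp add: z_def word_simps)
      finally show ?thesis .
    qed
    then show ?thesis using y a by (auto simp: scalars_def)
  qed
  ultimately show ?thesis using Y_subgroup by (auto simp: normal_in_def scalars_def)
qed

text \<open>Power maps preserve every subgroup of \<open>N\<close>, in particular one of order
  \<open>r\<close>, which would then be normal in \<open>Y\<close>.\<close>

lemma scalars_proper: "scalars \<noteq> Y"
proof
  assume e: "scalars = Y"
  obtain U where U: "subgroup U G" "U \<subseteq> N" "card U = r" using prime_subgroup_N by blast
  have "x \<otimes> u \<otimes> inv x \<in> U" if "x \<in> Y" "u \<in> U" for x u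
  proof -
    have "x \<in> scalars" "u \<in> T" using that e U(2) by auto
    then obtain a :: nat where "x \<otimes> u \<otimes> inv x = u [^] a" by (auto simp: scalars_def)
    then show ?thesis using subgroup_nat_pow_closed[OF U(1) that(2)] by simp
  qed
  then have "normal_in U Y" using U Y_subgroup N_Y by (auto simp: normal_in_def)
  then show False using no_prime_normal U(3) r by blast
qed

text \<open>On \<open>x\<close> and \<open>u\<close> the element \<open>g\<close> acts as a Jordan
  block with eigenvalue \<open>a\<close>, whose \<open>k\<close>-th power has \<open>a ^ k\<close>
  on the diagonal and \<open>k * a ^ (k - 1)\<close> off it. For \<open>k = 0\<close> the truncated
  exponent is harmless because its factor \<open>k\<close> vanishes.\<close>

lemma pow_iterate:
  assumes g: "g \<in> Y" and x: "x \<in> T" and u: "u \<in> N" "g \<otimes> x \<otimes> inv g = x [^] a \<otimes> u"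
    and gN: "g \<otimes> u \<otimes> inv g = u [^] (a::nat)"
  shows "g [^] (k::nat) \<otimes> x \<otimes> inv (g [^] k) = x [^] (a ^ k) \<otimes> u [^] (k * a ^ (k - 1))"
proof (induction k)
  case (Suc k)
  define v w where "v = x [^] (a ^ k)" and "w = u [^] (k * a ^ (k - 1))"
  have vw: "v \<in> T" "w \<in> N" using x u by (auto simp: v_def w_def)
  have gk: "g [^] k \<in> Y" using subgroup_nat_pow_closed[OF Y_subgroup g] .
  have "g [^] Suc k = g \<otimes> g [^] k" using g by (metis Yc nat_pow_Suc2)
  then have "g [^] Suc k \<otimes> x \<otimes> inv (g [^] Suc k) = g \<otimes> (g [^] k \<otimes> x \<otimes> inv (g [^] k)) \<otimes> inv g"
    using g gk x by (simp add: word_simps)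
  also have "\<dots> = (g \<otimes> v \<otimes> inv g) \<otimes> (g \<otimes> w \<otimes> inv g)"
    unfolding Suc using conj_mult[OF g vw(1), of w] vw by (simp add: v_def w_def)
  also have "g \<otimes> v \<otimes> inv g = (x [^] a \<otimes> u) [^] (a ^ k)"
    unfolding v_def using conj_pow[of g x] g x u by simp
  also have "\<dots> = x [^] (a ^ Suc k) \<otimes> u [^] (a ^ k)"
    using x u by (simp add: T_pow_mult nat_pow_pow)
  also have "g \<otimes> w \<otimes> inv g = u [^] (a * (k * a ^ (k - 1)))"
    unfolding w_def using conj_pow[of g u] g u gN by (simp add: nat_pow_pow)
  also have "x [^] (a ^ Suc k) \<otimes> u [^] (a ^ k) \<otimes> u [^] (a * (k * a ^ (k - 1)))
      = x [^] (a ^ Suc k) \<otimes> u [^] (a ^ k + a * (k * a ^ (k - 1)))"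
    using x u by (simp add: m_assoc nat_pow_mult)
  also have "a ^ k + a * (k * a ^ (k - 1)) = Suc k * a ^ (Suc k - 1)"
    by (cases k) (simp_all add: algebra_simps)
  finally show ?case .
qed (use x u in simp)

text \<open>Take \<open>y\<close> in a prime step above \<open>scalars\<close>, not itself a scalar,
  acting on \<open>T/N\<close> as \<open>a\<close>. Its eigenspace \<open>E\<close> for
  \<open>a\<close> is normal in \<open>Y\<close> and nontrivial, hence contains \<open>N\<close>; so
  \<open>y\<close> acts as \<open>a\<close> on both \<open>N\<close> and \<open>T/N\<close>. Then
  \<open>y [^] (r - 1)\<close> acts trivially on both, by \<open>trivial_on_factors\<close> on
  \<open>T\<close>, and the Jordan formula makes \<open>y\<close> a scalar after all.\<close>

lemma central_extension_impossible:
  assumes cT: "card T = r * card N"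
  shows False
proof -
  have NA: "N \<subseteq> scalars"
  proof
    fix z assume z: "z \<in> N"
    have "\<forall>x\<in>T. z \<otimes> x \<otimes> inv z = x [^] (1::nat)" using z T_central[OF z] by (simp add: m_assoc)
    then show "z \<in> scalars" using Nc[OF z] unfolding scalars_def by blast
  qed
  have "scalars \<subset> Y" using scalars_proper by (auto simp: scalars_def)
  then obtain L q where L: "normal_in L Y" "scalars \<subseteq> L" "prime_nat q" "card L = q * card scalars"
    using supersolvable_overD[OF quot[OF N nontriv] normal_scalars normal_in_self[OF Y_subgroup] NA] by blast
  note dL = normal_inD[OF L(1)] and dA = normal_inD[OF normal_scalars]
  have max: "maximal_in scalars L" using maximal_in_prime_index[OF dA(1) dL(1) L(2,4,3)] .
  then obtain y where y: "y \<in> L" "y \<notin> scalars" by (auto simp: maximal_in_def)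
  have yY: "y \<in> Y" using y dL(3) by auto
  obtain a where a: "acts_mod y a" using acts_mod_exists[OF yY] by blast
  have e_exp: "e [^] r = \<one>" if "e \<in> T" for e using T_exponent[OF cT that] .
  define E where "E = {x \<in> T. y \<otimes> x \<otimes> inv y = x [^] a}"
  have ET: "E \<subseteq> T" by (auto simp: E_def)
  have subE: "subgroup E G"
  proof (rule subgroup_finI)
    show "E \<subseteq> carrier G" using ET by auto
    show "\<one> \<in> E" using yY subgroup.one_closed[OF subT] by (simp add: E_def)
    show "b \<otimes> c \<in> E" if "b \<in> E" "c \<in> E" for b c
    proof -
      have bc: "b \<in> T" "c \<in> T" "y \<otimes> b \<otimes> inv y = b [^] a" "y \<otimes> c \<otimes> inv y = c [^] a" using that by (auto simp: E_def)
      then show ?thesis using conj_mult[OF yY bc(1,2)] by (simp add: E_def T_pow_mult)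
    qed
  qed
  \<comment> \<open>Every element of \<open>L\<close> acts on \<open>E\<close> by the same scalar as
    on \<open>T/N\<close>: this holds for \<open>scalars\<close> and for \<open>y\<close>, which
    generate \<open>L\<close>. Conjugates of \<open>y\<close> lie in \<open>L\<close> and act on
    \<open>T/N\<close> as \<open>a\<close>, hence also on \<open>E\<close>, which makes
    \<open>E\<close> invariant under \<open>Y\<close>.\<close>
  define M where "M = {z \<in> L. \<exists>m. (\<forall>e\<in>E. z \<otimes> e \<otimes> inv z = e [^] m) \<and> acts_mod z m}"
  have M_eq: "M = L"
  proof -
    have "subgroup M G"
    proof (rule subgroup_finI)
      show "M \<subseteq> carrier G" using dL(3) by (auto simp: M_def)
      have "\<forall>e\<in>T. \<one> \<otimes> e \<otimes> inv \<one> = e [^] (1::nat)" by simp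
      then have "(\<forall>e\<in>E. \<one> \<otimes> e \<otimes> inv \<one> = e [^] (1::nat)) \<and> acts_mod \<one> 1"
        using ET by (auto simp: acts_mod_def)
      then show "\<one> \<in> M" unfolding M_def using subgroup.one_closed[OF dL(1)] by blast
      fix b c assume "b \<in> M" "c \<in> M"
      then obtain m k where bc: "b \<in> L" "c \<in> L" "\<And>e. e \<in> E \<Longrightarrow> b \<otimes> e \<otimes> inv b = e [^] m" "acts_mod b m"
        "\<And>e. e \<in> E \<Longrightarrow> c \<otimes> e \<otimes> inv c = e [^] k" "acts_mod c k" by (auto simp: M_def)
      have bY: "b \<in> Y" "c \<in> Y" using bc dL(3) by auto
      have split: "b \<otimes> c \<otimes> e \<otimes> inv (b \<otimes> c) = b \<otimes> (c \<otimes> e \<otimes> inv c) \<otimes> inv b" if "e \<in> T" for e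
        using bY that by (simp add: word_simps)
      have 1: "b \<otimes> c \<otimes> e \<otimes> inv (b \<otimes> c) = e [^] (m * k)" if e: "e \<in> E" for e
      proof -
        have eT: "e \<in> T" using e ET by auto
        have "b \<otimes> c \<otimes> e \<otimes> inv (b \<otimes> c) = b \<otimes> (e [^] k) \<otimes> inv b" unfolding split[OF eT] bc(5)[OF e] ..
        also have "\<dots> = (e [^] m) [^] k" using conj_pow[of b e k] bc(3)[OF e] bY eT by simp
        finally show ?thesis using eT by (simp add: nat_pow_pow)
      qed
      have 2: "acts_mod (b \<otimes> c) (m * k)"
        unfolding acts_mod_def
      proof
        fix x assume x: "x \<in> T"
        define v where "v = c \<otimes> x \<otimes> inv c \<otimes> inv (x [^] k)"
        have v: "v \<in> N" using bc(6) x by (auto simp: acts_mod_def v_def)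
        have cv: "c \<otimes> x \<otimes> inv c = v \<otimes> x [^] k" using bY x by (simp add: v_def word_simps)
        have "b \<otimes> c \<otimes> x \<otimes> inv (b \<otimes> c) = (b \<otimes> v \<otimes> inv b) \<otimes> (b \<otimes> x [^] k \<otimes> inv b)"
          unfolding split[OF x] cv using conj_mult[OF bY(1)] v x by simp
        then have "b \<otimes> c \<otimes> x \<otimes> inv (b \<otimes> c) \<otimes> inv (x [^] (m * k))
            = (b \<otimes> v \<otimes> inv b) \<otimes> (b \<otimes> x [^] k \<otimes> inv b \<otimes> inv ((x [^] k) [^] m))"
          using bY v x by (simp add: m_assoc nat_pow_pow mult.commute)
        moreover have "b \<otimes> x [^] k \<otimes> inv b \<otimes> inv ((x [^] k) [^] m) \<in> N"
          using bc(4) x by (simp add: acts_mod_def)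
        ultimately show "b \<otimes> c \<otimes> x \<otimes> inv (b \<otimes> c) \<otimes> inv (x [^] (m * k)) \<in> N"
          using bY v N_closed(2) N_conj by metis
      qed
      show "b \<otimes> c \<in> M" unfolding M_def using 1 2 bc subgroup.m_closed[OF dL(1)] by blast
    qed
    moreover have "scalars \<subseteq> M"
    proof
      fix g assume g: "g \<in> scalars"
      then obtain m :: nat where m: "g \<in> Y" "\<And>x. x \<in> T \<Longrightarrow> g \<otimes> x \<otimes> inv g = x [^] m" by (auto simp: scalars_def)
      have "acts_mod g m" unfolding acts_mod_def using m by simp
      then show "g \<in> M" unfolding M_def using m ET L(2) g by blast
    qed
    moreover have "y \<in> M" using y a by (auto simp: M_def E_def)
    moreover have "M \<subseteq> L" by (auto simp: M_def)
    ultimately have "M = scalars \<or> M = L" "y \<in> M" using max unfolding maximal_in_def by blast+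
    then show ?thesis using y by blast
  qed
  have "normal_in E Y"
  proof -
    have "g \<otimes> e \<otimes> inv g \<in> E" if g: "g \<in> Y" and e: "e \<in> E" for g e
    proof -
      have eT: "e \<in> T" using e ET by auto
      define z where "z = inv g \<otimes> y \<otimes> g"
      have zL: "z \<in> L" unfolding z_def using normal_in_conj'[OF L(1) g y(1)] .
      then have zY: "z \<in> Y" using dL(3) by auto
      obtain m where m: "z \<otimes> e \<otimes> inv z = e [^] m" "acts_mod z m" using zL e unfolding M_eq[symmetric] by (auto simp: M_def)
      have "acts_mod z a"
        unfolding acts_mod_def
      proof
        fix x assume x: "x \<in> T"
        have "inv g \<otimes> (y \<otimes> (g \<otimes> x \<otimes> inv g) \<otimes> inv y \<otimes> inv ((g \<otimes> x \<otimes> inv g) [^] a)) \<otimes> g \<in> N"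
          using a x g by (intro normal_in_conj'[OF N g]) (simp add: acts_mod_def)
        also have "(g \<otimes> x \<otimes> inv g) [^] a = g \<otimes> x [^] a \<otimes> inv g" using conj_pow[of g x a] g x by simp
        finally show "z \<otimes> x \<otimes> inv z \<otimes> inv (x [^] a) \<in> N" using g x yY by (simp add: z_def word_simps)
      qed
      then have "[m = a] (mod r)" using acts_mod_unique[OF cT m(2)] zY by blast
      then have "e [^] m = e [^] a" using pow_cong_exponent[of e r] e_exp[OF eT] eT by simp
      then have zz: "z \<otimes> e \<otimes> inv z = e [^] a" using m(1) by simp
      have "y \<otimes> (g \<otimes> e \<otimes> inv g) \<otimes> inv y = g \<otimes> (z \<otimes> e \<otimes> inv z) \<otimes> inv g"
        using g eT yY by (simp add: z_def word_simps)
      also have "\<dots> = (g \<otimes> e \<otimes> inv g) [^] a" unfolding zz using conj_pow[of g e a] g eT by simp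
      finally show ?thesis using g eT by (simp add: E_def)
    qed
    then show ?thesis using subE Y_subgroup ET T_Y by (auto simp: normal_in_def)
  qed
  \<comment> \<open>\<open>\<psi>\<close> maps \<open>T\<close> into the smaller group
    \<open>N\<close>, and its fibres are the cosets of \<open>E\<close>, so it cannot be
    injective.\<close>
  moreover have "E \<noteq> {\<one>}"
  proof
    assume E1: "E = {\<one>}"
    define \<psi> where "\<psi> x = y \<otimes> x \<otimes> inv y \<otimes> inv (x [^] a)" for x
    have "card T = card E * card (\<psi> ` T)"
    proof (rule card_fibres_subgroup[OF subT subE ET])
      fix x z assume xz: "x \<in> T" "z \<in> T"
      define b c where "b = y \<otimes> x \<otimes> inv y" and "c = y \<otimes> z \<otimes> inv y"
      have bc: "b \<in> T" "c \<in> T" using xz yY by (auto simp: b_def c_def)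
      have 1: "y \<otimes> (inv x \<otimes> z) \<otimes> inv y = inv b \<otimes> c" using xz yY by (simp add: b_def c_def word_simps)
      have 2: "(inv x \<otimes> z) [^] a = inv (x [^] a) \<otimes> z [^] a" using xz T_pow_mult[of "inv x" z a] by (simp add: nat_pow_inv)
      have "\<psi> x = \<psi> z \<longleftrightarrow> b \<otimes> inv (x [^] a) = c \<otimes> inv (z [^] a)" by (simp add: \<psi>_def b_def c_def)
      also have "\<dots> \<longleftrightarrow> inv b \<otimes> (b \<otimes> inv (x [^] a)) \<otimes> z [^] a = inv b \<otimes> (c \<otimes> inv (z [^] a)) \<otimes> z [^] a"
        using bc xz by simp
      also have "\<dots> \<longleftrightarrow> inv (x [^] a) \<otimes> z [^] a = inv b \<otimes> c"
        using bc xz by (simp add: word_simps)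
      also have "\<dots> \<longleftrightarrow> inv x \<otimes> z \<in> E" using 1 2 xz by (auto simp: E_def)
      finally show "\<psi> x = \<psi> z \<longleftrightarrow> inv x \<otimes> z \<in> E" .
    qed
    then have "card T = card (\<psi> ` T)" using E1 by simp
    moreover have "\<psi> ` T \<subseteq> N" using a by (auto simp: acts_mod_def \<psi>_def)
    then have "card (\<psi> ` T) \<le> card N" using subgroup_finite[OF subN] card_mono by blast
    ultimately have "r * card N \<le> card N" using cT by simp
    then show False using subgroup_card_pos[OF subN] prime_gt_1_nat[OF r] by simp
  qed
  ultimately have NE: "N \<subseteq> E" using N_unique by blast
  \<comment> \<open>\<open>a\<close> is a unit modulo \<open>r\<close> because conjugation by
    \<open>y\<close> is injective on \<open>N\<close>. Both Fermat's theorem and the cancellation at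
    the end depend on this.\<close>
  have ra: "\<not> r dvd a"
  proof
    assume "r dvd a"
    then obtain b where b: "a = r * b" by (auto elim: dvdE)
    obtain x where x: "x \<in> N" "x \<noteq> \<one>" using nontriv N_closed(1) by blast
    have "y \<otimes> x \<otimes> inv y = (x [^] r) [^] b" using NE x b by (auto simp: E_def nat_pow_pow)
    then have "y \<otimes> x \<otimes> inv y = \<one>" using N_exponent[OF x(1)] by simp
    then have "inv y \<otimes> (y \<otimes> x \<otimes> inv y) \<otimes> y = inv y \<otimes> \<one> \<otimes> y" by simp
    then show False using x yY by (simp add: word_simps)
  qed
  then have fermat: "[a ^ (r - 1) = 1] (mod r)" using fermat_theorem[OF r] by blast
  define g where "g = y [^] (r - 1)"
  have gY: "g \<in> Y" unfolding g_def using subgroup_nat_pow_closed[OF Y_subgroup yY] .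
  have it: "g \<otimes> x \<otimes> inv g = x \<otimes> u [^] ((r - 1) * a ^ (r - 1 - 1))"
    if "x \<in> T" "u \<in> N" "y \<otimes> x \<otimes> inv y = x [^] a \<otimes> u" for x u
  proof -
    have "y \<otimes> u \<otimes> inv y = u [^] a" using NE that by (auto simp: E_def)
    then have "g \<otimes> x \<otimes> inv g = x [^] (a ^ (r - 1)) \<otimes> u [^] ((r - 1) * a ^ (r - 1 - 1))"
      using pow_iterate[OF yY that] unfolding g_def by blast
    moreover have "x [^] (a ^ (r - 1)) = x [^] (1::nat)" using pow_cong_exponent[OF _ _ fermat] e_exp that by simp
    ultimately show ?thesis using that by simp
  qed
  have comm_g: "g \<otimes> x = x \<otimes> g" if x: "x \<in> T" for x
  proof (rule trivial_on_factors[OF cT gY _ _ x])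
    fix x assume x: "x \<in> N"
    then have "y \<otimes> x \<otimes> inv y = x [^] a \<otimes> \<one>" using NE by (auto simp: E_def)
    then have "g \<otimes> x \<otimes> inv g = x" using it[of x \<one>] x by simp
    then have "g \<otimes> x \<otimes> inv g \<otimes> g = x \<otimes> g" by simp
    then show "g \<otimes> x = x \<otimes> g" using gY x by (simp add: m_assoc)
  next
    fix x assume x: "x \<in> T"
    define u where "u = inv (x [^] a) \<otimes> (y \<otimes> x \<otimes> inv y)"
    have "u = y \<otimes> x \<otimes> inv y \<otimes> inv (x [^] a)" unfolding u_def using x yY by (intro T_comm) auto
    then have u: "u \<in> N" using a x by (auto simp: acts_mod_def)
    have "y \<otimes> x \<otimes> inv y = x [^] a \<otimes> u" using x yY by (simp add: u_def cancel_inv)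
    then have gx: "g \<otimes> x \<otimes> inv g = x \<otimes> u [^] ((r - 1) * a ^ (r - 1 - 1))" using it[OF x u] by blast
    have "u [^] ((r - 1) * a ^ (r - 1 - 1)) \<in> N" using u by simp
    then show "g \<otimes> x \<otimes> inv g \<otimes> inv x \<in> N"
      unfolding gx using x T_comm[OF x, of "u [^] ((r - 1) * a ^ (r - 1 - 1))"] u by (simp add: m_assoc)
  qed
  have "y \<otimes> x \<otimes> inv y = x [^] a" if x: "x \<in> T" for x
  proof -
    define u where "u = inv (x [^] a) \<otimes> (y \<otimes> x \<otimes> inv y)"
    have "u = y \<otimes> x \<otimes> inv y \<otimes> inv (x [^] a)" unfolding u_def using x yY by (intro T_comm) auto
    then have u: "u \<in> N" using a x by (auto simp: acts_mod_def)
    have yx: "y \<otimes> x \<otimes> inv y = x [^] a \<otimes> u" using x yY by (simp add: u_def cancel_inv)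
    have "x \<otimes> u [^] ((r - 1) * a ^ (r - 1 - 1)) = g \<otimes> x \<otimes> inv g" using it[OF x u yx] by simp
    also have "\<dots> = x" using comm_g[OF x] gY x by (simp add: m_assoc)
    finally have "u [^] ((r - 1) * a ^ (r - 1 - 1)) \<in> {\<one>}" using x u by simp
    moreover have "u [^] r \<in> {\<one>}" using N_exponent[OF u] by simp
    \<comment> \<open>The off-diagonal entry of the \<open>(r - 1)\<close>-th power is a unit modulo
      \<open>r\<close>, so triviality of that power forces the Jordan part \<open>u\<close> to
      vanish.\<close>
    moreover have "coprime ((r - 1) * a ^ (r - 1 - 1)) r"
    proof -
      have "\<not> r dvd r - 1" using prime_gt_1_nat[OF r] by (auto dest: dvd_imp_le)
      then have "\<not> r dvd (r - 1) * a ^ (r - 1 - 1)"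
        using ra r by (meson prime_dvd_mult_iff prime_dvd_power)
      then show ?thesis using r prime_imp_coprime coprime_commute by blast
    qed
    ultimately have "u \<in> {\<one>}" using pow_coprime_mem[OF triv_subgroup] u by simp
    then show ?thesis using yx x by simp
  qed
  then have "y \<in> scalars" using yY unfolding scalars_def by blast
  then show False using y(2) by simp
qed

end

section \<open>The supersolvable complement\<close>

context minimal_nonsupersolvable
begin

lemma centralizer_N: "centralizer_in Y N = N"
proof (rule ccontr)
  assume ne: "centralizer_in Y N \<noteq> N"
  have "N \<subseteq> centralizer_in Y N" using N_comm by (auto simp: centralizer_in_def)
  then have "N \<subset> centralizer_in Y N" using ne by blast
  then obtain L p where L: "normal_in L Y" "N \<subseteq> L" "L \<subseteq> centralizer_in Y N" "prime_nat p" "card L = p * card N"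
    using supersolvable_overD[OF quot[OF N nontriv] N normal_in_centralizer[OF N] subset_refl] by blast
  have max: "maximal_in N L" using maximal_in_prime_index[OF subN normal_inD(1)[OF L(1)] L(2,5,4)] .
  then obtain t where t: "t \<in> L" "t \<notin> N" by (auto simp: maximal_in_def)
  interpret T: central_extension G Y N r n L t
    by unfold_locales (use L max t in \<open>auto simp: centralizer_in_def\<close>)
  have "p = r" using T.index_T_prime L(4,5) by blast
  then show False using T.central_extension_impossible L(5) by blast
qed

text \<open>For \<open>K\<close> between \<open>S\<close> and \<open>Y\<close>,
  \<open>N <#> K = Y\<close> makes \<open>N \<inter> K\<close> normal in \<open>Y\<close>.
  Minimality of \<open>N\<close> then leaves only the two ends.\<close>

lemma complement_maximal:
  assumes S: "subgroup S G" "S \<subseteq> Y" "N \<inter> S = {\<one>}" "N <#> S = Y"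
  shows "maximal_in S Y"
proof -
  have "K = S \<or> K = Y" if K: "subgroup K G" "S \<subseteq> K" "K \<subseteq> Y" for K
  proof -
    have NK: "N <#> K = Y"
      using set_mult_subset[OF Y_subgroup N_Y K(3)] mono_set_mult[of N N S K G] K(2) S(4) by blast
    have "N \<inter> K = {\<one>} \<or> N \<inter> K = N" using minimal[OF normal_Int_supplement[OF K(1,3) NK]] by blast
    then show ?thesis
    proof
      assume "N \<inter> K = {\<one>}"
      then have "card N * card K = card N * card S"
        using card_set_mult_trivial[OF subN K(1)] card_set_mult_trivial[OF subN S(1,3)] NK S(4) by simp
      then have "card K = card S" using subgroup_card_pos[OF subN] by simp
      then show ?thesis using subgroup_eq_card[OF K(1,2)] by simp
    next
      assume "N \<inter> K = N"
      then have "N <#> S \<subseteq> K" using set_mult_subset[OF K(1) _ K(2)] by blast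
      then show ?thesis using S(4) K(3) by blast
    qed
  qed
  moreover have "S \<noteq> Y" using S(3) nontriv N_Y by blast
  ultimately show ?thesis using S Y_subgroup unfolding maximal_in_def by blast
qed

text \<open>\<open>S\<close> is isomorphic to \<open>Y/N\<close>. In place of the isomorphism,
  \<open>N <#> K\<close> takes normal subgroups \<open>K\<close> of \<open>S\<close> to normal
  subgroups of \<open>Y\<close>, and \<open>L \<inter> S\<close> takes a step in \<open>Y\<close>
  back to one in \<open>S\<close> of the same index.\<close>

lemma complement_supersolvable:
  assumes S: "subgroup S G" "S \<subseteq> Y" "N \<inter> S = {\<one>}" "N <#> S = Y"
  shows "supersolvable_over {\<one>} S"
  unfolding supersolvable_over_def
proof (intro conjI allI impI, rule normal_in_one[OF S(1)], elim conjE)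
  have prod_normal: "normal_in (N <#> K) Y" if K: "normal_in K S" for K
  proof -
    note dK = normal_inD[OF K]
    have sub: "subgroup (N <#> K) G" using subgroup_prod[OF N dK(1)] dK(3) S(2) by blast
    have sup: "N \<subseteq> N <#> K" using set_mult_superset subN dK by auto
    have "y \<otimes> a \<otimes> inv y \<in> N <#> K" if y: "y \<in> Y" and a: "a \<in> N <#> K" for y a
    proof -
      obtain m s where ms: "m \<in> N" "s \<in> S" "y = m \<otimes> s" using y S(4) by (auto simp: set_mult_def)
      obtain b k where bk: "b \<in> N" "k \<in> K" "a = b \<otimes> k" using a by (auto simp: set_mult_def)
      have c: "s \<in> Y" "k \<in> Y" using ms bk S(2) dK(3) by auto
      have "(s \<otimes> b \<otimes> inv s) \<otimes> (s \<otimes> k \<otimes> inv s) \<in> N <#> K"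
        using normal_inD(4)[OF N c(1) bk(1)] dK(4)[OF ms(2) bk(2)] by (rule set_mult_memI)
      then have "m \<otimes> ((s \<otimes> b \<otimes> inv s) \<otimes> (s \<otimes> k \<otimes> inv s)) \<otimes> inv m \<in> N <#> K"
        using sup ms(1) subgroup.m_closed[OF sub] by (meson N_closed(3) subsetD)
      moreover have "y \<otimes> a \<otimes> inv y = m \<otimes> ((s \<otimes> b \<otimes> inv s) \<otimes> (s \<otimes> k \<otimes> inv s)) \<otimes> inv m"
        using ms bk c by (simp add: word_simps)
      ultimately show ?thesis by simp
    qed
    then show ?thesis using sub Y_subgroup set_mult_subset[OF Y_subgroup N_Y] dK(3) S(2) by (auto simp: normal_in_def)
  qed
  have card_prod: "card (N <#> K) = card N * card K" if "subgroup K G" "K \<subseteq> S" for K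
    by (rule card_set_mult_trivial[OF subN that(1)]) (use S(3) that subgroup.one_closed[OF that(1)] in blast)
  fix K W assume K: "normal_in K S" and W: "normal_in W S" and KW: "K \<subset> W"
  note dK = normal_inD[OF K] and dW = normal_inD[OF W]
  have "card K < card W" using KW subgroup_finite[OF dW(1)] psubset_card_mono by blast
  then have "N <#> K \<noteq> N <#> W"
    using card_prod[OF dK(1,3)] card_prod[OF dW(1,3)] subgroup_card_pos[OF subN] by auto
  then have "N <#> K \<subset> N <#> W" using mono_set_mult[of N N K W G] KW by blast
  moreover have sup: "N \<subseteq> N <#> K" "K \<subseteq> N <#> K" using set_mult_superset subN dK by auto
  ultimately obtain L p where L: "normal_in L Y" "N <#> K \<subseteq> L" "L \<subseteq> N <#> W" "prime_nat p" "card L = p * card (N <#> K)"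
    using supersolvable_overD[OF quot[OF N nontriv] prod_normal[OF K] prod_normal[OF W]] by blast
  note dL = normal_inD[OF L(1)]
  have LS: "normal_in (L \<inter> S) S" using normal_in_Int_subgroup[OF L(1) S(1,2)] .
  have "L = N <#> (L \<inter> S)" using dedekind_prod[OF subN S(1) dL(1)] sup L(2) dL(3) S(4) by blast
  then have "card L = card (N <#> (L \<inter> S))" by (rule arg_cong)
  moreover have "card (N <#> (L \<inter> S)) = card N * card (L \<inter> S)"
    by (rule card_prod[OF normal_inD(1)[OF LS]]) simp
  ultimately have "card N * card (L \<inter> S) = p * (card N * card K)"
    unfolding L(5) card_prod[OF dK(1,3)] by metis
  then have "card N * card (L \<inter> S) = card N * (p * card K)" by (metis mult.left_commute)
  then have "card (L \<inter> S) = p * card K" by (simp only: nat_mult_eq_cancel1[OF subgroup_card_pos[OF subN]])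
  moreover have "K \<subseteq> L \<inter> S" using sup L(2) dK(3) by blast
  moreover have "L \<inter> S \<subseteq> W"
  proof
    fix x assume x: "x \<in> L \<inter> S"
    then obtain b w where bw: "b \<in> N" "w \<in> W" "x = b \<otimes> w" using L(3) by (auto simp: set_mult_def)
    have c: "w \<in> S" "w \<in> Y" using bw dW(3) S(2) by auto
    have "x \<otimes> inv w \<in> S" using x c subgroup.m_closed[OF S(1)] subgroup.m_inv_closed[OF S(1)] by blast
    then have "b \<in> N \<inter> S" using bw c by (simp add: m_assoc)
    then have "b = \<one>" using S(3) by simp
    then show "x \<in> W" using bw c by simp
  qed
  ultimately show "\<exists>L p. normal_in L S \<and> K \<subseteq> L \<and> L \<subseteq> W \<and> prime_nat p \<and> card L = p * card K"
    using LS L(4) by blast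
qed

lemma n_ge_2: "n \<ge> 2"
proof (rule ccontr)
  assume "\<not> n \<ge> 2"
  then have "n = 1" using n_pos by simp
  then have "card N = r" using card_N by simp
  then show False using no_prime_normal[OF N] r by simp
qed

text \<open>A subgroup \<open>U\<close> of order \<open>r\<close> in the complement \<open>S\<close> would start two maximal chains of
  different lengths, one through \<open>S\<close> and one through the \<open>r\<close>-group \<open>NU\<close>.\<close>

lemma primitive_type_exists:
  assumes mu: "minimal_uniform Y"
  shows "\<exists>S. primitive_type Y N S r n"
proof -
  obtain S where S: "subgroup S G" "S \<subseteq> Y" "N \<inter> S = {\<one>}" "N <#> S = Y"
    using complement_exists[OF centralizer_N] by blast
  have max: "maximal_in S Y" using complement_maximal[OF S] .
  have ss: "supersolvable_over {\<one>} S" using complement_supersolvable[OF S] .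
  have cY: "card Y = card N * card S" using card_set_mult_trivial[OF subN S(1,3)] S(4) by simp
  have "S \<noteq> {\<one>}"
  proof
    assume "S = {\<one>}"
    then have "card Y = card N" using cY by simp
    then show False using subgroup_eq_card[OF Y_subgroup N_Y] N_neq_Y by simp
  qed
  moreover have "\<not> r dvd card S"
  proof
    assume "r dvd card S"
    then obtain U where U: "subgroup U G" "U \<subseteq> S" "card U = r" using cauchy_subgroup[OF S(1) r] by blast
    have UY: "U \<subseteq> Y" using U(2) S(2) by blast
    have un: "uniform_chains U Y" using mu U UY r by (auto simp: minimal_uniform_def)
    have U1: "{\<one>} \<subseteq> U" using subgroup.one_closed[OF U(1)] by simp
    obtain c where c: "card S = r * c" using \<open>r dvd card S\<close> by (auto elim: dvdE)
    have cpos: "c > 0" using c subgroup_card_pos[OF S(1)] by (cases c) auto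
    have "chain_len U S (Omega c)"
      using supersolvable_chain[OF ss U(1) U1 U(2)] c U(3) prime_gt_0_nat[OF r] by simp
    \<comment> \<open>With \<open>card S = r * c\<close>, the way through \<open>S\<close> has
      \<open>Omega c\<close> steps up to \<open>S\<close> and one more. The way through
      \<open>N <#> U\<close>, of order \<open>r ^ Suc n\<close>, has \<open>n\<close> steps and then
      \<open>Omega c\<close>.\<close>
    then have 1: "chain_len U Y (Suc (Omega c))" using chain_step max by blast
    have NU: "N \<inter> U = {\<one>}" using S(3) U(2) U1 by blast
    have sub: "subgroup (N <#> U) G" using subgroup_prod[OF N U(1) UY] .
    have sup: "N \<subseteq> N <#> U" "U \<subseteq> N <#> U" using set_mult_superset subN U by auto
    have cNU: "card (N <#> U) = r ^ Suc n" using card_set_mult_trivial[OF subN U(1) NU] U(3) card_N by simp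
    have "chain_len U (N <#> U) (Suc n - 1)" using p_group_chain[OF r sub cNU U(1) sup(2), of 1] U(3) by simp
    moreover have "chain_len (N <#> U) Y (Omega (card Y div card (N <#> U)))"
      using supersolvable_chain[OF quot[OF N nontriv] sub sup(1)] set_mult_subset[OF Y_subgroup N_Y UY] by blast
    moreover have "card Y div card (N <#> U) = c"
      using cY c cNU card_N prime_gt_0_nat[OF r] by simp
    ultimately have "chain_len U Y (n + Omega c)" using chain_trans by fastforce
    then have "n = 1" using 1 un unfolding uniform_chains_def by fastforce
    then show False using n_ge_2 by simp
  qed
  ultimately show ?thesis
    unfolding primitive_type_def
    using N S r card_N n_ge_2 N_unique centralizer_N quot[OF N nontriv] ss max by blast
qed

end

section \<open>Fusion\<close>

text \<open>\<open>C\<close> decomposes into cycles of \<open>\<pi>\<close>. The cycle through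
  \<open>c\<close>, whose length is the least \<open>n > 0\<close> with
  \<open>(\<pi> ^^ n) c = c\<close>, is split off, and induction treats the rest. This evaluates the
  transfer, with \<open>\<pi>\<close> the translation of cosets by one element.\<close>

lemma cyclic_sums_cong:
  fixes w :: "'x \<Rightarrow> nat"
  assumes "finite C" "\<And>c. c \<in> C \<Longrightarrow> \<pi> c \<in> C" "inj_on \<pi> C"
    "\<And>c n. c \<in> C \<Longrightarrow> n > 0 \<Longrightarrow> (\<pi> ^^ n) c = c \<Longrightarrow> [(\<Sum>i<n. w ((\<pi> ^^ i) c)) = n * l] (mod p)"
  shows "[sum w C = card C * l] (mod p)"
  using assms
proof (induction "card C" arbitrary: C rule: less_induct)
  case less
  show ?case
  proof (cases "C = {}")
    case False
    then obtain c where c: "c \<in> C" by blast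
    have mem: "(\<pi> ^^ i) c \<in> C" for i by (induction i) (use c less.prems in auto)
    have cancel: "(\<pi> ^^ (i + k)) c = (\<pi> ^^ i) c \<Longrightarrow> (\<pi> ^^ k) c = c" for i k
    proof (induction i)
      case (Suc i)
      then have "\<pi> ((\<pi> ^^ (i + k)) c) = \<pi> ((\<pi> ^^ i) c)" by simp
      then have "(\<pi> ^^ (i + k)) c = (\<pi> ^^ i) c" using less.prems(3) mem by (auto dest: inj_onD)
      then show ?case using Suc by simp
    qed simp
    have "\<not> inj_on (\<lambda>i. (\<pi> ^^ i) c) {..card C}"
    proof
      assume "inj_on (\<lambda>i. (\<pi> ^^ i) c) {..card C}"
      moreover have "(\<lambda>i. (\<pi> ^^ i) c) ` {..card C} \<subseteq> C" using mem by auto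
      ultimately have "card {..card C} \<le> card C" using card_inj_on_le less.prems(1) by blast
      then show False by simp
    qed
    then obtain i j where ij: "i \<noteq> j" "(\<pi> ^^ i) c = (\<pi> ^^ j) c" by (auto simp: inj_on_def)
    have ex: "\<exists>n>0. (\<pi> ^^ n) c = c"
    proof (cases "i < j")
      case True
      then show ?thesis using cancel[of i "j - i"] ij by (intro exI[of _ "j - i"]) auto
    next
      case False
      then show ?thesis using cancel[of j "i - j"] ij by (intro exI[of _ "i - j"]) auto
    qed
    define n where "n = (LEAST n. n > 0 \<and> (\<pi> ^^ n) c = c)"
    have n: "n > 0" "(\<pi> ^^ n) c = c" using LeastI_ex[OF ex] by (auto simp: n_def)
    have least: "n \<le> k" if "k > 0" "(\<pi> ^^ k) c = c" for k using that by (auto simp: n_def intro: Least_le)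
    have inj: "inj_on (\<lambda>i. (\<pi> ^^ i) c) {..<n}"
    proof (rule linorder_inj_onI)
      fix i j assume "i < j" "i \<in> {..<n}" "j \<in> {..<n}"
      then show "(\<pi> ^^ i) c \<noteq> (\<pi> ^^ j) c" using cancel[of i "j - i"] least[of "j - i"] by auto
    qed auto
    define B where "B = (\<lambda>i. (\<pi> ^^ i) c) ` {..<n}"
    have BC: "B \<subseteq> C" using mem by (auto simp: B_def)
    have finB: "finite B" by (simp add: B_def)
    have cB: "card B = n" using inj by (simp add: B_def card_image)
    have sumB: "[sum w B = card B * l] (mod p)"
      using less.prems(4)[OF c n] inj by (simp add: cB) (simp add: B_def sum.reindex)
    have pre: "d \<in> B" if "d \<in> C" "\<pi> d \<in> B" for d
    proof -
      from that obtain i where i: "i < n" "\<pi> d = (\<pi> ^^ i) c" by (auto simp: B_def)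
      \<comment> \<open>The predecessor on the cycle, wrapping from index 0 to
        \<open>n - 1\<close>.\<close>
      define k where "k = (if i = 0 then n - 1 else i - 1)"
      have "(\<pi> ^^ Suc k) c = (\<pi> ^^ i) c" using n by (cases i; cases n) (auto simp: k_def)
      then have "\<pi> d = \<pi> ((\<pi> ^^ k) c)" using i by simp
      then have "d = (\<pi> ^^ k) c" using less.prems(3) that(1) mem by (auto dest: inj_onD)
      moreover have "k < n" using i n by (auto simp: k_def)
      ultimately show ?thesis by (auto simp: B_def)
    qed
    have "[sum w (C - B) = card (C - B) * l] (mod p)"
    proof (rule less.hyps)
      have "c \<in> B" using n(1) by (auto simp: B_def intro: image_eqI[of _ _ 0])
      then show "card (C - B) < card C" using c less.prems(1) by (auto intro: psubset_card_mono)
      show "\<And>d. d \<in> C - B \<Longrightarrow> \<pi> d \<in> C - B" using pre less.prems(2) by auto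
      show "inj_on \<pi> (C - B)" using less.prems(3) by (auto intro: inj_on_diff)
    qed (use less.prems in auto)
    then have "[sum w (C - B) + sum w B = card (C - B) * l + card B * l] (mod p)"
      using sumB by (rule cong_add)
    moreover have "sum w (C - B) + sum w B = sum w C" using BC less.prems(1) by (simp add: sum.subset_diff)
    moreover have "card (C - B) * l + card B * l = card C * l"
      using BC less.prems(1) finB card_mono[OF less.prems(1) BC]
      by (simp add: card_Diff_subset flip: add_mult_distrib)
    ultimately show ?thesis by simp
  qed simp
qed

section \<open>Coprime action\<close>

context fin_group
begin

text \<open>Let \<open>K\<close> be a maximal normal subgroup of \<open>Y\<close> in
  \<open>D\<close> that \<open>Q\<close> centralizes. A prime step above \<open>K\<close> inside
  \<open>D\<close> has \<open>p\<close> cosets, too few for a \<open>q\<close>-group with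
  \<open>q > p\<close> to move any of them. Coprimality of the exponents then lifts the trivial
  action on \<open>K\<close> and on the factor to the whole step.\<close>

lemma coprime_action_trivial:
  assumes "supersolvable_over {\<one>} Y" "normal_in D Y" "card D = p ^ j" "prime_nat p"
    "subgroup Q G" "Q \<subseteq> Y" "card Q = q ^ e" "prime_nat q" "p < q"
  shows "\<forall>y\<in>Q. \<forall>d\<in>D. y \<otimes> d = d \<otimes> y"
proof -
  note dD = normal_inD[OF assms(2)]
  have Yc [simp]: "x \<in> carrier G" if "x \<in> Y" for x using that dD(2) by (simp add: subgroup.mem_carrier)
  define S where "S = {K. normal_in K Y \<and> K \<subseteq> D \<and> (\<forall>y\<in>Q. \<forall>d\<in>K. y \<otimes> d = d \<otimes> y)}"
  have "finite S"
    by (rule finite_subset[of _ "Pow D"]) (use subgroup_finite[OF dD(1)] in \<open>auto simp: S_def\<close>)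
  moreover have "{\<one>} \<in> S"
    using normal_in_one[OF dD(2)] subgroup.one_closed[OF dD(1)] assms(6) Yc
    by (auto simp: S_def subset_iff simp del: Yc)
  ultimately obtain K where K: "K \<in> S" and Kmax: "\<And>L. L \<in> S \<Longrightarrow> K \<subseteq> L \<Longrightarrow> K = L"
    using finite_has_maximal[of S] by blast
  have KY: "normal_in K Y" "K \<subseteq> D" and KQ: "\<And>y d. y \<in> Q \<Longrightarrow> d \<in> K \<Longrightarrow> y \<otimes> d = d \<otimes> y"
    using K by (auto simp: S_def)
  note dK = normal_inD[OF KY(1)]
  have "K = D"
  proof (rule ccontr)
    assume "K \<noteq> D"
    then have "K \<subset> D" using KY by blast
    moreover have "{\<one>} \<subseteq> K" using subgroup.one_closed[OF dK(1)] by simp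
    ultimately obtain L s where L: "normal_in L Y" "K \<subseteq> L" "L \<subseteq> D" "prime_nat s" "card L = s * card K"
      using supersolvable_overD[OF assms(1) KY(1) assms(2)] by blast
    note dL = normal_inD[OF L(1)]
    have "s dvd p ^ j" using card_subgroup_dvd[OF dL(1) dD(1) L(3)] L(5) assms(3) by (metis dvd_mult_left)
    then have sp: "s = p" using L(4) assms(4) by (meson prime_dvd_power primes_dvd_imp_eq)
    define C where "C = (\<lambda>x. x <# K) ` L"
    have fC: "finite C" using subgroup_finite[OF dL(1)] by (simp add: C_def)
    have "card L = card K * card C" unfolding C_def by (rule card_cosets_subgroup[OF dL(1) dK(1) L(2)])
    then have cC: "card C = p" using L(5) sp subgroup_card_pos[OF dK(1)] by simp
    define act where "act y c = (\<lambda>x. y \<otimes> x \<otimes> inv y) ` c" for y and c :: "'a set"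
    have act_coset: "act y (x <# K) = (y \<otimes> x \<otimes> inv y) <# K" if y: "y \<in> Q" and x: "x \<in> L" for x y
    proof -
      have yx: "y \<in> Y" "x \<in> Y" using x y assms(6) dL(3) by auto
      have "y \<otimes> (x \<otimes> k) \<otimes> inv y = (y \<otimes> x \<otimes> inv y) \<otimes> k" if k: "k \<in> K" for k
      proof -
        have "y \<otimes> (x \<otimes> k) \<otimes> inv y = y \<otimes> x \<otimes> inv y \<otimes> (y \<otimes> k \<otimes> inv y)"
          using yx k dK(3) by (simp add: word_simps subsetD)
        also have "y \<otimes> k \<otimes> inv y = k" using KQ[OF y k] yx subsetD[OF dK(3) k] by (simp add: m_assoc)
        finally show ?thesis .
      qed
      then have "(\<lambda>k. y \<otimes> (x \<otimes> k) \<otimes> inv y) ` K = (\<lambda>k. (y \<otimes> x \<otimes> inv y) \<otimes> k) ` K" by (rule image_cong[OF refl])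
      moreover have "z <# K = (\<lambda>k. z \<otimes> k) ` K" for z by (auto simp: l_coset_def)
      ultimately show ?thesis by (simp add: act_def image_image)
    qed
    \<comment> \<open>The moved cosets only: on them \<open>Q\<close> has no fixed points, so
      \<open>q\<close> divides their number, which is at most \<open>p\<close>.\<close>
    define M where "M = {c \<in> C. \<exists>y\<in>Q. act y c \<noteq> c}"
    have QY: "y \<in> Y" if "y \<in> Q" for y using that assms(6) by auto
    have act_one: "act \<one> c = c" if "c \<in> C" for c
    proof -
      from that obtain x where x: "x \<in> L" "c = x <# K" by (auto simp: C_def)
      have "x \<in> Y" using x dL(3) by auto
      then show ?thesis using act_coset[OF subgroup.one_closed[OF assms(5)] x(1)] x(2) by simp
    qed
    have act_C: "act y c \<in> C" if "y \<in> Q" "c \<in> C" for y c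
    proof -
      from that obtain x where x: "x \<in> L" "c = x <# K" by (auto simp: C_def)
      then show ?thesis using act_coset[OF that(1) x(1)] dL(4)[OF QY[OF that(1)] x(1)] by (auto simp: C_def)
    qed
    have act_mult: "act (y \<otimes> z) c = act y (act z c)" if "y \<in> Q" "z \<in> Q" "c \<in> C" for y z c
    proof -
      from that obtain x where x: "x \<in> L" "c = x <# K" by (auto simp: C_def)
      have "y \<in> Y" "z \<in> Y" "x \<in> Y" using x dL(3) QY that by auto
      then have "(y \<otimes> z) \<otimes> x \<otimes> inv (y \<otimes> z) = y \<otimes> (z \<otimes> x \<otimes> inv z) \<otimes> inv y" by (simp add: word_simps)
      then show ?thesis
        using act_coset[of "y \<otimes> z" x] act_coset[of z x] act_coset[of y "z \<otimes> x \<otimes> inv z"] x that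
          subgroup.m_closed[OF assms(5)] dL(4)[OF QY] by simp
    qed
    have fM: "finite M" using fC by (simp add: M_def)
    have act_M: "act y c \<in> M" if "y \<in> Q" "c \<in> M" for y c
    proof -
      have c: "c \<in> C" using that by (simp add: M_def)
      from that obtain z where z: "z \<in> Q" "act z c \<noteq> c" by (auto simp: M_def)
      have "act (inv y) (act y c) = c"
        using act_mult[of "inv y" y c] act_one[OF c] that(1) c QY subgroup.m_inv_closed[OF assms(5)] by simp
      have "\<exists>w\<in>Q. act w (act y c) \<noteq> act y c"
      proof (rule ccontr)
        assume "\<not> (\<exists>w\<in>Q. act w (act y c) \<noteq> act y c)"
        then have fixed: "\<And>w. w \<in> Q \<Longrightarrow> act w (act y c) = act y c" by blast
        then have "act y c = c"
          using \<open>act (inv y) (act y c) = c\<close> that(1) subgroup.m_inv_closed[OF assms(5)] by auto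
        then show False using fixed[OF z(1)] z(2) by simp
      qed
      then show ?thesis using act_C[OF that(1) c] by (simp add: M_def)
    qed
    have "q dvd card M \<longleftrightarrow> q dvd card {c \<in> M. \<forall>y\<in>Q. act y c = c}"
      by (rule card_fixed_points_cong[OF assms(5,7,8) fM])
        (use act_one act_mult act_M in \<open>auto simp: M_def\<close>)
    moreover have "{c \<in> M. \<forall>y\<in>Q. act y c = c} = {}" by (auto simp: M_def)
    ultimately have "q dvd card M" by simp
    moreover have "card M \<le> p" using card_mono[OF fC, of M] cC by (auto simp: M_def)
    ultimately have "card M = 0" using assms(9) by (meson dvd_imp_le leD le_less_trans neq0_conv)
    then have "M = {}" using fM by simp
    have LQ: "y \<otimes> l = l \<otimes> y" if y: "y \<in> Q" and l: "l \<in> L" for y l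
    proof -
      have yl: "y \<in> Y" "l \<in> Y" using y l QY dL(3) by auto
      have "act y (l <# K) = l <# K" using \<open>M = {}\<close> y l by (auto simp: M_def C_def)
      then have "l <# K = (y \<otimes> l \<otimes> inv y) <# K" using act_coset[OF y l] by simp
      moreover define k where "k = inv l \<otimes> (y \<otimes> l \<otimes> inv y)"
      ultimately have k: "k \<in> K" using l_coset_eq_iff[OF dK(1)] yl by simp
      then have kY: "k \<in> Y" using dK(3) by auto
      have ylk: "y \<otimes> l \<otimes> inv y = l \<otimes> k" using yl by (simp add: k_def cancel_inv)
      have yk: "y \<otimes> k \<otimes> inv y = k" using KQ[OF y k] yl kY by (simp add: m_assoc)
      \<comment> \<open>Conjugation by \<open>y\<close> multiplies \<open>l\<close> by an element
        \<open>k\<close> that it fixes, so its iterates multiply by powers of \<open>k\<close>. At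
        \<open>i = q ^ e\<close> this gives \<open>k [^] (q ^ e) = \<one>\<close>, while
        \<open>k\<close> lies in the \<open>p\<close>-group \<open>D\<close>.\<close>
      have "y [^] i \<otimes> l \<otimes> inv (y [^] i) = l \<otimes> k [^] i" for i :: nat
      proof (induction i)
        case (Suc i)
        have yi: "y [^] i \<in> carrier G" "k [^] i \<in> carrier G" using yl kY by auto
        have "y [^] Suc i \<otimes> l \<otimes> inv (y [^] Suc i) = y \<otimes> (y [^] i \<otimes> l \<otimes> inv (y [^] i)) \<otimes> inv y"
          using yl yi nat_pow_Suc2[of y i] by (simp add: word_simps del: nat_pow_Suc)
        also have "\<dots> = (y \<otimes> l \<otimes> inv y) \<otimes> (y \<otimes> k [^] i \<otimes> inv y)" unfolding Suc using yl yi by (simp add: word_simps)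
        also have "y \<otimes> k [^] i \<otimes> inv y = k [^] i" using conj_pow[of y k i] yk yl kY by simp
        finally show ?case using ylk yl kY yi nat_pow_Suc2[of k i] by (simp add: m_assoc del: nat_pow_Suc)
      qed (use yl in simp)
      from this[of "q ^ e"] have "l \<otimes> k [^] (q ^ e) = l"
        using pow_card_subgroup[OF assms(5) y] assms(7) yl by simp
      then have "k [^] (q ^ e) \<in> {\<one>}" using yl kY by simp
      moreover have "k [^] (p ^ j) \<in> {\<one>}" using pow_card_subgroup[OF dD(1), of k] k KY(2) assms(3) by auto
      moreover have "coprime (q ^ e) (p ^ j)" using primes_coprime[OF assms(8,4)] assms(9) by simp
      ultimately have "k \<in> {\<one>}" by (rule pow_coprime_mem[OF triv_subgroup Yc[OF kY]])
      then have "k = \<one>" by simp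
      then have "y \<otimes> l \<otimes> inv y \<otimes> y = l \<otimes> y" using ylk yl by simp
      then show ?thesis using yl by (simp add: m_assoc)
    qed
    then have "L \<in> S" using L by (auto simp: S_def)
    then have "K = L" using Kmax L(2) by blast
    then have "card K = p * card K" using L(5) sp by simp
    then show False using subgroup_card_pos[OF dK(1)] prime_gt_1_nat[OF assms(4)] by simp
  qed
  then show ?thesis using KQ by blast
qed

lemma conj_set_mult:
  assumes "x \<in> carrier G" "y \<in> carrier G" "H \<subseteq> carrier G"
  shows "conj_set x (conj_set y H) = conj_set (x \<otimes> y) H"
proof -
  have "(\<lambda>h. x \<otimes> (y \<otimes> h \<otimes> inv y) \<otimes> inv x) ` H = (\<lambda>h. x \<otimes> y \<otimes> h \<otimes> inv (x \<otimes> y)) ` H"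
    by (rule image_cong) (use assms in \<open>auto simp: word_simps subset_iff\<close>)
  then show ?thesis by (simp add: conj_set_def image_image)
qed

end

text \<open>Frobenius's local condition: the normalizer of a nontrivial \<open>p\<close>-subgroup
  \<open>D\<close> acts on \<open>D\<close> as a \<open>p\<close>-group. It is phrased by
  \<open>q\<close>-subgroups, the form in which coprime action on a supersolvable normalizer
  supplies it.\<close>

locale frobenius_local = fin_group +
  fixes Y :: "'a set" and p :: nat
  assumes Y_subgroup: "subgroup Y G" and p: "prime_nat p"
    and local: "\<And>D j Q q e. \<lbrakk>subgroup D G; D \<subseteq> Y; D \<noteq> {\<one>}; card D = p ^ j; subgroup Q G;
      Q \<subseteq> normalizer_in Y D; card Q = q ^ e; prime_nat q; q \<noteq> p\<rbrakk>
      \<Longrightarrow> \<forall>y\<in>Q. \<forall>d\<in>D. y \<otimes> d = d \<otimes> y"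
begin

lemma Yc [simp]: "x \<in> Y \<Longrightarrow> x \<in> carrier G"
  using Y_subgroup by (simp add: subgroup.mem_carrier)

lemma Y_closed [simp]: "\<one> \<in> Y" "x \<in> Y \<Longrightarrow> y \<in> Y \<Longrightarrow> x \<otimes> y \<in> Y" "x \<in> Y \<Longrightarrow> inv x \<in> Y"
  using Y_subgroup by (auto simp: subgroup.one_closed subgroup.m_closed subgroup.m_inv_closed)

definition sylow :: "'a set \<Rightarrow> 'a set \<Rightarrow> bool"
  where "sylow P Z \<longleftrightarrow> subgroup P G \<and> P \<subseteq> Z \<and> (\<exists>k. card P = p ^ k) \<and> \<not> p * card P dvd card Z"

lemma sylow_conj:
  assumes "sylow P Z" "sylow Q Z" "subgroup Z G"
  shows "\<exists>x\<in>Z. conj_set x P = Q"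
proof -
  have Pc: "P \<subseteq> carrier G" and Qc: "Q \<subseteq> carrier G" using assms by (auto simp: sylow_def subgroup.subset)
  have "\<exists>x\<in>Z. conj_set (inv x) B \<subseteq> A" if AB: "sylow A Z" "sylow B Z" for A B
  proof -
    from AB obtain k where A: "subgroup A G" "A \<subseteq> Z" "\<not> p * card A dvd card Z"
      and B: "subgroup B G" "B \<subseteq> Z" "card B = p ^ k" by (auto simp: sylow_def)
    obtain x where x: "x \<in> Z" "\<forall>h\<in>B. inv x \<otimes> h \<otimes> x \<in> A"
      using p_subgroup_conj_sylow[OF assms(3) A B p] by blast
    moreover have "x \<in> carrier G" using x assms(3) by (simp add: subgroup.mem_carrier)
    ultimately show ?thesis by (intro bexI[of _ x]) (auto simp: conj_set_def)
  qed
  then obtain x z where x: "x \<in> Z" "conj_set (inv x) Q \<subseteq> P" and z: "z \<in> Z" "conj_set (inv z) P \<subseteq> Q"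
    using assms by metis
  have xc: "x \<in> carrier G" "z \<in> carrier G" using x z assms(3) by (auto simp: subgroup.mem_carrier)
  have fin: "finite P" "finite Q" using assms subgroup_finite by (auto simp: sylow_def)
  have "card P \<le> card Q" using card_mono[OF fin(2) z(2)] card_conj_set[of "inv z" P] xc Pc by simp
  moreover have "card (conj_set (inv x) Q) = card Q" using card_conj_set xc Qc by simp
  ultimately have "conj_set (inv x) Q = P" using card_seteq[OF fin(1) x(2)] by simp
  then have "conj_set x P = Q" using conj_set_inv[of "inv x" Q] xc Qc by simp
  then show ?thesis using x(1) by blast
qed

lemma sylow_above:
  assumes "subgroup D G" "D \<subseteq> Z" "card D = p ^ j" "subgroup Z G"
  shows "\<exists>P. sylow P Z \<and> D \<subseteq> P"
  using p_subgroup_in_sylow[OF assms(4,1,2,3) p] unfolding sylow_def by blast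

text \<open>A prime \<open>q \<noteq> p\<close> cannot divide the index of the centralizer
  \<open>C\<close>: a Sylow \<open>q\<close>-subgroup of some \<open>K\<close> with
  \<open>card K = q * card C\<close> would already lie in \<open>C\<close>. Since \<open>S\<close>
  takes care of \<open>p\<close>, no prime divides the index of \<open>C <#> S\<close>.\<close>

lemma normalizer_factor:
  assumes D: "subgroup D G" "D \<subseteq> Y" "D \<noteq> {\<one>}" "card D = p ^ j"
    and S: "sylow S (normalizer_in Y D)" and g: "g \<in> normalizer_in Y D"
  shows "\<exists>z s. z \<in> centralizer_in Y D \<and> s \<in> S \<and> g = z \<otimes> s"
proof -
  define N where "N = normalizer_in Y D"
  define C where "C = centralizer_in N D"
  have DN: "normal_in D N" unfolding N_def using normal_in_normalizer[OF Y_subgroup D(1,2)] .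
  have NY: "N \<subseteq> Y" by (auto simp: N_def normalizer_in_def)
  have C: "normal_in C N" unfolding C_def using normal_in_centralizer[OF DN] .
  note dC = normal_inD[OF C]
  have subS: "subgroup S G" "S \<subseteq> N" using S by (auto simp: sylow_def N_def)
  have no_q: "\<not> q * card C dvd card N" if q: "prime_nat q" "q \<noteq> p" for q
  proof
    assume "q * card C dvd card N"
    then obtain K where K: "subgroup K G" "C \<subseteq> K" "K \<subseteq> N" "card K = q * card C"
      using cauchy_quotient[OF C q(1)] by blast
    obtain Q e where Q: "subgroup Q G" "Q \<subseteq> K" "card Q = q ^ e" "\<not> q * card Q dvd card K"
      using p_subgroup_in_sylow[OF K(1) triv_subgroup _ _ q(1), of 0] subgroup.one_closed[OF K(1)] by auto
    have "\<forall>y\<in>Q. \<forall>d\<in>D. y \<otimes> d = d \<otimes> y"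
      using local[OF D Q(1) _ Q(3) q] Q(2) K(3) unfolding N_def by blast
    then have "Q \<subseteq> C" using Q(2) K(3) by (auto simp: C_def centralizer_in_def)
    then have "card Q dvd card C" using card_subgroup_dvd[OF Q(1) dC(1)] by blast
    then show False using Q(4) K(4) by simp
  qed
  have CS: "subgroup (C <#> S) G" using subgroup_prod[OF C subS] .
  have CSN: "C <#> S \<subseteq> N" using set_mult_subset[OF dC(2,3) subS(2)] .
  have sup: "C \<subseteq> C <#> S" "S \<subseteq> C <#> S" using set_mult_superset dC subS by auto
  obtain k where k: "card N = card (C <#> S) * k" using card_subgroup_dvd[OF CS dC(2) CSN] by (auto elim: dvdE)
  have "k = 1"
  proof (rule ccontr)
    assume "k \<noteq> 1"
    then obtain q where q: "prime_nat q" "q dvd k" using prime_factor_nat by blast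
    then have dv: "q * card (C <#> S) dvd card N" using k by (simp add: mult.commute)
    have "q * card C dvd card N"
      using dv card_subgroup_dvd[OF dC(1) CS sup(1)] by (meson dvd_trans mult_dvd_mono dvd_refl)
    then have "q = p" using no_q q(1) by blast
    then have "p * card S dvd card N"
      using dv card_subgroup_dvd[OF subS(1) CS sup(2)] by (meson dvd_trans mult_dvd_mono dvd_refl)
    then show False using S by (simp add: sylow_def N_def)
  qed
  then have "C <#> S = N" using subgroup_eq_card[OF dC(2) CSN] k by simp
  then have "g \<in> C <#> S" using g by (simp add: N_def)
  then show ?thesis using NY by (auto simp: set_mult_def C_def centralizer_in_def)
qed

text \<open>Induction on the index of \<open>P \<inter> Q\<close>: Sylow subgroups of \<open>N(P \<inter> Q)\<close> are conjugate under
  \<open>C(P \<inter> Q)\<close>, and connect \<open>P\<close> to \<open>Q\<close> through Sylow subgroups with larger intersections.\<close>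

lemma sylow_conj_centralizing:
  assumes "sylow P Y" "sylow Q Y"
  shows "\<exists>c\<in>centralizer_in Y (P \<inter> Q). conj_set c P = Q"
  using assms
proof (induction "card P - card (P \<inter> Q)" arbitrary: P Q rule: less_induct)
  case less
  have P: "subgroup P G" "P \<subseteq> Y" and Q: "subgroup Q G" "Q \<subseteq> Y" using less.prems by (auto simp: sylow_def)
  obtain k where k: "card P = p ^ k" using less.prems by (auto simp: sylow_def)
  obtain x where x: "x \<in> Y" "conj_set x P = Q" using sylow_conj[OF less.prems Y_subgroup] by blast
  then have cQ: "card Q = card P" using card_conj_set[of x P] P by (simp add: subgroup.subset)
  define D where "D = P \<inter> Q"
  have D: "subgroup D G" "D \<subseteq> Y" "D \<subseteq> P" "D \<subseteq> Q" using P Q by (auto simp: D_def subgroups_Inter_pair)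
  have "card D dvd p ^ k" using card_subgroup_dvd[OF D(1) P(1) D(3)] k by simp
  then obtain j where j: "card D = p ^ j" "j \<le> k" using divides_primepow_nat[OF p] by blast
  show ?case
  proof (cases "D = {\<one>} \<or> D = P")
    case True
    then show ?thesis
    proof
      assume "D = {\<one>}"
      then have "x \<in> centralizer_in Y (P \<inter> Q)" using x(1) by (auto simp: centralizer_in_def D_def)
      then show ?thesis using x(2) by blast
    next
      assume "D = P"
      then have "P = Q" using subgroup_eq_card[OF Q(1) D(4)] cQ by simp
      moreover have "\<one> \<in> centralizer_in Y (P \<inter> Q)" using P by (auto simp: centralizer_in_def)
      moreover have "conj_set \<one> P = P" using conj_set_self[OF P(1)] subgroup.one_closed[OF P(1)] by blast
      ultimately show ?thesis by blast
    qed
  next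
    case False
    define N where "N = normalizer_in Y D"
    have subN: "subgroup N G" unfolding N_def using subgroup_normalizer_in[OF Y_subgroup D(1)] .
    have "card D < card P" using False D(3) psubset_card_mono[OF subgroup_finite[OF P(1)]] by blast
    then have "j < k" using j k prime_gt_1_nat[OF p] by simp
    then have pD: "p * card D dvd p ^ k" using j by (simp add: Suc_leI le_imp_power_dvd flip: power_Suc)
    \<comment> \<open>Normalizers grow in \<open>p\<close>-groups: \<open>P\<close> and
      \<open>Q\<close> both contain a subgroup of \<open>N\<close> properly above
      \<open>D\<close>.\<close>
    have grow: "\<exists>K. subgroup K G \<and> D \<subset> K \<and> K \<subseteq> R \<and> K \<subseteq> N \<and> (\<exists>i. card K = p ^ i)"
      if R: "subgroup R G" "D \<subseteq> R" "R \<subseteq> Y" "card R = p ^ k" for R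
    proof -
      obtain K where K: "normal_in D K" "K \<subseteq> R" "card K = p * card D"
        using p_subgroup_extend[OF R(1) D(1) R(2) j(1) p] pD R(4) by auto
      have "D \<noteq> K" using K(3) subgroup_card_pos[OF D(1)] prime_gt_1_nat[OF p] by auto
      moreover have "K \<subseteq> N" unfolding N_def using normal_in_le_normalizer[OF K(1)] K(2) R(3) by blast
      moreover have "card K = p ^ Suc j" using K(3) j by simp
      ultimately show ?thesis using normal_inD(2,3)[OF K(1)] K(2) by blast
    qed
    obtain K1 i1 where K1: "subgroup K1 G" "D \<subset> K1" "K1 \<subseteq> P" "K1 \<subseteq> N" "card K1 = p ^ i1"
      using grow[OF P(1) D(3) P(2) k] by blast
    obtain K2 i2 where K2: "subgroup K2 G" "D \<subset> K2" "K2 \<subseteq> Q" "K2 \<subseteq> N" "card K2 = p ^ i2"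
      using grow[OF Q(1) D(4) Q(2)] k cQ by auto
    obtain S1 where S1: "sylow S1 N" "K1 \<subseteq> S1" using sylow_above[OF K1(1,4,5) subN] by blast
    obtain S2 where S2: "sylow S2 N" "K2 \<subseteq> S2" using sylow_above[OF K2(1,4,5) subN] by blast
    obtain c where c: "c \<in> N" "conj_set c S1 = S2" using sylow_conj[OF S1(1) S2(1) subN] by blast
    \<comment> \<open>The factor \<open>s\<close> normalizes \<open>S1\<close>, so \<open>z\<close>,
      which centralizes \<open>D\<close>, already carries \<open>S1\<close> to
      \<open>S2\<close>.\<close>
    obtain z s where zs: "z \<in> centralizer_in Y D" "s \<in> S1" "c = z \<otimes> s"
      using normalizer_factor[OF D(1,2) _ j(1)] S1(1) c(1) False unfolding N_def by blast
    have NY: "N \<subseteq> Y" by (auto simp: N_def normalizer_in_def)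
    have S1s: "subgroup S1 G" "S1 \<subseteq> Y" using S1 NY by (auto simp: sylow_def)
    have zY: "z \<in> Y" using zs by (auto simp: centralizer_in_def)
    have "conj_set z S1 = conj_set z (conj_set s S1)" using conj_set_self[OF S1s(1) zs(2)] by simp
    also have "\<dots> = S2" using conj_set_mult[of z s S1] zs zY S1s c(2) by (auto simp: subset_iff)
    finally have zS: "conj_set z S1 = S2" .
    obtain i where i: "card S1 = p ^ i" using S1(1) by (auto simp: sylow_def)
    \<comment> \<open>\<open>R\<close> meets \<open>P\<close> at least in \<open>K1\<close>, and its
      conjugate \<open>R'\<close> by \<open>z\<close> meets \<open>Q\<close> at least in
      \<open>K2\<close>. Both intersections are larger than \<open>D\<close>, and the three
      conjugating elements, all centralizing \<open>D\<close>, compose.\<close>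
    obtain R where R: "sylow R Y" "S1 \<subseteq> R" using sylow_above[OF S1s i Y_subgroup] by blast
    have Rs: "subgroup R G" "R \<subseteq> Y" using R by (auto simp: sylow_def)
    have lt: "card A - card (A \<inter> B) < card P - card (P \<inter> Q)"
      if "D \<subset> K" "K \<subseteq> A \<inter> B" "finite A" "card A = card P" for A B K
    proof -
      have "card D < card (A \<inter> B)" using that by (intro psubset_card_mono) auto
      moreover have "card (A \<inter> B) \<le> card A" using that by (intro card_mono) auto
      ultimately show ?thesis using that unfolding D_def by linarith
    qed
    have "K1 \<subseteq> P \<inter> R" using K1(3) S1(2) R(2) by blast
    then obtain a where a: "a \<in> centralizer_in Y (P \<inter> R)" "conj_set a P = R"
      using less.hyps[OF lt[OF K1(2) _ subgroup_finite[OF P(1)]] less.prems(1) R(1)] by blast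
    have aY: "a \<in> Y" "a \<in> centralizer_in Y D"
      using a \<open>K1 \<subseteq> P \<inter> R\<close> K1(2) by (auto simp: centralizer_in_def)
    define R' where "R' = conj_set z R"
    have R's: "subgroup R' G" unfolding R'_def using subgroup_conj_set zY Rs by simp
    have cR: "card R = card P" using a(2) card_conj_set[of a P] aY P by (auto simp: subset_iff)
    then have cR': "card R' = card P" unfolding R'_def using card_conj_set[of z R] zY Rs by (auto simp: subset_iff)
    have R'Y: "R' \<subseteq> Y" using conj_set_mono[OF Rs(2), of z] conj_set_self[OF Y_subgroup zY] by (simp add: R'_def)
    have R': "sylow R' Y" using R's R'Y cR' less.prems(1) by (simp add: sylow_def)
    have "K2 \<subseteq> R' \<inter> Q" using S2(2) zS conj_set_mono[OF R(2), of z] K2(3) by (auto simp: R'_def)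
    then obtain b where b: "b \<in> centralizer_in Y (R' \<inter> Q)" "conj_set b R' = Q"
      using less.hyps[OF lt[OF K2(2) _ subgroup_finite[OF R's] cR'] R' less.prems(2)] by blast
    have bY: "b \<in> Y" "b \<in> centralizer_in Y D"
      using b \<open>K2 \<subseteq> R' \<inter> Q\<close> K2(2) by (auto simp: centralizer_in_def)
    have "subgroup (centralizer_in Y D) G" using subgroup_centralizer_in[OF Y_subgroup] D(2) by (auto simp: subset_iff)
    then have "b \<otimes> (z \<otimes> a) \<in> centralizer_in Y D" using bY aY zs(1) by (simp add: subgroup.m_closed)
    moreover have "conj_set (b \<otimes> (z \<otimes> a)) P = Q"
      using b(2) a(2) conj_set_mult[of b "z \<otimes> a" P] conj_set_mult[of z a P] bY aY zY P
      by (auto simp: R'_def subset_iff)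
    ultimately show ?thesis unfolding D_def by blast
  qed
qed

text \<open>With \<open>Q\<close> the conjugate of \<open>P\<close> by \<open>inv g\<close>,
  \<open>x\<close> lies in \<open>P \<inter> Q\<close>. An element \<open>c\<close> centralizing
  this intersection carries \<open>P\<close> to \<open>Q\<close>, so \<open>g \<otimes> c\<close>
  normalizes \<open>P\<close> and conjugates \<open>x\<close> as \<open>g\<close> does; its factor
  centralizing \<open>P\<close> drops out, and a factor in \<open>P\<close> remains.\<close>

lemma fusion_in_sylow:
  assumes P: "sylow P Y" "P \<noteq> {\<one>}" and x: "x \<in> P" and g: "g \<in> Y" "g \<otimes> x \<otimes> inv g \<in> P"
  shows "\<exists>h\<in>P. g \<otimes> x \<otimes> inv g = h \<otimes> x \<otimes> inv h"
proof -
  have Ps: "subgroup P G" "P \<subseteq> Y" using P by (auto simp: sylow_def)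
  obtain k where k: "card P = p ^ k" using P by (auto simp: sylow_def)
  define Q where "Q = conj_set (inv g) P"
  have Qs: "subgroup Q G" unfolding Q_def using subgroup_conj_set[of "inv g"] g Ps by simp
  have QY: "Q \<subseteq> Y" unfolding Q_def using conj_set_mono[OF Ps(2), of "inv g"] conj_set_self[OF Y_subgroup, of "inv g"] g by simp
  have "card Q = card P" unfolding Q_def using card_conj_set[of "inv g" P] g Ps by (auto simp: subset_iff)
  then have Q: "sylow Q Y" using P Qs QY by (simp add: sylow_def)
  have xY: "x \<in> Y" using x Ps by auto
  have "inv g \<otimes> (g \<otimes> x \<otimes> inv g) \<otimes> inv (inv g) \<in> Q" using g unfolding Q_def conj_set_def by blast
  then have "x \<in> Q" using g xY by (simp add: word_simps)
  obtain c where c: "c \<in> centralizer_in Y (P \<inter> Q)" "conj_set c P = Q" using sylow_conj_centralizing[OF P(1) Q] by blast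
  have cY: "c \<in> Y" and cx: "c \<otimes> x = x \<otimes> c" using c x \<open>x \<in> Q\<close> by (auto simp: centralizer_in_def)
  have "conj_set (g \<otimes> c) P = conj_set g Q" using conj_set_mult[of g c P] c g cY Ps by (auto simp: subset_iff)
  also have "\<dots> = P" unfolding Q_def using conj_set_inv[of "inv g" P] g Ps by (auto simp: subset_iff)
  finally have gcP: "conj_set (g \<otimes> c) P = P" .
  then have "\<And>h. h \<in> P \<Longrightarrow> (g \<otimes> c) \<otimes> h \<otimes> inv (g \<otimes> c) \<in> P" by (auto simp: conj_set_def)
  then have "g \<otimes> c \<in> normalizer_in Y P"
    using normal_conj_bij[OF Ps(1), of "g \<otimes> c"] g cY by (simp add: normalizer_in_def)
  moreover have "sylow P (normalizer_in Y P)"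
  proof -
    have "P \<subseteq> normalizer_in Y P" using normal_inD(3)[OF normal_in_normalizer[OF Y_subgroup Ps]] .
    moreover have "card (normalizer_in Y P) dvd card Y"
      by (rule card_subgroup_dvd[OF subgroup_normalizer_in[OF Y_subgroup Ps(1)] Y_subgroup]) (auto simp: normalizer_in_def)
    ultimately show ?thesis using P(1) unfolding sylow_def by (meson dvd_trans)
  qed
  ultimately obtain z s where zs: "z \<in> centralizer_in Y P" "s \<in> P" "g \<otimes> c = z \<otimes> s"
    using normalizer_factor[OF Ps P(2) k] by blast
  have zY: "z \<in> Y" "s \<in> Y" using zs Ps by (auto simp: centralizer_in_def)
  define w where "w = s \<otimes> x \<otimes> inv s"
  have w: "w \<in> P" unfolding w_def using zs x subgroup.m_closed[OF Ps(1)] subgroup.m_inv_closed[OF Ps(1)] by blast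
  have wY: "w \<in> Y" using w Ps by auto
  have "c \<otimes> x \<otimes> inv c = x" using cx cY xY by (simp add: m_assoc)
  then have "g \<otimes> x \<otimes> inv g = g \<otimes> (c \<otimes> x \<otimes> inv c) \<otimes> inv g" by simp
  also have "\<dots> = (g \<otimes> c) \<otimes> x \<otimes> inv (g \<otimes> c)" using g cY xY by (simp add: word_simps)
  also have "\<dots> = z \<otimes> w \<otimes> inv z" unfolding zs(3) w_def using zY xY by (simp add: word_simps)
  also have "\<dots> = w" using zs(1) w zY wY by (simp add: centralizer_in_def m_assoc)
  finally show ?thesis using zs(2) unfolding w_def by blast
qed

end

section \<open>Transfer\<close>

context fin_group
begin

text \<open>A subgroup \<open>H\<close> of order \<open>p ^ k\<close> is normal of index
  \<open>p\<close>, and \<open>P/H\<close> is generated by the class of any \<open>a\<close> outside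
  \<open>H\<close>; \<open>l x\<close> is an exponent of \<open>a\<close> in the class of
  \<open>x\<close>. The homomorphism is kept as a function into the naturals with congruences, so
  that the transfer is an ordinary sum.\<close>

lemma prime_power_group_hom:
  assumes P: "subgroup P G" "card P = p ^ Suc k" and p: "prime_nat p"
  shows "\<exists>l :: 'a \<Rightarrow> nat. (\<forall>x\<in>P. \<forall>y\<in>P. [l (x \<otimes> y) = l x + l y] (mod p)) \<and> (\<exists>a\<in>P. \<not> p dvd l a)"
proof -
  have Pc [simp]: "x \<in> carrier G" if "x \<in> P" for x using that P by (simp add: subgroup.mem_carrier)
  have cl [simp]: "\<one> \<in> P" "x \<in> P \<Longrightarrow> y \<in> P \<Longrightarrow> x \<otimes> y \<in> P" "x \<in> P \<Longrightarrow> inv x \<in> P"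
    "x \<in> P \<Longrightarrow> x [^] (i::nat) \<in> P" for x y i
    using P by (auto simp: subgroup.one_closed subgroup.m_closed subgroup.m_inv_closed subgroup_nat_pow_closed)
  have "\<exists>H. subgroup H (G\<lparr>carrier := P\<rparr>) \<and> card H = p ^ k"
    by (rule sylow_thm[OF p]) (use P subgroup_finite[OF P(1)] subgroup_imp_group[OF P(1)] in \<open>auto simp: order_def\<close>)
  then obtain H where H: "subgroup H (G\<lparr>carrier := P\<rparr>)" "card H = p ^ k" by blast
  have HG: "subgroup H G" "H \<subseteq> P" using H(1) P(1) incl_subgroup subgroup.subset by fastforce+
  have idx: "card P = p * card H" using P(2) H(2) by simp
  obtain K where K: "normal_in H K" "K \<subseteq> P" "card K = p * card H"
    using p_subgroup_extend[OF P(1) HG H(2) p] idx by auto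
  then have "K = P" using subgroup_eq_card[OF P(1)] idx by simp
  then have HP: "normal_in H P" using K by simp
  have max: "maximal_in H P" using maximal_in_prime_index[OF HG(1) P(1) HG(2) idx p] .
  then obtain a where a: "a \<in> P" "a \<notin> H" by (auto simp: maximal_in_def)
  have rep: "\<exists>i::nat. \<exists>u\<in>H. x = u \<otimes> a [^] i" if x: "x \<in> P" for x
  proof -
    define M where "M = {x \<in> P. \<exists>i::nat. \<exists>u\<in>H. x = u \<otimes> a [^] i}"
    have "subgroup M G"
    proof (rule subgroup_finI)
      show "M \<subseteq> carrier G" by (auto simp: M_def)
      have "\<one> = \<one> \<otimes> a [^] (0::nat)" by simp
      then show "\<one> \<in> M" unfolding M_def using subgroup.one_closed[OF HG(1)] cl(1) by blast
      fix x y assume "x \<in> M" "y \<in> M"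
      then obtain u i v j where uv: "x \<in> P" "y \<in> P" "u \<in> H" "v \<in> H" "x = u \<otimes> a [^] (i::nat)" "y = v \<otimes> a [^] (j::nat)"
        by (auto simp: M_def)
      define w where "w = a [^] i \<otimes> v \<otimes> inv (a [^] i)"
      have w: "w \<in> H" unfolding w_def using normal_inD(4)[OF HP] a uv by simp
      have c: "u \<in> P" "v \<in> P" using uv HG by auto
      have "x \<otimes> y = (u \<otimes> w) \<otimes> (a [^] i \<otimes> a [^] j)" using uv(5,6) c a by (simp add: w_def word_simps)
      then have "x \<otimes> y = (u \<otimes> w) \<otimes> a [^] (i + j)" using a by (simp add: nat_pow_mult)
      then show "x \<otimes> y \<in> M" unfolding M_def using uv w subgroup.m_closed[OF HG(1)] cl(2) by blast
    qed
    moreover have "H \<subseteq> M"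
    proof
      fix u assume u: "u \<in> H"
      then have "u = u \<otimes> a [^] (0::nat)" using HG by auto
      then show "u \<in> M" unfolding M_def using u HG by blast
    qed
    moreover have "a \<in> M"
    proof -
      have "a = \<one> \<otimes> a [^] (1::nat)" using a by simp
      then show ?thesis unfolding M_def using a subgroup.one_closed[OF HG(1)] by blast
    qed
    moreover have "M \<subseteq> P" by (auto simp: M_def)
    ultimately have "M = P" using max a(2) unfolding maximal_in_def by blast
    then show ?thesis using x by (auto simp: M_def)
  qed
  have uniq: "[i = j] (mod p)" if uv: "u \<in> H" "v \<in> H" "u \<otimes> a [^] i = v \<otimes> a [^] j" for u v and i j :: nat
  proof -
    have aux: "[i = j] (mod p)" if le: "i \<le> j" and uv: "u \<in> H" "v \<in> H" "u \<otimes> a [^] i = v \<otimes> a [^] j" for u v and i j :: nat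
    proof (rule ccontr)
      assume n: "\<not> [i = j] (mod p)"
      have c: "u \<in> P" "v \<in> P" using uv HG by auto
      have "a [^] j = a [^] (j - i) \<otimes> a [^] i" using le a by (simp add: nat_pow_mult)
      then have "u \<otimes> a [^] i = v \<otimes> a [^] (j - i) \<otimes> a [^] i" using uv c a by (simp add: m_assoc)
      then have "u = v \<otimes> a [^] (j - i)" using c a by simp
      then have "inv v \<otimes> u = a [^] (j - i)" using c a by (simp add: cancel_inv)
      then have "a [^] (j - i) \<in> H"
        using uv subgroup.m_closed[OF HG(1)] subgroup.m_inv_closed[OF HG(1)] by metis
      moreover have "a [^] (p ^ Suc k) \<in> H"
        using pow_card_subgroup[OF P(1) a(1)] P(2) subgroup.one_closed[OF HG(1)] by simp
      moreover have "coprime (j - i) (p ^ Suc k)"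
      proof -
        have "\<not> p dvd j - i"
        proof
          assume "p dvd j - i"
          then have "[j = i] (mod p)" using le by (simp add: cong_altdef_nat)
          then show False using n cong_sym by blast
        qed
        then have "coprime (j - i) p" using prime_imp_coprime[OF p] coprime_commute by blast
        then show ?thesis by simp
      qed
      ultimately have "a \<in> H" using pow_coprime_mem[OF HG(1) Pc[OF a(1)]] by blast
      then show False using a by simp
    qed
    show ?thesis
    proof (cases "i \<le> j")
      case True
      then show ?thesis using aux uv by blast
    next
      case False
      then show ?thesis using aux[of j i v u] uv by (simp add: cong_sym)
    qed
  qed
  define l where "l x = (SOME i::nat. \<exists>u\<in>H. x = u \<otimes> a [^] i)" for x
  have l: "\<exists>u\<in>H. x = u \<otimes> a [^] l x" if "x \<in> P" for x
    unfolding l_def using someI_ex[OF rep[OF that]] .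
  have "[l (x \<otimes> y) = l x + l y] (mod p)" if xy: "x \<in> P" "y \<in> P" for x y
  proof -
    obtain u where u: "u \<in> H" "x = u \<otimes> a [^] l x" using l[OF xy(1)] by blast
    obtain v where v: "v \<in> H" "y = v \<otimes> a [^] l y" using l[OF xy(2)] by blast
    obtain z where z: "z \<in> H" "x \<otimes> y = z \<otimes> a [^] l (x \<otimes> y)" using l[OF cl(2)[OF xy]] by blast
    define i j where "i = l x" and "j = l y"
    define w where "w = a [^] i \<otimes> v \<otimes> inv (a [^] i)"
    have w: "w \<in> H" unfolding w_def using normal_inD(4)[OF HP] a v by simp
    have c: "u \<in> P" "v \<in> P" "w \<in> P" using u v w HG by auto
    have "x \<otimes> y = (u \<otimes> a [^] i) \<otimes> (v \<otimes> a [^] j)" using u(2) v(2) by (simp add: i_def j_def)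
    also have "\<dots> = (u \<otimes> w) \<otimes> (a [^] i \<otimes> a [^] j)" using c a by (simp add: w_def word_simps)
    also have "\<dots> = (u \<otimes> w) \<otimes> a [^] (i + j)" using a by (simp add: nat_pow_mult)
    finally have "z \<otimes> a [^] l (x \<otimes> y) = (u \<otimes> w) \<otimes> a [^] (i + j)" using z(2) by simp
    then show ?thesis
      using uniq[OF z(1) subgroup.m_closed[OF HG(1) u(1) w]] by (simp add: i_def j_def)
  qed
  moreover have "\<not> p dvd l a"
  proof -
    obtain u where u: "u \<in> H" "a = u \<otimes> a [^] l a" using l[OF a(1)] by blast
    have "\<one> \<otimes> a [^] (1::nat) = u \<otimes> a [^] l a" using u a by simp
    then have "[1 = l a] (mod p)" using uniq[OF subgroup.one_closed[OF HG(1)] u(1)] by blast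
    then show ?thesis using prime_gt_1_nat[OF p] by (auto simp: cong_def mod_eq_0_iff_dvd[symmetric])
  qed
  ultimately show ?thesis using a by blast
qed

end

context frobenius_local
begin

text \<open>The transfer into a cyclic quotient of order \<open>p\<close> of a Sylow subgroup \<open>P\<close>, written additively
  modulo \<open>p\<close>. As \<open>P\<close> controls its own fusion, the transfer of \<open>a \<in> P\<close> is \<open>[Y : P]\<close> times
  its image in that quotient.\<close>

lemma normal_subgroup_index_p:
  assumes dvd: "p dvd card Y"
  shows "\<exists>K. normal_in K Y \<and> K \<noteq> Y \<and> card Y \<le> p * card K"
proof -
  obtain P where P: "sylow P Y"
    using sylow_above[OF triv_subgroup, of Y 0] Y_subgroup by auto
  have Ps: "subgroup P G" "P \<subseteq> Y" using P by (auto simp: sylow_def)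
  have Pc [simp]: "x \<in> Y" if "x \<in> P" for x using that Ps by auto
  have P_cl [simp]: "\<one> \<in> P" "x \<in> P \<Longrightarrow> y \<in> P \<Longrightarrow> x \<otimes> y \<in> P" "x \<in> P \<Longrightarrow> inv x \<in> P"
    "x \<in> P \<Longrightarrow> x [^] (i::nat) \<in> P" for x y i
    using Ps by (auto simp: subgroup.one_closed subgroup.m_closed subgroup.m_inv_closed subgroup_nat_pow_closed)
  obtain k where k: "card P = p ^ k" using P by (auto simp: sylow_def)
  have "k \<noteq> 0" using k dvd P by (cases k) (auto simp: sylow_def)
  then obtain k' where k': "card P = p ^ Suc k'" using k by (cases k) auto
  have P1: "P \<noteq> {\<one>}" using k' prime_gt_1_nat[OF p] by auto
  obtain l :: "'a \<Rightarrow> nat" and a where l: "\<And>x y. x \<in> P \<Longrightarrow> y \<in> P \<Longrightarrow> [l (x \<otimes> y) = l x + l y] (mod p)"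
    and a: "a \<in> P" "\<not> p dvd l a"
    using prime_power_group_hom[OF Ps(1) k' p] by blast
  have l1: "[l \<one> = 0] (mod p)"
    using l[of \<one> \<one>] cong_add_lcancel_0_nat[of "l \<one>" "l \<one>" p] by (simp add: cong_sym_eq)
  have linv: "[l (x \<otimes> y \<otimes> inv x) = l y] (mod p)" if "x \<in> P" "y \<in> P" for x y
  proof -
    have "[l (x \<otimes> y \<otimes> inv x) = l (x \<otimes> y) + l (inv x)] (mod p)" using l that by simp
    also have "[l (x \<otimes> y) + l (inv x) = l x + l y + l (inv x)] (mod p)" using l that by (simp add: cong_add_rcancel_nat)
    also have "l x + l y + l (inv x) = l y + (l x + l (inv x))" by simp
    also have "[l y + (l x + l (inv x)) = l y + l (x \<otimes> inv x)] (mod p)"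
      using l[of x "inv x"] that by (simp add: cong_add_lcancel_nat cong_sym)
    also have "[l y + l (x \<otimes> inv x) = l y + 0] (mod p)" using cong_add[OF cong_refl l1, of "l y"] that by simp
    finally show ?thesis by simp
  qed
  define C where "C = (\<lambda>x. x <# P) ` Y"
  have finC: "finite C" using subgroup_finite[OF Y_subgroup] by (simp add: C_def)
  have cC: "card Y = card P * card C" unfolding C_def using card_cosets_subgroup[OF Y_subgroup Ps] .
  then have pC: "\<not> p dvd card C" using P by (auto simp: sylow_def)
  define r where "r c = (SOME x. x \<in> Y \<and> c = x <# P)" for c
  have r: "r c \<in> Y" "c = r c <# P" if "c \<in> C" for c
  proof -
    have "\<exists>x. x \<in> Y \<and> c = x <# P" using that by (auto simp: C_def)
    from someI_ex[OF this] show "r c \<in> Y" "c = r c <# P" by (auto simp: r_def)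
  qed
  note act = left_coset_action[OF Y_subgroup Ps Y_subgroup order_refl, folded C_def]
  \<comment> \<open>The cocycle of the action on cosets:
    \<open>g \<otimes> r c = r (g <# c) \<otimes> f g c\<close>. The transfer \<open>V g\<close>
    adds the values of \<open>l\<close> on it.\<close>
  define f where "f g c = inv (r (g <# c)) \<otimes> g \<otimes> r c" for g c
  have fP: "f g c \<in> P" if g: "g \<in> Y" and c: "c \<in> C" for g c
  proof -
    have gc: "g <# c \<in> C" using act(2) g c by blast
    have "g <# (r c <# P) = (g \<otimes> r c) <# P" using g r(1)[OF c] Ps by (simp add: lcos_m_assoc subgroup.subset)
    then have "r (g <# c) <# P = (g \<otimes> r c) <# P" using r(2)[OF c] r(2)[OF gc] by metis
    then have "inv (r (g <# c)) \<otimes> (g \<otimes> r c) \<in> P" using l_coset_eq_iff[OF Ps(1)] g r(1)[OF c] r(1)[OF gc] by simp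
    then show ?thesis using g r(1)[OF c] r(1)[OF gc] by (simp add: f_def m_assoc)
  qed
  have f_mult: "f (g \<otimes> h) c = f g (h <# c) \<otimes> f h c" if g: "g \<in> Y" and h: "h \<in> Y" and c: "c \<in> C" for g h c
  proof -
    have m: "h <# c \<in> C" "g <# (h <# c) \<in> C" using act(2) g h c by auto
    have "(g \<otimes> h) <# c = g <# (h <# c)" using act(3) g h c by blast
    then show ?thesis using g h r(1)[OF c] r(1)[OF m(1)] r(1)[OF m(2)] by (simp add: f_def word_simps)
  qed
  define V where "V g = (\<Sum>c\<in>C. l (f g c))" for g
  have inj: "inj_on (\<lambda>c. h <# c) C" if h: "h \<in> Y" for h
  proof (rule inj_on_inverseI)
    fix c assume c: "c \<in> C"
    have "inv h <# (h <# c) = (inv h \<otimes> h) <# c" using act(3)[of "inv h" h c] h c by simp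
    then show "inv h <# (h <# c) = c" using act(1)[OF c] h by simp
  qed
  have V_mult: "[V (g \<otimes> h) = V g + V h] (mod p)" if g: "g \<in> Y" and h: "h \<in> Y" for g h
  proof -
    have "(\<lambda>c. h <# c) ` C = C"
      by (rule endo_inj_surj[OF finC]) (use act(2)[OF h] inj[OF h] in auto)
    then have "bij_betw (\<lambda>c. h <# c) C C" using inj[OF h] by (simp add: bij_betw_def)
    then have "(\<Sum>c\<in>C. l (f g (h <# c))) = V g" unfolding V_def by (rule sum.reindex_bij_betw)
    moreover have "[V (g \<otimes> h) = (\<Sum>c\<in>C. l (f g (h <# c)) + l (f h c))] (mod p)"
      unfolding V_def
    proof (rule cong_sum)
      fix c assume c: "c \<in> C"
      show "[l (f (g \<otimes> h) c) = l (f g (h <# c)) + l (f h c)] (mod p)"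
        unfolding f_mult[OF g h c] by (rule l) (use fP g h c act(2) in blast)+
    qed
    ultimately show ?thesis by (simp add: sum.distrib V_def)
  qed
  have Va: "[V a = card C * l a] (mod p)"
    unfolding V_def
  proof (rule cyclic_sums_cong[OF finC])
    have aY: "a \<in> Y" using a by simp
    have apow [simp]: "a [^] (i::nat) \<in> Y" for i using a by simp
    show "\<And>c. c \<in> C \<Longrightarrow> a <# c \<in> C" using act(2)[OF aY] .
    show "inj_on (\<lambda>c. a <# c) C" using inj[OF aY] .
    fix c n assume c: "c \<in> C" and n: "n > 0" and fixc: "((\<lambda>c. a <# c) ^^ n) c = c"
    have mem: "((\<lambda>c. a <# c) ^^ i) c \<in> C" for i by (induction i) (use c act(2)[OF aY] in auto)
    \<comment> \<open>Along an orbit of \<open>a\<close> the representatives in between telescope.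
      After \<open>n\<close> steps with \<open>c\<close> fixed, only the conjugate of
      \<open>a [^] n\<close> by \<open>inv (r c)\<close> remains.\<close>
    have part: "[(\<Sum>i<m. l (f a (((\<lambda>c. a <# c) ^^ i) c))) = l (inv (r (((\<lambda>c. a <# c) ^^ m) c)) \<otimes> a [^] m \<otimes> r c)] (mod p)
        \<and> inv (r (((\<lambda>c. a <# c) ^^ m) c)) \<otimes> a [^] m \<otimes> r c \<in> P" for m
    proof (induction m)
      case 0
      then show ?case using l1 r(1)[OF c] by (simp add: cong_sym)
    next
      case (Suc m)
      define d where "d = ((\<lambda>c. a <# c) ^^ m) c"
      have d: "d \<in> C" "a <# d \<in> C" using mem[of m] act(2)[OF aY] by (auto simp: d_def)
      define x where "x = inv (r d) \<otimes> a [^] m \<otimes> r c"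
      have x: "x \<in> P" using Suc by (simp add: x_def d_def)
      have eq: "inv (r (a <# d)) \<otimes> a [^] Suc m \<otimes> r c = f a d \<otimes> x"
        unfolding f_def x_def using r(1)[OF c] r(1)[OF d(1)] r(1)[OF d(2)] aY nat_pow_Suc2[of a m]
        by (simp add: word_simps del: nat_pow_Suc)
      have "(\<Sum>i<Suc m. l (f a (((\<lambda>c. a <# c) ^^ i) c))) = (\<Sum>i<m. l (f a (((\<lambda>c. a <# c) ^^ i) c))) + l (f a d)"
        by (simp add: d_def)
      also have "[\<dots> = l x + l (f a d)] (mod p)"
        using Suc by (simp add: cong_add_rcancel_nat x_def d_def)
      also have "l x + l (f a d) = l (f a d) + l x" by simp
      also have "[l (f a d) + l x = l (f a d \<otimes> x)] (mod p)" using l[OF fP[OF aY d(1)] x] by (rule cong_sym)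
      finally show ?case using eq fP[OF aY d(1)] x by (simp add: d_def)
    qed
    have conj: "inv (r c) \<otimes> a [^] n \<otimes> r c \<in> P" using part[of n] fixc by simp
    have an: "a [^] n \<in> P" using a by simp
    \<comment> \<open>Control of fusion: the conjugation by \<open>inv (r c)\<close> is replaced by
      one inside \<open>P\<close>, which \<open>l\<close> does not see modulo
      \<open>p\<close>.\<close>
    obtain h where h: "h \<in> P" "inv (r c) \<otimes> a [^] n \<otimes> r c = h \<otimes> a [^] n \<otimes> inv h"
      using fusion_in_sylow[OF P P1 an, of "inv (r c)"] conj r(1)[OF c] by auto
    have lpow: "[l (a [^] i) = i * l a] (mod p)" for i :: nat
    proof (induction i)
      case (Suc i)
      have "[l (a [^] Suc i) = l (a [^] i) + l a] (mod p)" using l[of "a [^] i" a] a by simp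
      also have "[l (a [^] i) + l a = i * l a + l a] (mod p)" using Suc by (simp add: cong_add_rcancel_nat)
      finally show ?case by (simp add: add.commute)
    qed (use l1 in simp)
    have "[(\<Sum>i<n. l (f a (((\<lambda>c. a <# c) ^^ i) c))) = l (inv (r c) \<otimes> a [^] n \<otimes> r c)] (mod p)"
      using part[of n] fixc by simp
    also have "[l (inv (r c) \<otimes> a [^] n \<otimes> r c) = l (a [^] n)] (mod p)" using linv[OF h(1) an] h(2) by simp
    also have "[l (a [^] n) = n * l a] (mod p)" by (rule lpow)
    finally show "[(\<Sum>i<n. l (f a (((\<lambda>c. a <# c) ^^ i) c))) = n * l a] (mod p)" .
  qed
  define K where "K = {g \<in> Y. p dvd V g}"
  have Vd: "p dvd V (g \<otimes> h) \<longleftrightarrow> p dvd V g + V h" if "g \<in> Y" "h \<in> Y" for g h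
    using V_mult[OF that] by (rule cong_dvd_iff)
  have V1: "p dvd V \<one>"
  proof -
    have "[V \<one> = 0] (mod p)"
      using V_mult[of \<one> \<one>] cong_add_lcancel_0_nat[of "V \<one>" "V \<one>" p] by (simp add: cong_sym_eq)
    then show ?thesis by (simp add: cong_0_iff)
  qed
  have subK: "subgroup K G"
    by (rule subgroup_finI) (use V1 Vd in \<open>auto simp: K_def\<close>)
  have "g \<otimes> x \<otimes> inv g \<in> K" if g: "g \<in> Y" and x: "x \<in> K" for g x
  proof -
    have x': "x \<in> Y" "p dvd V x" using x by (auto simp: K_def)
    have 1: "p dvd V g + V (inv g)" using Vd[of g "inv g"] V1 g by simp
    have "[V (g \<otimes> x \<otimes> inv g) = V (g \<otimes> x) + V (inv g)] (mod p)" using V_mult g x' by simp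
    also have "[V (g \<otimes> x) + V (inv g) = V g + V x + V (inv g)] (mod p)"
      using V_mult[OF g x'(1)] by (simp add: cong_add_rcancel_nat)
    finally have "p dvd V (g \<otimes> x \<otimes> inv g) \<longleftrightarrow> p dvd V g + V x + V (inv g)" by (rule cong_dvd_iff)
    moreover have "V g + V x + V (inv g) = V x + (V g + V (inv g))" by simp
    ultimately show ?thesis using g x' 1 by (simp add: K_def)
  qed
  then have "normal_in K Y" using subK Y_subgroup by (auto simp: normal_in_def K_def)
  moreover have "K \<noteq> Y"
  proof -
    have "\<not> p dvd card C * l a" using pC a(2) p by (simp add: prime_dvd_mult_iff)
    then have "\<not> p dvd V a" using cong_dvd_iff[OF Va] by simp
    then have "a \<notin> K" by (simp add: K_def)
    then show ?thesis using Pc[OF a(1)] by metis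
  qed
  moreover have "card Y \<le> p * card K"
  proof -
    have "card Y = card K * card ((\<lambda>g. V g mod p) ` Y)"
    proof (rule card_fibres_subgroup[OF Y_subgroup subK])
      show "K \<subseteq> Y" by (auto simp: K_def)
      fix x y assume xy: "x \<in> Y" "y \<in> Y"
      have "[V y = V x + V (inv x \<otimes> y)] (mod p)" using V_mult[of x "inv x \<otimes> y"] xy by (simp add: cancel_inv)
      then have "[V x = V y] (mod p) \<longleftrightarrow> [V x = V x + V (inv x \<otimes> y)] (mod p)"
        by (simp add: cong_def)
      also have "\<dots> \<longleftrightarrow> p dvd V (inv x \<otimes> y)"
        using cong_add_lcancel_nat[of "V x" 0 "V (inv x \<otimes> y)" p] by (simp add: cong_sym_eq[of 0] cong_0_iff)
      finally show "V x mod p = V y mod p \<longleftrightarrow> inv x \<otimes> y \<in> K" using xy by (simp add: K_def cong_def)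
    qed
    moreover have "(\<lambda>g. V g mod p) ` Y \<subseteq> {..<p}" using prime_gt_0_nat[OF p] by auto
    then have "card ((\<lambda>g. V g mod p) ` Y) \<le> p" using card_mono[of "{..<p}"] by fastforce
    ultimately show ?thesis by (simp add: mult.commute)
  qed
  ultimately show ?thesis by blast
qed

end

section \<open>The structure theorem\<close>

context fin_group
begin

lemma primitive_typeD:
  assumes "primitive_type Z F S f n"
  shows "normal_in F Z" "subgroup S G" "S \<subseteq> Z" "F \<inter> S = {\<one>}" "F <#> S = Z"
    "prime_nat f" "card F = f ^ n" "2 \<le> n" "\<not> f dvd card S" "S \<noteq> {\<one>}"
    "\<And>K. normal_in K Z \<Longrightarrow> K \<noteq> {\<one>} \<Longrightarrow> F \<subseteq> K" "centralizer_in Z F = F"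
    "supersolvable_over F Z" "supersolvable_over {\<one>} S" "maximal_in S Z"
    "card Z = card F * card S" "F \<noteq> {\<one>}" "F \<noteq> Z"
proof -
  note d = assms[unfolded primitive_type_def]
  show "normal_in F Z" "subgroup S G" "S \<subseteq> Z" "F \<inter> S = {\<one>}" "F <#> S = Z"
    "prime_nat f" "card F = f ^ n" "2 \<le> n" "\<not> f dvd card S" "S \<noteq> {\<one>}"
    "\<And>K. normal_in K Z \<Longrightarrow> K \<noteq> {\<one>} \<Longrightarrow> F \<subseteq> K" "centralizer_in Z F = F"
    "supersolvable_over F Z" "supersolvable_over {\<one>} S" "maximal_in S Z"
    using d by blast+
  then show c: "card Z = card F * card S"
    using card_set_mult_trivial[OF normal_inD(1)] by metis
  show "F \<noteq> {\<one>}"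
  proof
    assume "F = {\<one>}"
    then have "f ^ n = 1" using \<open>card F = f ^ n\<close> by simp
    then show False using \<open>2 \<le> n\<close> prime_gt_1_nat[OF \<open>prime_nat f\<close>] by simp
  qed
  show "F \<noteq> Z"
  proof
    assume "F = Z"
    then have "card S = 1" using c subgroup_card_pos[OF normal_inD(1)[OF \<open>normal_in F Z\<close>]] by simp
    then show False using nontrivial_card[OF \<open>subgroup S G\<close> \<open>S \<noteq> {\<one>}\<close>] by simp
  qed
qed

text \<open>\<open>S\<close> is maximal in \<open>Z\<close> and has \<open>Omega (card S)\<close>
  prime steps below it; \<open>F\<close> has \<open>n\<close> steps below it and
  \<open>Omega (card S)\<close> above. Starting at a subgroup of prime order removes one step in
  \<open>S\<close> or in \<open>F\<close>, which leaves lengths that differ by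
  \<open>n - 1\<close>.\<close>

lemma primitive_chains:
  assumes "primitive_type Z F S f n"
  shows "chain_len {\<one>} Z (Suc (Omega (card S)))" "chain_len {\<one>} Z (n + Omega (card S))"
    "\<exists>U. subgroup U G \<and> U \<subseteq> Z \<and> prime_nat (card U) \<and> chain_len U Z (Omega (card S))"
    "\<And>H. subgroup H G \<Longrightarrow> H \<subseteq> F \<Longrightarrow> card H = f \<Longrightarrow> chain_len H Z (n - 1 + Omega (card S))"
proof -
  note d = primitive_typeD[OF assms]
  note dF = normal_inD[OF d(1)]
  have one: "{\<one>} \<subseteq> H" if "subgroup H G" for H using subgroup.one_closed[OF that] by simp
  show "chain_len {\<one>} Z (Suc (Omega (card S)))"
    using chain_step[OF supersolvable_chain[OF d(14) triv_subgroup order_refl one[OF d(2)]] d(15)] by simp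
  have FZ: "chain_len F Z (Omega (card S))"
    using supersolvable_chain[OF d(13) dF(1) order_refl dF(3)] d(16) subgroup_card_pos[OF dF(1)] by simp
  then show "chain_len {\<one>} Z (n + Omega (card S))"
    using chain_trans[OF FZ p_group_chain[OF d(6) dF(1) d(7) triv_subgroup one[OF dF(1)], of 0]] by simp
  show "chain_len H Z (n - 1 + Omega (card S))" if "subgroup H G" "H \<subseteq> F" "card H = f" for H
    using chain_trans[OF FZ p_group_chain[OF d(6) dF(1) d(7) that(1,2), of 1]] that(3) by simp
  obtain q where q: "prime_nat q" "q dvd card S"
    using nontrivial_card[OF d(2,10)] prime_factor_nat[of "card S"] by auto
  obtain U where U: "subgroup U G" "U \<subseteq> S" "card U = q" using cauchy_subgroup[OF d(2) q] by blast
  obtain c where c: "card S = q * c" using q(2) by (auto elim: dvdE)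
  have "c > 0" using c subgroup_card_pos[OF d(2)] by (cases c) auto
  then have "Omega (card S) = Suc (Omega c)" using c Omega_prime_mult[OF q(1)] by simp
  moreover have "chain_len U S (Omega c)"
    using supersolvable_chain[OF d(14) U(1) one[OF U(1)] U(2)] c U(3) prime_gt_0_nat[OF q(1)] by simp
  ultimately have "chain_len U Z (Omega (card S))" using chain_step d(15) by simp
  then show "\<exists>U. subgroup U G \<and> U \<subseteq> Z \<and> prime_nat (card U) \<and> chain_len U Z (Omega (card S))"
    using U q(1) d(3) by blast
qed

definition settled :: "'a set \<Rightarrow> bool"
  where "settled Z \<longleftrightarrow> supersolvable_over {\<one>} Z \<or> (\<exists>F S f n. primitive_type Z F S f n)"

lemma supersolvable_prime_order:
  assumes Y: "subgroup Y G" "prime_nat (card Y)"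
  shows "supersolvable_over {\<one>} Y"
proof -
  have "supersolvable_over Y Y"
    using normal_in_self[OF Y(1)] by (auto simp: supersolvable_over_def normal_in_def)
  then show ?thesis
    using supersolvable_over_prime_index[OF normal_in_one[OF Y(1)], of Y "card Y"] Y subgroup.one_closed[OF Y(1)]
    by simp
qed

text \<open>Let \<open>\<lambda>\<close> be the least length of a maximal chain starting at a subgroup of prime order, and
  \<open>u\<close> the least order of a subgroup attaining it. No normalizer of a \<open>u\<close>-subgroup is of
  primitive type, and every prime dividing the order of such a normalizer is at least \<open>u\<close>. So
  the normalizers satisfy the hypothesis of the transfer argument, and \<open>Y\<close> is not simple.\<close>

lemma simple_settled:
  assumes mu: "minimal_uniform Y"
    and simple: "\<And>K. normal_in K Y \<Longrightarrow> K = {\<one>} \<or> K = Y"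
    and proper: "\<And>Z. subgroup Z G \<Longrightarrow> Z \<subset> Y \<Longrightarrow> settled Z"
  shows "supersolvable_over {\<one>} Y"
proof (rule ccontr)
  assume nss: "\<not> supersolvable_over {\<one>} Y"
  have Y: "subgroup Y G" using mu by (simp add: minimal_uniform_def)
  have Yc: "x \<in> carrier G" if "x \<in> Y" for x using Y that by (simp add: subgroup.mem_carrier)
  have not_prime: "\<not> prime_nat (card Y)" using supersolvable_prime_order[OF Y] nss by blast
  have no_prime_normal: "\<not> prime_nat (card K)" if "normal_in K Y" for K
    using simple[OF that] not_prime by auto
  have "Y \<noteq> {\<one>}"
  proof
    assume "Y = {\<one>}"
    then have "supersolvable_over {\<one>} Y" using normal_in_self[OF Y] by (auto simp: supersolvable_over_def normal_in_def)
    then show False using nss by simp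
  qed
  then have "card Y > 1" using nontrivial_card[OF Y] by simp
  then obtain q0 where q0: "prime_nat q0" "q0 dvd card Y" using prime_factor_nat[of "card Y"] by auto
  define \<U> where "\<U> = {H. subgroup H G \<and> H \<subseteq> Y \<and> prime_nat (card H)}"
  \<comment> \<open>The choice is harmless: all chains from a member of \<open>\<U>\<close> to
    \<open>Y\<close> have the same length.\<close>
  define len where "len H = (SOME n. chain_len H Y n)" for H
  have len: "len H = n" if H: "H \<in> \<U>" and n: "chain_len H Y n" for H n
  proof -
    have "chain_len H Y (len H)" unfolding len_def using n by (rule someI)
    moreover have "uniform_chains H Y" using mu H by (auto simp: \<U>_def minimal_uniform_def)
    ultimately show ?thesis using n unfolding uniform_chains_def by blast
  qed
  have len_conj: "conj_set x H \<in> \<U> \<and> len (conj_set x H) = len H \<and> card (conj_set x H) = card H" if H: "H \<in> \<U>" and x: "x \<in> Y" for x H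
  proof -
    have h: "subgroup H G" "H \<subseteq> Y" "prime_nat (card H)" using H by (auto simp: \<U>_def)
    have c: "card (conj_set x H) = card H" using card_conj_set[of x H] Yc x h by (auto simp: subset_iff)
    obtain n where n: "chain_len H Y n" using chain_exists[OF h(1) Y h(2)] by blast
    have "chain_len (conj_set x H) Y n" using chain_len_conj[OF n Yc[OF x]] conj_set_self[OF Y x] by simp
    moreover have "conj_set x H \<in> \<U>"
      using subgroup_conj_set[OF Yc[OF x] h(1)] conj_set_mono[OF h(2), of x] conj_set_self[OF Y x] c h(3)
      by (simp add: \<U>_def)
    ultimately show ?thesis using len n H c by metis
  qed
  obtain H0 where "H0 \<in> \<U>" using cauchy_subgroup[OF Y q0] q0(1) by (auto simp: \<U>_def)
  then obtain H1 where H1: "H1 \<in> \<U>" "\<And>H. H \<in> \<U> \<Longrightarrow> len H1 \<le> len H"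
    using ex_has_least_nat[of "\<lambda>H. H \<in> \<U>" H0 len] by blast
  then obtain U0 where U0: "U0 \<in> \<U>" "len U0 = len H1"
    "\<And>H. H \<in> \<U> \<Longrightarrow> len H = len H1 \<Longrightarrow> card U0 \<le> card H"
    using ex_has_least_nat[of "\<lambda>H. H \<in> \<U> \<and> len H = len H1" H1 card] by blast
  define u where "u = card U0"
  have U: "subgroup U0 G" "U0 \<subseteq> Y" "prime_nat u" using U0(1) by (auto simp: \<U>_def u_def)
  have least: "\<And>H. H \<in> \<U> \<Longrightarrow> len U0 \<le> len H" using H1 U0 by simp
  have norm_proper: "normalizer_in Y D \<subset> Y" if "subgroup D G" "D \<subseteq> Y" "D \<noteq> {\<one>}" "D \<noteq> Y" for D
  proof -
    have "normalizer_in Y D \<noteq> Y"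
    proof
      assume "normalizer_in Y D = Y"
      then have "normal_in D Y" using normal_in_normalizer[OF Y that(1,2)] by simp
      then show False using simple that by blast
    qed
    then show ?thesis by (auto simp: normalizer_in_def)
  qed
  \<comment> \<open>The normalizer of \<open>F\<close> in \<open>Y\<close> is again of primitive
    type with the same \<open>F\<close>, so \<open>F\<close> is a Sylow \<open>u\<close>-subgroup of
    \<open>Y\<close> and contains a conjugate of \<open>U0\<close>. The chains of this conjugate are
    longer by \<open>n - 1\<close> than those of a subgroup of prime order in \<open>S\<close>,
    against the choice of \<open>U0\<close>.\<close>
  have no_prim: False if Z: "Z \<subset> Y" and prim: "primitive_type Z F S u n" for Z F S n
  proof -
    note d = primitive_typeD[OF prim]
    note dF = normal_inD[OF d(1)]
    have FY: "F \<subset> Y" using dF(3) Z by blast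
    define M where "M = normalizer_in Y F"
    have FM: "normal_in F M" unfolding M_def using normal_in_normalizer[OF Y dF(1)] FY by blast
    have ZM: "Z \<subseteq> M" unfolding M_def using normal_in_le_normalizer[OF d(1)] Z by blast
    have "M \<subset> Y" unfolding M_def using norm_proper[OF dF(1) _ d(17)] FY by blast
    then have "settled M" using proper normal_inD(2)[OF FM] by blast
    moreover have "\<not> supersolvable_over {\<one>} M"
    proof
      assume "supersolvable_over {\<one>} M"
      moreover have "{\<one>} \<subset> F" using d(17) subgroup.one_closed[OF dF(1)] by blast
      ultimately obtain L q where L: "normal_in L M" "{\<one>} \<subseteq> L" "L \<subseteq> F" "prime_nat q" "card L = q * card {\<one>}"
        using supersolvable_overD[OF _ normal_in_one[OF normal_inD(2)[OF FM]] FM order_refl] by blast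
      have "normal_in L Z" using normal_in_mono[OF L(1) dF(2) _ ZM] L(3) dF(3) by blast
      moreover have "L \<noteq> {\<one>}" using L(4,5) by auto
      ultimately have "L = F" using d(11) L(3) by blast
      then have "prime_nat (u ^ n)" using L(4,5) d(7) by simp
      then show False using d(8) by (simp add: prime_power_iff)
    qed
    ultimately obtain F' S' f' n' where prim': "primitive_type M F' S' f' n'" by (auto simp: settled_def)
    note e = primitive_typeD[OF prim']
    have F'F: "F' \<subseteq> F" using e(11)[OF FM d(17)] .
    have "normal_in F' Z" using normal_in_mono[OF e(1) dF(2) _ ZM] F'F dF(3) by blast
    then have "F' = F" using d(11) e(17) F'F by blast
    then have "f' ^ n' = u ^ n" using e(7) d(7) by simp
    moreover have "f' dvd f' ^ n'" using e(8) by (simp add: dvd_power)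
    ultimately have "f' dvd u ^ n" by simp
    then have "f' = u" using prime_dvd_power[OF e(6)] primes_dvd_imp_eq[OF e(6) U(3)] by blast
    then have no_dvd: "\<not> u * card F dvd card M"
      using e(9,16) \<open>F' = F\<close> subgroup_card_pos[OF dF(1)] by (simp add: mult.commute)
    have syl: "\<not> u * card F dvd card Y"
    proof
      assume "u * card F dvd card Y"
      then obtain K where K: "normal_in F K" "K \<subseteq> Y" "card K = u * card F"
        using p_subgroup_extend[OF Y dF(1) _ d(7) U(3)] FY by blast
      have "K \<subseteq> M" unfolding M_def using normal_in_le_normalizer[OF K(1,2)] .
      then have "card K dvd card M" using card_subgroup_dvd[OF normal_inD(2)[OF K(1)] normal_inD(2)[OF FM]] by blast
      then show False using no_dvd K(3) by simp
    qed
    have "card U0 = u ^ 1" by (simp add: u_def)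
    then obtain x where x: "x \<in> Y" "\<forall>h\<in>U0. inv x \<otimes> h \<otimes> x \<in> F"
      using p_subgroup_conj_sylow[OF Y dF(1) _ syl U(1,2) _ U(3)] FY by blast
    have ix: "inv x \<in> Y" using x Y by (simp add: subgroup.m_inv_closed)
    define H where "H = conj_set (inv x) U0"
    have HF: "H \<subseteq> F" using x Yc by (auto simp: H_def conj_set_def)
    have H: "H \<in> \<U>" "len H = len U0" "card H = u" using len_conj[OF U0(1) ix] by (auto simp: H_def u_def)
    obtain m where m: "chain_len Z Y m" using chain_exists[OF dF(2) Y] Z by blast
    have "chain_len H Y (n - 1 + Omega (card S) + m)"
      using chain_trans[OF m primitive_chains(4)[OF prim _ HF H(3)]] H(1) by (auto simp: \<U>_def)
    then have lH: "len U0 = n - 1 + Omega (card S) + m" using len H(1,2) by metis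
    obtain Q where Q: "subgroup Q G" "Q \<subseteq> Z" "prime_nat (card Q)" "chain_len Q Z (Omega (card S))"
      using primitive_chains(3)[OF prim] by blast
    have QU: "Q \<in> \<U>" using Q Z by (auto simp: \<U>_def)
    have "len Q = Omega (card S) + m" using len[OF QU chain_trans[OF m Q(4)]] .
    then show False using least[OF QU] lH d(8) by linarith
  qed
  obtain P k where P: "subgroup P G" "U0 \<subseteq> P" "P \<subseteq> Y" "card P = u ^ k" "\<not> u * card P dvd card Y"
    using p_subgroup_in_sylow[OF Y U(1,2) _ U(3), of 1] by (auto simp: u_def)
  have uP: "u dvd card P" using card_subgroup_dvd[OF U(1) P(1,2)] by (simp add: u_def)
  have subZP: "subgroup (centralizer_in P P) G" using subgroup_centralizer_in[OF P(1)] P(1) by (simp add: subgroup.subset)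
  have "u dvd card (centralizer_in P P)"
  proof -
    obtain z where "z \<in> P" "z \<noteq> \<one>" "\<forall>x\<in>P. x \<otimes> z = z \<otimes> x"
      using p_group_fixed_point[OF normal_in_self[OF P(1)] P(1) order_refl P(4) U(3) uP] by blast
    then have "centralizer_in P P \<noteq> {\<one>}" by (auto simp: centralizer_in_def)
    then have "card (centralizer_in P P) \<noteq> 1" using nontrivial_card[OF subZP] by simp
    moreover have "card (centralizer_in P P) dvd u ^ k"
      using card_subgroup_dvd[OF subZP P(1)] P(4) by (auto simp: centralizer_in_def)
    then obtain i where "card (centralizer_in P P) = u ^ i" using divides_primepow_nat[OF U(3)] by blast
    ultimately show ?thesis by (cases i) auto
  qed
  \<comment> \<open>As \<open>Z1\<close> is central in the Sylow subgroup \<open>P\<close>, some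
    conjugate of it centralizes any given \<open>u\<close>-subgroup \<open>D\<close> and lies in its
    normalizer. Each such normalizer thus contains a subgroup of order \<open>u\<close> with the
    least chain length.\<close>
  then obtain Z1 where Z1: "subgroup Z1 G" "Z1 \<subseteq> centralizer_in P P" "card Z1 = u"
    using cauchy_subgroup[OF subZP U(3)] by blast
  have Z1P: "Z1 \<subseteq> P" and Z1c: "\<And>z x. z \<in> Z1 \<Longrightarrow> x \<in> P \<Longrightarrow> z \<otimes> x = x \<otimes> z"
    using Z1(2) by (auto simp: centralizer_in_def)
  have Pc: "x \<in> carrier G" if "x \<in> P" for x using P(1) that by (simp add: subgroup.mem_carrier)
  have Z1U: "Z1 \<in> \<U>" using Z1 Z1P P(3) U(3) by (auto simp: \<U>_def)
  have Z1n: "normal_in Z1 P"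
  proof -
    have "x \<otimes> z \<otimes> inv x \<in> Z1" if "x \<in> P" "z \<in> Z1" for x z
    proof -
      have "x \<otimes> z \<otimes> inv x = z \<otimes> x \<otimes> inv x" using Z1c[OF that(2,1)] by simp
      then show ?thesis using that Z1P Pc by (simp add: m_assoc subset_iff)
    qed
    then show ?thesis using Z1(1) P(1) Z1P by (auto simp: normal_in_def)
  qed
  \<comment> \<open>If distinct, \<open>Z1\<close> and \<open>U0\<close> are both maximal in their
    product of order \<open>u * u\<close>, and one chain from the product to \<open>Y\<close> serves
    both.\<close>
  have Z1len: "len Z1 = len U0"
  proof (cases "Z1 \<subseteq> U0")
    case True
    then have "Z1 = U0" using subgroup_eq_card[OF U(1)] Z1(3) by (simp add: u_def)
    then show ?thesis by simp
  next
    case False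
    have one: "{\<one>} \<subseteq> Z1" "{\<one>} \<subseteq> U0" using subgroup.one_closed[OF Z1(1)] subgroup.one_closed[OF U(1)] by auto
    have int: "Z1 \<inter> U0 = {\<one>}"
      using prime_index_Int[OF triv_subgroup Z1(1) one(1) _ U(3) U(1) one(2)] Z1(3) False by simp
    define W where "W = Z1 <#> U0"
    have W: "subgroup W G" unfolding W_def using subgroup_prod[OF Z1n U(1) P(2)] .
    have sup: "Z1 \<subseteq> W" "U0 \<subseteq> W" unfolding W_def using set_mult_superset Z1(1) U(1) by auto
    have WY: "W \<subseteq> Y" unfolding W_def using set_mult_subset[OF Y _ U(2)] Z1P P(3) by blast
    have cW: "card W = u * u" unfolding W_def using card_set_mult_trivial[OF Z1(1) U(1) int] Z1(3) by (simp add: u_def)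
    obtain m where m: "chain_len W Y m" using chain_exists[OF W Y WY] by blast
    have "maximal_in Z1 W" using maximal_in_prime_index[OF Z1(1) W sup(1) _ U(3)] cW Z1(3) by simp
    then have "len Z1 = 1 + m" using len[OF Z1U chain_trans[OF m chain_maximal]] by blast
    moreover have "maximal_in U0 W" using maximal_in_prime_index[OF U(1) W sup(2) _ U(3)] cW by (simp add: u_def)
    then have "len U0 = 1 + m" using len[OF U0(1) chain_trans[OF m chain_maximal]] by blast
    ultimately show ?thesis by simp
  qed
  have "P \<noteq> Y"
  proof
    assume "P = Y"
    then show False using no_prime_normal[of Z1] Z1n Z1(3) U(3) by simp
  qed
  have card_u_proper: "D \<noteq> Y" if "card D = u ^ j" for D j
  proof
    assume "D = Y"
    then have c: "card Y = u ^ j" using that by simp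
    have "card P < card Y" using \<open>P \<noteq> Y\<close> P(3) subgroup_finite[OF Y] by (intro psubset_card_mono) auto
    then have "u ^ k < u ^ j" using c P(4) by simp
    then have "k < j" using prime_gt_1_nat[OF U(3)] by simp
    then have "u ^ Suc k dvd u ^ j" by (simp add: Suc_leI le_imp_power_dvd del: power_Suc)
    then show False using P(4,5) c by simp
  qed
  interpret fl: frobenius_local G Y u
  proof (intro frobenius_local.intro frobenius_local_axioms.intro, rule fin_group_axioms, rule Y, rule U(3))
    fix D j Q q e
    assume D: "subgroup D G" "D \<subseteq> Y" "D \<noteq> {\<one>}" "card D = u ^ j"
      and Q: "subgroup Q G" "Q \<subseteq> normalizer_in Y D" "card Q = q ^ e" and q: "prime_nat q" "q \<noteq> u"
    define M where "M = normalizer_in Y D"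
    have DM: "normal_in D M" unfolding M_def using normal_in_normalizer[OF Y D(1,2)] .
    note dM = normal_inD[OF DM]
    have MY: "M \<subset> Y" unfolding M_def using norm_proper[OF D(1-3) card_u_proper[OF D(4)]] .
    have ssM: "supersolvable_over {\<one>} M"
    proof (rule ccontr)
      assume "\<not> supersolvable_over {\<one>} M"
      then obtain F S f n where prim: "primitive_type M F S f n"
        using proper[OF dM(2) MY] by (auto simp: settled_def)
      note d = primitive_typeD[OF prim]
      have "card F dvd card D" using card_subgroup_dvd[OF normal_inD(1)[OF d(1)] D(1) d(11)[OF DM D(3)]] .
      then have "f ^ n dvd u ^ j" using D(4) d(7) by simp
      moreover have "f dvd f ^ n" using d(8) by (simp add: dvd_power)
      ultimately have "f dvd u ^ j" by (rule dvd_trans[rotated])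
      then have "f = u" using prime_dvd_power[OF d(6)] primes_dvd_imp_eq[OF d(6) U(3)] by blast
      then show False using no_prim[OF MY] prim by blast
    qed
    obtain x where x: "x \<in> Y" "\<forall>h\<in>D. inv x \<otimes> h \<otimes> x \<in> P"
      using p_subgroup_conj_sylow[OF Y P(1,3,5) D(1,2,4) U(3)] by blast
    define Z2 where "Z2 = conj_set x Z1"
    have Z2: "Z2 \<in> \<U>" "len Z2 = len U0" "card Z2 = u"
      using len_conj[OF Z1U x(1)] Z1len Z1(3) by (auto simp: Z2_def)
    have Z2s: "subgroup Z2 G" "Z2 \<subseteq> Y" using Z2(1) by (auto simp: \<U>_def)
    have "z \<otimes> d \<otimes> inv z = d \<and> inv z \<otimes> d \<otimes> z = d" if z: "z \<in> Z2" and dD: "d \<in> D" for z d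
    proof -
      obtain v where v: "v \<in> Z1" "z = x \<otimes> v \<otimes> inv x" using z by (auto simp: Z2_def conj_set_def)
      define w where "w = inv x \<otimes> d \<otimes> x"
      have w: "w \<in> P" using x(2) dD by (simp add: w_def)
      have c: "x \<in> carrier G" "v \<in> carrier G" "d \<in> carrier G" "w \<in> carrier G"
        using x(1) v(1) dD D(2) Z1P Yc Pc w by auto
      have vw: "v \<otimes> w = w \<otimes> v" using Z1c[OF v(1) w] .
      have dw: "d = x \<otimes> w \<otimes> inv x" using c by (simp add: w_def word_simps)
      have "z \<otimes> d = x \<otimes> (v \<otimes> w) \<otimes> inv x" unfolding v(2) dw using c by (simp add: word_simps)
      also have "\<dots> = d \<otimes> z" unfolding vw v(2) dw using c by (simp add: word_simps)
      finally have zd: "z \<otimes> d = d \<otimes> z" .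
      have zc: "z \<in> carrier G" using v(2) c by simp
      have "inv z \<otimes> d \<otimes> z = inv z \<otimes> (z \<otimes> d)" unfolding zd using zc c by (simp add: m_assoc)
      also have "\<dots> = d" using zc c by (simp add: cancel_inv)
      finally have "inv z \<otimes> d \<otimes> z = d" .
      moreover have "z \<otimes> d \<otimes> inv z = d" unfolding zd using zc c by (simp add: m_assoc)
      ultimately show ?thesis by simp
    qed
    then have Z2M: "Z2 \<subseteq> M" using Z2s(2) by (auto simp: M_def normalizer_in_def)
    have one: "{\<one>} \<subseteq> H" if "subgroup H G" for H using subgroup.one_closed[OF that] by simp
    obtain m where m: "chain_len M Y m" using chain_exists[OF dM(2) Y] MY by blast
    \<comment> \<open>In the supersolvable group \<open>M\<close> every subgroup of prime order
      starts a chain with the same number of steps. So \<open>V\<close> shares the least length of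
      \<open>Z2\<close>, and \<open>u\<close> was the least order attaining it.\<close>
    have u_le: "u \<le> v" if v: "prime_nat v" "v dvd card M" for v
    proof -
      obtain V where V: "subgroup V G" "V \<subseteq> M" "card V = v" using cauchy_subgroup[OF dM(2) v] by blast
      have VU: "V \<in> \<U>" using V v(1) MY by (auto simp: \<U>_def)
      have *: "Suc (Omega (card M div w)) = Omega (card M)" if "prime_nat w" "w dvd card M" for w
      proof -
        from that(2) obtain c where c: "card M = w * c" by (auto elim: dvdE)
        then have "c > 0" using subgroup_card_pos[OF dM(2)] by (cases c) auto
        then show ?thesis using c Omega_prime_mult[OF that(1)] prime_gt_0_nat[OF that(1)] by simp
      qed
      have "len V = Omega (card M div v) + m"
        using len[OF VU chain_trans[OF m supersolvable_chain[OF ssM V(1) one[OF V(1)] V(2)]]] V(3) by simp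
      moreover have "len Z2 = Omega (card M div u) + m"
        using len[OF Z2(1) chain_trans[OF m supersolvable_chain[OF ssM Z2s(1) one[OF Z2s(1)] Z2M]]] Z2(3) by simp
      moreover have "u dvd card M" using card_subgroup_dvd[OF Z2s(1) dM(2) Z2M] Z2(3) by simp
      ultimately have "len V = len U0" using *[OF v] *[OF U(3)] Z2(2) by simp
      then show ?thesis using U0(2) U0(3)[OF VU] V(3) by (simp add: u_def)
    qed
    show "\<forall>y\<in>Q. \<forall>d\<in>D. y \<otimes> d = d \<otimes> y"
    proof (cases "e = 0")
      case True
      then have "card Q = 1" using Q(3) by simp
      then have "Q = {\<one>}" using nontrivial_card[OF Q(1)] by fastforce
      then show ?thesis using D(2) Yc by auto
    next
      case False
      have QM: "Q \<subseteq> M" using Q(2) by (simp add: M_def)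
      have "q dvd card Q" using Q(3) False by simp
      then have "q dvd card M" using card_subgroup_dvd[OF Q(1) dM(2) QM] dvd_trans by blast
      then have "u < q" using u_le[OF q(1)] q(2) by simp
      then show ?thesis using coprime_action_trivial[OF ssM DM D(4) U(3) Q(1) QM Q(3) q(1)] by blast
    qed
  qed
  have "u dvd card Y" using card_subgroup_dvd[OF U(1) Y U(2)] by (simp add: u_def)
  then obtain K where K: "normal_in K Y" "K \<noteq> Y" "card Y \<le> u * card K"
    using fl.normal_subgroup_index_p by blast
  \<comment> \<open>The transfer gave a proper normal subgroup of index at most \<open>u\<close>. By
    simplicity it is trivial, which leaves only the order \<open>u\<close> for
    \<open>Y\<close>.\<close>
  then have "K = {\<one>}" using simple by blast
  then have "card Y \<le> u" using K(3) by simp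
  moreover have "u \<le> card Y" using \<open>u dvd card Y\<close> \<open>card Y > 1\<close> by (simp add: dvd_imp_le)
  ultimately show False using not_prime U(3) by simp
qed

section \<open>Minimal normal subgroups of the non-simple group\<close>

lemma commutators_in_prime_index:
  assumes HP: "normal_in H P" and max: "maximal_in H P" and "x \<in> P" "y \<in> P"
  shows "x \<otimes> y \<otimes> inv x \<otimes> inv y \<in> H"
proof -
  note d = normal_inD[OF HP]
  have Pc [simp]: "z \<in> carrier G" if "z \<in> P" for z using that d(2) by (simp add: subgroup.mem_carrier)
  have [simp]: "z \<in> P" if "z \<in> H" for z using that d(3) by auto
  have cl [simp]: "\<one> \<in> P" "v \<in> P \<Longrightarrow> w \<in> P \<Longrightarrow> v \<otimes> w \<in> P" "v \<in> P \<Longrightarrow> inv v \<in> P" for v w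
    using d(2) by (auto simp: subgroup.one_closed subgroup.m_closed subgroup.m_inv_closed)
  have Hcl: "\<one> \<in> H" "v \<in> H \<Longrightarrow> w \<in> H \<Longrightarrow> v \<otimes> w \<in> H" "v \<in> H \<Longrightarrow> inv v \<in> H" for v w
    using d(1) by (auto simp: subgroup.one_closed subgroup.m_closed subgroup.m_inv_closed)
  \<comment> \<open>\<open>H\<close> and one element \<open>t\<close> outside it generate
    \<open>P\<close>, so commutators need only be tested modulo \<open>H\<close> on these
    generators.\<close>
  obtain t where t: "t \<in> P" "t \<notin> H" using max by (auto simp: maximal_in_def)
  have whole: "M = P" if M: "M \<subseteq> P" "H \<subseteq> M" "t \<in> M" "\<And>v w. v \<in> M \<Longrightarrow> w \<in> M \<Longrightarrow> v \<otimes> w \<in> M" for M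
  proof -
    have "subgroup M G" by (rule subgroup_finI) (use M Hcl in \<open>auto simp: subset_iff\<close>)
    then show ?thesis using max M(1-3) t unfolding maximal_in_def by blast
  qed
  have mult: "v \<otimes> w \<otimes> z \<otimes> inv (v \<otimes> w) \<otimes> inv z \<in> H"
    if "v \<in> P" "w \<in> P" "z \<in> P" "v \<otimes> z \<otimes> inv v \<otimes> inv z \<in> H" "w \<otimes> z \<otimes> inv w \<otimes> inv z \<in> H" for v w z
  proof -
    have "v \<otimes> (w \<otimes> z \<otimes> inv w \<otimes> inv z) \<otimes> inv v \<otimes> (v \<otimes> z \<otimes> inv v \<otimes> inv z) \<in> H"
      by (rule Hcl(2)[OF d(4)[OF that(1,5)] that(4)])
    then show ?thesis using that(1-3) by (simp add: word_simps)
  qed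
  have left: "v \<otimes> z \<otimes> inv v \<otimes> inv z \<in> H" if "v \<in> H" "z \<in> P" for v z
  proof -
    have "v \<otimes> (z \<otimes> inv v \<otimes> inv z) \<in> H" by (rule Hcl(2)[OF that(1) d(4)[OF that(2) Hcl(3)[OF that(1)]]])
    then show ?thesis using that by (simp add: word_simps)
  qed
  have t_comm: "z \<otimes> t \<otimes> inv z \<otimes> inv t \<in> H" if "z \<in> P" for z
  proof -
    have "{z \<in> P. z \<otimes> t \<otimes> inv z \<otimes> inv t \<in> H} = P"
      by (rule whole) (use t left mult Hcl in \<open>auto simp: m_assoc[of t t]\<close>)
    then show ?thesis using that by blast
  qed
  have "{z \<in> P. \<forall>w\<in>P. z \<otimes> w \<otimes> inv z \<otimes> inv w \<in> H} = P"
  proof (rule whole)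
    show "H \<subseteq> {z \<in> P. \<forall>w\<in>P. z \<otimes> w \<otimes> inv z \<otimes> inv w \<in> H}" using left by auto
    have "t \<otimes> w \<otimes> inv t \<otimes> inv w \<in> H" if "w \<in> P" for w
      using Hcl(3)[OF t_comm[OF that]] t that by (simp add: word_simps)
    then show "t \<in> {z \<in> P. \<forall>w\<in>P. z \<otimes> w \<otimes> inv z \<otimes> inv w \<in> H}" using t by blast
    show "\<And>v w. v \<in> {z \<in> P. \<forall>w\<in>P. z \<otimes> w \<otimes> inv z \<otimes> inv w \<in> H} \<Longrightarrow> w \<in> {z \<in> P. \<forall>w\<in>P. z \<otimes> w \<otimes> inv z \<otimes> inv w \<in> H} \<Longrightarrow>
      v \<otimes> w \<in> {z \<in> P. \<forall>w\<in>P. z \<otimes> w \<otimes> inv z \<otimes> inv w \<in> H}" using mult by auto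
  qed blast
  then show ?thesis using assms(3,4) by blast
qed

text \<open>A nontrivial settled group is supersolvable over some \<open>M \<noteq> Z\<close>,
  either trivial or \<open>F\<close>. A maximal one among the proper normal subgroups above
  \<open>M\<close> has prime index, so the group is not perfect.\<close>

lemma settled_commutators:
  assumes "settled Z" "subgroup Z G" "Z \<noteq> {\<one>}"
  shows "\<exists>H. subgroup H G \<and> H \<subset> Z \<and> (\<forall>x\<in>Z. \<forall>y\<in>Z. x \<otimes> y \<otimes> inv x \<otimes> inv y \<in> H)"
proof -
  obtain M where M: "supersolvable_over M Z" "M \<noteq> Z"
    using assms(1,3) primitive_typeD(13,18) unfolding settled_def by metis
  define S where "S = {H. normal_in H Z \<and> M \<subseteq> H \<and> H \<noteq> Z}"
  have "finite S"
    by (rule finite_subset[of _ "Pow Z"]) (use subgroup_finite[OF assms(2)] in \<open>auto simp: S_def normal_in_def\<close>)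
  moreover have "M \<in> S" using M by (auto simp: S_def supersolvable_over_def)
  ultimately obtain H where H: "H \<in> S" and Hmax: "\<And>L. L \<in> S \<Longrightarrow> H \<subseteq> L \<Longrightarrow> H = L"
    using finite_has_maximal[of S] by blast
  have HZ: "normal_in H Z" "M \<subseteq> H" "H \<noteq> Z" using H by (auto simp: S_def)
  note d = normal_inD[OF HZ(1)]
  have "H \<subset> Z" using HZ d by blast
  then obtain L p where L: "normal_in L Z" "H \<subseteq> L" "L \<subseteq> Z" "prime_nat p" "card L = p * card H"
    using supersolvable_overD[OF M(1) HZ(1) normal_in_self[OF assms(2)] HZ(2)] by blast
  have "H \<noteq> L" using L(5) subgroup_card_pos[OF d(1)] prime_gt_1_nat[OF L(4)] by auto
  then have "L = Z" using Hmax[of L] L HZ(2) by (auto simp: S_def)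
  then have "maximal_in H Z" using maximal_in_prime_index[OF d(1) assms(2) d(3)] L(4,5) by blast
  then show ?thesis using commutators_in_prime_index[OF HZ(1)] d(1) \<open>H \<subset> Z\<close> by blast
qed

text \<open>The commutators of \<open>N\<close> generate a normal subgroup of \<open>Y\<close>. It
  is proper in \<open>N\<close> because \<open>N\<close> is settled, hence trivial by
  minimality.\<close>

lemma abelian_minimal_normal:
  assumes N: "normal_in N Y" and min: "\<And>K. normal_in K Y \<Longrightarrow> K \<subseteq> N \<Longrightarrow> K = {\<one>} \<or> K = N"
    and "settled N" "N \<noteq> {\<one>}" and xy: "x \<in> N" "y \<in> N"
  shows "x \<otimes> y = y \<otimes> x"
proof -
  note d = normal_inD[OF N]
  have Yc: "z \<in> carrier G" if "z \<in> Y" for z using that d(2) by (simp add: subgroup.mem_carrier)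
  have Nc: "z \<in> carrier G" "z \<in> Y" if "z \<in> N" for z using that d(3) Yc by auto
  obtain H where H: "subgroup H G" "H \<subset> N" "\<forall>x\<in>N. \<forall>y\<in>N. x \<otimes> y \<otimes> inv x \<otimes> inv y \<in> H"
    using settled_commutators[OF assms(3) d(1) assms(4)] by blast
  define C where "C = {z. \<exists>x\<in>N. \<exists>y\<in>N. z = x \<otimes> y \<otimes> inv x \<otimes> inv y}"
  define D where "D = generate G C"
  have CH: "C \<subseteq> H" using H(3) by (auto simp: C_def)
  have Cc: "C \<subseteq> carrier G" using CH H(1) subgroup.subset by blast
  have DH: "D \<subseteq> H" unfolding D_def using generate_subgroup_incl[OF CH H(1)] .
  have subD: "subgroup D G" unfolding D_def using generate_is_subgroup[OF Cc] .
  have "y \<otimes> z \<otimes> inv y \<in> D" if y: "y \<in> Y" and z: "z \<in> D" for y z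
  proof -
    have conjC: "y \<otimes> c \<otimes> inv y \<in> C" if "c \<in> C" for c
    proof -
      from that obtain a b where ab: "a \<in> N" "b \<in> N" "c = a \<otimes> b \<otimes> inv a \<otimes> inv b" by (auto simp: C_def)
      have "y \<otimes> c \<otimes> inv y = (y \<otimes> a \<otimes> inv y) \<otimes> (y \<otimes> b \<otimes> inv y) \<otimes> inv (y \<otimes> a \<otimes> inv y) \<otimes> inv (y \<otimes> b \<otimes> inv y)"
        using ab Nc Yc[OF y] by (simp add: word_simps)
      then show ?thesis using d(4)[OF y] ab unfolding C_def by blast
    qed
    show ?thesis using z unfolding D_def
    proof (induction rule: generate.induct)
      case one
      then show ?case using Yc[OF y] generate.one by simp
    next
      case (incl c)
      then show ?case by (intro generate.incl conjC)
    next
      case (inv c)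
      have "y \<otimes> inv c \<otimes> inv y = inv (y \<otimes> c \<otimes> inv y)" using inv Cc Yc[OF y] by (auto simp: word_simps subset_iff)
      then show ?case using generate.inv[OF conjC[OF inv], of G] by simp
    next
      case (eng a b)
      have c: "a \<in> carrier G" "b \<in> carrier G" using eng generate_in_carrier[OF Cc] by auto
      have "y \<otimes> (a \<otimes> b) \<otimes> inv y = (y \<otimes> a \<otimes> inv y) \<otimes> (y \<otimes> b \<otimes> inv y)" using c Yc[OF y] by (simp add: word_simps)
      then show ?case using generate.eng[OF eng.IH] by simp
    qed
  qed
  then have "normal_in D Y" using subD d DH H(2) by (auto simp: normal_in_def)
  then have "D = {\<one>}" using min[of D] DH H(2) by blast
  moreover have "x \<otimes> y \<otimes> inv x \<otimes> inv y \<in> D" unfolding D_def by (rule generate.incl) (use xy in \<open>auto simp: C_def\<close>)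
  ultimately have "x \<otimes> y \<otimes> inv x \<otimes> inv y = \<one>" by simp
  then have "x \<otimes> y \<otimes> inv x \<otimes> inv y \<otimes> (y \<otimes> x) = \<one> \<otimes> (y \<otimes> x)" by simp
  then show ?thesis using Nc xy by (simp add: word_simps)
qed

text \<open>The inductive hypothesis ranges over all groups of one type: subgroups of
  \<open>Y\<close> are treated inside \<open>G\<close>, quotients in a new group. A quotient of
  primitive type is impossible, as it has two chains of different lengths from its trivial
  subgroup.\<close>

lemma settled_step:
  assumes mu: "minimal_uniform Y"
    and IH: "\<And>(H :: ('a, 'b) monoid_scheme) Z.
      card Z < card Y \<Longrightarrow> fin_group H \<Longrightarrow> group.minimal_uniform H Z \<Longrightarrow> fin_group.settled H Z"
  shows "settled Y"
proof -
  have Y: "subgroup Y G" using mu by (simp add: minimal_uniform_def)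
  have proper: "settled Z" if "subgroup Z G" "Z \<subset> Y" for Z
    using IH[of Z G] minimal_uniform_subgroup[OF mu that(1)] that
      psubset_card_mono[OF subgroup_finite[OF Y]] fin_group_axioms by blast
  show ?thesis
  proof (cases "(\<forall>K. normal_in K Y \<longrightarrow> K = {\<one>} \<or> K = Y) \<or> supersolvable_over {\<one>} Y")
    case True
    then show ?thesis using simple_settled[OF mu _ proper] by (auto simp: settled_def)
  next
    case False
    then obtain K0 where K0: "normal_in K0 Y" "K0 \<noteq> {\<one>}" "K0 \<noteq> Y" by blast
    have quot: "supersolvable_over K Y" if K: "normal_in K Y" "K \<noteq> {\<one>}" for K
    proof -
      obtain Q :: "('a, 'b) monoid_scheme" and h
        where q: "quotient_map G Q Y h K" "card (carrier Q) * card K = card Y"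
        using quotient_same_type[OF K(1)] by blast
      interpret q: quotient_map G Q Y h K by (rule q(1))
      have "card K > 1" using nontrivial_card[OF normal_inD(1)[OF K(1)] K(2)] .
      moreover have "card (carrier Q) > 0" using q(2) subgroup_card_pos[OF Y] by (cases "card (carrier Q)") auto
      ultimately have "card (carrier Q) < card Y" using q(2) by (metis mult.right_neutral mult_less_cancel1)
      then have "q.Q.settled (carrier Q)"
        using IH q.Q.fin_group_axioms q.quotient_minimal_uniform(2)[OF mu K(2)] by blast
      moreover have "\<not> q.Q.primitive_type (carrier Q) F S f n" for F S f n
      proof
        assume prim: "q.Q.primitive_type (carrier Q) F S f n"
        have "Suc (Omega (card S)) = n + Omega (card S)"
          using q.quotient_minimal_uniform(1)[OF mu K(2)] q.Q.primitive_chains(1,2)[OF prim]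
          unfolding q.Q.uniform_chains_def by blast
        then show False using q.Q.primitive_typeD(8)[OF prim] by simp
      qed
      ultimately show ?thesis using q.supersolvable_pullback by (auto simp: q.Q.settled_def)
    qed
    \<comment> \<open>Least order among the nontrivial normal subgroups gives minimality and,
      compared with \<open>K0\<close>, properness; the induction then makes \<open>N\<close> settled
      and hence abelian.\<close>
    obtain N where N: "normal_in N Y" "N \<noteq> {\<one>}"
      and least: "\<And>K. normal_in K Y \<Longrightarrow> K \<noteq> {\<one>} \<Longrightarrow> card N \<le> card K"
      using ex_has_least_nat[of "\<lambda>K. normal_in K Y \<and> K \<noteq> {\<one>}" K0 card] K0 by blast
    note dN = normal_inD[OF N(1)]
    have min: "K = {\<one>} \<or> K = N" if K: "normal_in K Y" "K \<subseteq> N" for K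
    proof (rule disjCI)
      assume "K \<noteq> N"
      then have "card K < card N" using K(2) subgroup_finite[OF dN(1)] by (intro psubset_card_mono) auto
      then show "K = {\<one>}" using least[OF K(1)] by fastforce
    qed
    have "N \<subset> Y"
    proof -
      have "card N \<le> card K0" using least K0 by blast
      also have "card K0 < card Y" using K0 normal_inD[OF K0(1)] subgroup_finite[OF Y] by (intro psubset_card_mono) auto
      finally show ?thesis using dN(3) by blast
    qed
    then have "settled N" using proper dN(1) by blast
    then have comm: "x \<otimes> y = y \<otimes> x" if "x \<in> N" "y \<in> N" for x y
      using abelian_minimal_normal[OF N(1) min _ N(2)] that by blast
    have Nc: "x \<in> carrier G" "x \<in> Y" if "x \<in> N" for x using that dN by (auto simp: subgroup.mem_carrier)
    obtain r where r: "prime_nat r" "r dvd card N"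
      using nontrivial_card[OF dN(1) N(2)] prime_factor_nat[of "card N"] by auto
    \<comment> \<open>The elements of \<open>N\<close> annihilated by \<open>r\<close> form a normal
      subgroup of \<open>Y\<close>, nontrivial by Cauchy's theorem, hence all of
      \<open>N\<close>.\<close>
    have exp: "x [^] r = \<one>" if "x \<in> N" for x
    proof -
      define K where "K = {x \<in> N. x [^] r = \<one>}"
      have dist: "(x \<otimes> y) [^] r = x [^] r \<otimes> y [^] r" if "x \<in> N" "y \<in> N" for x y
        by (rule pow_mult_distrib) (use comm Nc that in auto)
      have "subgroup K G"
        by (rule subgroup_finI) (use Nc dist subgroup.one_closed[OF dN(1)] subgroup.m_closed[OF dN(1)] in \<open>auto simp: K_def\<close>)
      moreover have "y \<otimes> x \<otimes> inv y \<in> K" if "y \<in> Y" "x \<in> K" for x y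
      proof -
        have x: "x \<in> N" "x [^] r = \<one>" and y: "y \<in> carrier G" using that Y by (auto simp: K_def subgroup.mem_carrier)
        have "(y \<otimes> x \<otimes> inv y) [^] r = y \<otimes> x [^] r \<otimes> inv y" using conj_pow[OF y Nc(1)[OF x(1)], of r] by simp
        then show ?thesis using x y dN(4)[OF that(1) x(1)] by (simp add: K_def)
      qed
      ultimately have K: "normal_in K Y" using Y Nc by (auto simp: normal_in_def K_def)
      obtain U where U: "subgroup U G" "U \<subseteq> N" "card U = r" using cauchy_subgroup[OF dN(1) r] by blast
      have "U \<subseteq> K" using U pow_card_subgroup[OF U(1)] by (auto simp: K_def)
      moreover have "U \<noteq> {\<one>}" using U(3) prime_gt_1_nat[OF r(1)] by auto
      ultimately have "K \<noteq> {\<one>}" using subgroup.one_closed[OF U(1)] by blast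
      then have "K = N" using min[OF K] by (auto simp: K_def)
      then show ?thesis using that by (auto simp: K_def)
    qed
    obtain n where n: "card N = r ^ n" using exponent_prime_card[OF dN(1) r(1) exp] by blast
    interpret mn: minimal_nonsupersolvable G Y N r n
      by unfold_locales (use N quot False min r(1) comm exp n in auto)
    show ?thesis using mn.primitive_type_exists[OF mu] by (auto simp: settled_def)
  qed
qed

end

theorem minimal_uniform_settled:
  fixes G :: "('a, 'b) monoid_scheme"
  assumes "fin_group G" "group.minimal_uniform G Y"
  shows "fin_group.settled G Y"
  using assms
proof (induction "card Y" arbitrary: G Y rule: less_induct)
  case less
  show ?case by (rule fin_group.settled_step[OF less.prems]) (rule less.hyps)
qed

section \<open>Translation to the definitions of the theorem\<close>

lemma (in fin_group) cyclic_group_prime_order: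
  assumes "prime_nat (card (carrier G))"
  shows "cyclic_group G"
proof -
  have "carrier G \<noteq> {\<one>}" using assms by auto
  then obtain a where a: "a \<in> carrier G" "a \<noteq> \<one>" using one_closed by blast
  define H where "H = generate G {a}"
  have H: "subgroup H G" unfolding H_def using generate_is_subgroup a by simp
  have aH: "a \<in> H" unfolding H_def by (rule generate.incl) simp
  have "card H dvd card (carrier G)" using card_subgroup_dvd[OF H subgroup_self] H by (simp add: subgroup.subset)
  moreover have "H \<noteq> {\<one>}" using aH a by blast
  then have "card H \<noteq> 1" using nontrivial_card[OF H] by simp
  ultimately have "card H = card (carrier G)" using assms prime_nat_iff by blast
  then have "H = carrier G" using subgroup_eq_card[OF subgroup_self] H by (simp add: subgroup.subset)
  moreover have "H = range (\<lambda>n::int. a [^] n)" unfolding H_def generate_pow[OF a(1)] by auto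
  ultimately have "carrier G = range (\<lambda>n::int. a [^] n)" by simp
  then show ?thesis unfolding cyclic_group using a by blast
qed

context fin_group
begin

lemma subgroup_carrier_iff:
  "subgroup K G \<Longrightarrow> subgroup H (G\<lparr>carrier := K\<rparr>) \<longleftrightarrow> subgroup H G \<and> H \<subseteq> K"
  using incl_subgroup[of K H] subgroup_incl[of H K] subgroup.subset[of H "G\<lparr>carrier := K\<rparr>"] by auto

lemma maximal_in_iff:
  assumes "subgroup K G"
  shows "maximal_subgroup M (G\<lparr>carrier := K\<rparr>) \<longleftrightarrow> maximal_in M K"
  unfolding maximal_subgroup_def maximal_in_def using subgroup_carrier_iff[OF assms] assms by auto

lemma maximal_in_carrier_iff: "maximal_subgroup M G \<longleftrightarrow> maximal_in M (carrier G)"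
  using maximal_in_iff[OF subgroup_self] by simp

lemma normal_in_iff:
  assumes "subgroup K G"
  shows "N \<lhd> (G\<lparr>carrier := K\<rparr>) \<longleftrightarrow> normal_in N K"
proof -
  interpret K: group "G\<lparr>carrier := K\<rparr>" using assms by (simp add: subgroup_imp_group)
  show ?thesis
    unfolding K.normal_inv_iff subgroup_carrier_iff[OF assms] normal_in_def using assms by auto
qed

lemma normal_in_carrier_iff: "N \<lhd> G \<longleftrightarrow> normal_in N (carrier G)"
  using normal_in_iff[OF subgroup_self] by simp

lemma maximal_chain_exists:
  assumes "chain_len H (carrier G) n"
  shows "\<exists>C. maximal_chain G H n C"
proof -
  have "\<exists>C. C 0 = H \<and> C n = K \<and> (\<forall>i\<le>n. subgroup (C i) G) \<and> (\<forall>i<n. maximal_in (C i) (C (Suc i)))"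
    if "chain_len H K n" for K n
    using that
  proof (induction rule: chain_len.induct)
    case chain_refl
    then show ?case by (intro exI[of _ "\<lambda>_. H"]) auto
  next
    case (chain_step K n L)
    then obtain C where C: "C 0 = H" "C n = K" "\<forall>i\<le>n. subgroup (C i) G" "\<forall>i<n. maximal_in (C i) (C (Suc i))" by blast
    have "subgroup L G" using chain_step.hyps by (simp add: maximal_in_def)
    then show ?case using C chain_step.hyps
      by (intro exI[of _ "C(Suc n := L)"]) (auto simp: le_Suc_eq less_Suc_eq)
  qed
  from this[OF assms] obtain C where C: "C 0 = H" "C n = carrier G" "\<forall>i\<le>n. subgroup (C i) G" "\<forall>i<n. maximal_in (C i) (C (Suc i))"
    by blast
  then have "maximal_chain G H n C"
    unfolding maximal_chain_def using maximal_in_iff by (simp add: Suc_leI)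
  then show ?thesis by blast
qed

lemma minimal_subgroup_prime_order:
  assumes U: "subgroup U G" "prime_nat (card U)"
  shows "minimal_subgroup U G"
proof -
  have "maximal_in {\<one>} U"
    using maximal_in_prime_index[OF triv_subgroup U(1)] U subgroup.one_closed by auto
  then show ?thesis
    unfolding minimal_subgroup_def maximal_in_def using U subgroup.one_closed by blast
qed

lemma minimal_uniform_carrier:
  assumes "\<And>H. minimal_subgroup H G \<Longrightarrow> all_maximal_chains_same_length G H"
  shows "minimal_uniform (carrier G)"
  unfolding minimal_uniform_def
proof (intro conjI allI impI, rule subgroup_self)
  fix U assume "subgroup U G \<and> U \<subseteq> carrier G \<and> prime_nat (card U)"
  then have "all_maximal_chains_same_length G U" using assms minimal_subgroup_prime_order by blast
  then show "uniform_chains U (carrier G)"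
    unfolding uniform_chains_def all_maximal_chains_same_length_def using maximal_chain_exists by metis
qed

lemma supersolvable_series:
  assumes "supersolvable_over K Z"
  shows "\<exists>r N. N 0 = K \<and> N r = Z \<and> (\<forall>i\<le>r. normal_in (N i) Z) \<and>
    (\<forall>i<r. N i \<subseteq> N (Suc i) \<and> (\<exists>p. prime_nat p \<and> card (N (Suc i)) = p * card (N i)))"
  using assms
proof (induction "card Z - card K" arbitrary: K rule: less_induct)
  case less
  have K: "normal_in K Z" using less.prems by (simp add: supersolvable_over_def)
  note d = normal_inD[OF K]
  show ?case
  proof (cases "K = Z")
    case True
    then show ?thesis using K by (intro exI[of _ "0::nat"] exI[of _ "\<lambda>_. K"]) auto
  next
    case False
    then obtain L p where L: "normal_in L Z" "K \<subseteq> L" "prime_nat p" "card L = p * card K"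
      using supersolvable_overD[OF less.prems K normal_in_self[OF d(2)] order_refl] d(3) by blast
    have "card L \<le> card Z" using normal_inD[OF L(1)] subgroup_finite card_mono by blast
    moreover have "card K < card L" using L(4) subgroup_card_pos[OF d(1)] prime_gt_1_nat[OF L(3)] by simp
    ultimately have lt: "card Z - card L < card Z - card K" by linarith
    obtain r N where N: "N 0 = L" "N r = Z" "\<forall>i\<le>r. normal_in (N i) Z"
      "\<forall>i<r. N i \<subseteq> N (Suc i) \<and> (\<exists>p. prime_nat p \<and> card (N (Suc i)) = p * card (N i))"
      using less.hyps[OF lt supersolvable_over_mono[OF less.prems L(1,2)]] by blast
    define M where "M i = (case i of 0 \<Rightarrow> K | Suc j \<Rightarrow> N j)" for i
    have M_simps: "M 0 = K" "M (Suc j) = N j" for j by (simp_all add: M_def)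
    have "M 0 = K" "M (Suc r) = Z" using N(2) by (simp_all add: M_simps)
    moreover have "\<forall>i\<le>Suc r. normal_in (M i) Z"
    proof (intro allI impI)
      show "normal_in (M i) Z" if "i \<le> Suc r" for i using that K N(3) by (cases i) (simp_all add: M_simps)
    qed
    moreover have "\<forall>i<Suc r. M i \<subseteq> M (Suc i) \<and> (\<exists>p. prime_nat p \<and> card (M (Suc i)) = p * card (M i))"
    proof (intro allI impI)
      show "M i \<subseteq> M (Suc i) \<and> (\<exists>p. prime_nat p \<and> card (M (Suc i)) = p * card (M i))" if "i < Suc r" for i
      proof (cases i)
        case 0
        then show ?thesis unfolding 0 M_simps N(1) using L(2-4) by blast
      next
        case (Suc j)
        then have "j < r" using that by simp
        then show ?thesis unfolding Suc M_simps using N(4) by blast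
      qed
    qed
    ultimately show ?thesis by blast
  qed
qed

lemma quotient_order:
  assumes "normal_in H K"
  shows "group (G\<lparr>carrier := K\<rparr> Mod H)" "finite (carrier (G\<lparr>carrier := K\<rparr> Mod H))"
    "card (carrier (G\<lparr>carrier := K\<rparr> Mod H)) * card H = card K"
proof -
  note d = normal_inD[OF assms]
  interpret K: group "G\<lparr>carrier := K\<rparr>" using d by (simp add: subgroup_imp_group)
  have "H \<lhd> G\<lparr>carrier := K\<rparr>" using normal_in_iff[OF d(2)] assms by simp
  then interpret n: normal H "G\<lparr>carrier := K\<rparr>" .
  show "group (G\<lparr>carrier := K\<rparr> Mod H)" by (rule n.factorgroup_is_group)
  show "finite (carrier (G\<lparr>carrier := K\<rparr> Mod H))" using subgroup_finite[OF d(2)] by (simp add: carrier_FactGroup)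
  show "card (carrier (G\<lparr>carrier := K\<rparr> Mod H)) * card H = card K"
    using K.lagrange[OF n.is_subgroup] by (simp add: order_def FactGroup_def)
qed

text \<open>Iterated prime steps form a series whose factors have prime order and are therefore
  cyclic.\<close>

lemma supersolvable_if_over:
  assumes Z: "subgroup Z G" and ss: "supersolvable_over {\<one>} Z"
  shows "supersolvable (G\<lparr>carrier := Z\<rparr>)"
proof -
  obtain r N where N: "N 0 = {\<one>}" "N r = Z" "\<forall>i\<le>r. normal_in (N i) Z"
    "\<forall>i<r. N i \<subseteq> N (Suc i) \<and> (\<exists>p. prime_nat p \<and> card (N (Suc i)) = p * card (N i))"
    using supersolvable_series[OF ss] by blast
  have "cyclic_group ((G\<lparr>carrier := Z, carrier := N (Suc i)\<rparr>) Mod N i)" if i: "i < r" for i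
  proof -
    have s: "subgroup (N (Suc i)) G" "N (Suc i) \<subseteq> Z" using N(3) i normal_inD[of "N (Suc i)" Z] by auto
    have n: "normal_in (N i) (N (Suc i))" using normal_in_mono[of "N i" Z "N (Suc i)"] N(3,4) i s by auto
    obtain p where p: "prime_nat p" "card (N (Suc i)) = p * card (N i)" using N(4) i by blast
    interpret q: fin_group "G\<lparr>carrier := N (Suc i)\<rparr> Mod N i"
      using quotient_order(1,2)[OF n] by (simp add: fin_group_def fin_group_axioms_def)
    have "card (carrier (G\<lparr>carrier := N (Suc i)\<rparr> Mod N i)) = p"
      using quotient_order(3)[OF n] p subgroup_card_pos[OF normal_inD(1)[OF n]] by simp
    then show ?thesis using q.cyclic_group_prime_order p(1) by simp
  qed
  then show ?thesis
    unfolding supersolvable_def normal_in_iff[OF Z] using N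
    by (intro exI[of _ r] exI[of _ N]) simp
qed

text \<open>A minimal normal subgroup of a supersolvable group embeds in a cyclic factor of the
  series; by this bound its subgroup of order \<open>p\<close> is characteristic.\<close>

lemma cyclic_exponent_bound:
  assumes "cyclic_group G" "prime_nat p"
  shows "card {x \<in> carrier G. x [^] p = \<one>} \<le> p"
proof -
  obtain a where a: "a \<in> carrier G" "carrier G = range (\<lambda>n::int. a [^] n)" using assms(1) cyclic_group by blast
  have "carrier G = generate G {a}" unfolding generate_pow[OF a(1)] a(2) by auto
  then have gen: "carrier G = {a [^] k |k. k \<in> (UNIV :: nat set)}"
    using generate_pow_on_finite_carrier[OF fin a(1)] by simp
  define m where "m = ord a"
  have m: "m > 0" using ord_ge_1[OF fin a(1)] by (simp add: m_def)
  have am: "a [^] k = \<one> \<longleftrightarrow> m dvd k" for k :: nat unfolding m_def by (rule pow_eq_id[OF a(1)])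
  have mod: "a [^] k = a [^] (k mod m)" for k :: nat
    using pow_cong_exponent[OF a(1), of m k "k mod m"] am[of m] by (simp add: cong_def)
  \<comment> \<open>The solutions of \<open>x [^] p = \<one>\<close> are the powers of
    \<open>a [^] c\<close>, where \<open>c\<close> is \<open>ord a\<close> divided by
    \<open>p\<close>, or 0 if \<open>p\<close> does not divide \<open>ord a\<close>.\<close>
  have "\<exists>c. {x \<in> carrier G. x [^] p = \<one>} \<subseteq> (\<lambda>j. a [^] (c * j :: nat)) ` {..<p}"
  proof (cases "p dvd m")
    case True
    then obtain c where c: "m = p * c" by (auto elim: dvdE)
    have "x \<in> (\<lambda>j. a [^] (c * j)) ` {..<p}" if x: "x \<in> carrier G" "x [^] p = \<one>" for x
    proof -
      obtain k :: nat where k: "x = a [^] k" using x(1) gen by auto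
      define k' where "k' = k mod m"
      have xk: "x = a [^] k'" using k mod[of k] by (simp add: k'_def)
      have "a [^] (k' * p) = \<one>" using x(2) a(1) xk by (simp add: nat_pow_pow)
      then have "p * c dvd k' * p" using am c by simp
      then have "c dvd k'" using prime_gt_0_nat[OF assms(2)] by (simp add: mult.commute)
      then obtain j where j: "k' = c * j" by (auto elim: dvdE)
      have "k' < m" using m by (simp add: k'_def)
      then have "c * j < c * p" unfolding j c by (simp add: mult.commute)
      then have "j < p" by simp
      then show ?thesis using xk j by auto
    qed
    then show ?thesis by blast
  next
    case False
    then have cop: "coprime m p" using prime_imp_coprime[OF assms(2)] coprime_commute by blast
    have "x \<in> (\<lambda>j. a [^] (0 * j :: nat)) ` {..<p}" if x: "x \<in> carrier G" "x [^] p = \<one>" for x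
    proof -
      obtain k :: nat where k: "x = a [^] k" using x(1) gen by auto
      have "a [^] (k * p) = \<one>" using x(2) a(1) k by (simp add: nat_pow_pow)
      then have "m dvd k" using am cop by (simp add: coprime_dvd_mult_left_iff)
      then have "x = a [^] (0 * 0 :: nat)" using k am by simp
      then show ?thesis using prime_gt_0_nat[OF assms(2)] by blast
    qed
    then show ?thesis by blast
  qed
  then obtain c where "{x \<in> carrier G. x [^] p = \<one>} \<subseteq> (\<lambda>j. a [^] (c * j :: nat)) ` {..<p}" by blast
  then show ?thesis using surj_card_le[of "{..<p}"] by fastforce
qed

lemma supersolvable_minimal_normal:
  assumes ss: "supersolvable G" and min: "minimal_normal_subgroup F G" and p: "prime_nat p" "p dvd card F"
  shows "card F = p"
proof -
  have F: "normal_in F (carrier G)" "F \<noteq> {\<one>}"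
    and Fmin: "\<And>K. normal_in K (carrier G) \<Longrightarrow> K \<subseteq> F \<Longrightarrow> K = {\<one>} \<or> K = F"
    using min by (auto simp: minimal_normal_subgroup_def normal_in_carrier_iff)
  note dF = normal_inD[OF F(1)]
  have Fc: "x \<in> carrier G" if "x \<in> F" for x using dF(3) that by auto
  obtain r N where N: "N 0 = {\<one>}" "N r = carrier G" "\<And>i. i \<le> r \<Longrightarrow> normal_in (N i) (carrier G)"
    "\<And>i. i < r \<Longrightarrow> N i \<subseteq> N (Suc i)" "\<And>i. i < r \<Longrightarrow> cyclic_group (G\<lparr>carrier := N (Suc i)\<rparr> Mod N i)"
    using ss by (auto simp: supersolvable_def normal_in_carrier_iff)
  \<comment> \<open>The first term of the series that meets \<open>F\<close> nontrivially contains
    \<open>F\<close> by minimality, while its predecessor meets \<open>F\<close> trivially; this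
    embeds \<open>F\<close> in the factor between them.\<close>
  define j where "j = (LEAST i. F \<inter> N i \<noteq> {\<one>})"
  have ex: "F \<inter> N r \<noteq> {\<one>}" using F(2) N(2) dF(3) by (simp add: Int_absorb2)
  have j: "F \<inter> N j \<noteq> {\<one>}" "j \<le> r"
    unfolding j_def using LeastI[of "\<lambda>i. F \<inter> N i \<noteq> {\<one>}" r] Least_le[of "\<lambda>i. F \<inter> N i \<noteq> {\<one>}" r] ex by auto
  have "F \<inter> N 0 = {\<one>}" using N(1) subgroup.one_closed[OF dF(1)] by simp
  then obtain i where i: "j = Suc i" using j(1) by (cases j) auto
  have Fi: "F \<inter> N i = {\<one>}" using not_less_Least[of i "\<lambda>i. F \<inter> N i \<noteq> {\<one>}"] i by (auto simp: j_def)
  have "F \<inter> N (Suc i) = F" using Fmin[OF normal_in_Int[OF F(1) N(3)[of "Suc i"]]] j i by auto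
  then have FN: "F \<subseteq> N (Suc i)" by blast
  have s: "subgroup (N (Suc i)) G" using N(3) j i normal_inD(1) by blast
  have n: "normal_in (N i) (N (Suc i))"
    using normal_in_mono[OF N(3) s N(4)] j i s by (auto simp: subgroup.subset)
  let ?K = "G\<lparr>carrier := N (Suc i)\<rparr>"
  let ?Q = "?K Mod N i"
  interpret q: fin_group ?Q using quotient_order(1,2)[OF n] by (simp add: fin_group_def fin_group_axioms_def)
  have "N i \<lhd> ?K" using normal_in_iff[OF s] n by simp
  then interpret nm: normal "N i" ?K .
  define \<phi> where "\<phi> x = N i #> x" for x
  have phi: "\<phi> x = N i #>\<^bsub>?K\<^esub> x" for x by (simp add: \<phi>_def)
  have phi_in: "\<phi> x \<in> carrier ?Q" if "x \<in> F" for x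
    using FN that unfolding phi carrier_FactGroup by auto
  have phi_pow: "\<phi> x [^]\<^bsub>?Q\<^esub> (k::nat) = \<phi> (x [^] k)" if "x \<in> F" for x k
  proof -
    have "x \<in> carrier ?K" using FN that by auto
    from nm.FactGroup_pow[OF this, of k] show ?thesis
      unfolding phi by (simp add: nat_pow_consistent[symmetric])
  qed
  have inj: "inj_on \<phi> F"
  proof (rule inj_onI)
    fix x y assume xy: "x \<in> F" "y \<in> F" "\<phi> x = \<phi> y"
    have Ni: "subgroup (N i) G" using n by (simp add: normal_in_def)
    have "x \<in> N i #> y" using xy rcos_self[OF Fc[OF xy(1)] Ni] by (simp add: \<phi>_def)
    then obtain v where v: "v \<in> N i" "x = v \<otimes> y" by (auto simp: r_coset_def)
    have vc: "v \<in> carrier G" using v Ni by (simp add: subgroup.mem_carrier)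
    have "v = x \<otimes> inv y" using v vc Fc xy by (simp add: m_assoc)
    then have "v \<in> F" using xy subgroup.m_closed[OF dF(1)] subgroup.m_inv_closed[OF dF(1)] by blast
    then have "v = \<one>" using v Fi by blast
    then show "x = y" using v Fc xy by simp
  qed
  \<comment> \<open>The cyclic factor allows \<open>E\<close> at most \<open>p\<close> elements, so
    \<open>E\<close> is a subgroup \<open>U\<close> of order \<open>p\<close>. Being cut out by an
    exponent, it is invariant under conjugation.\<close>
  define E where "E = {x \<in> F. x [^] p = \<one>}"
  have "\<phi> ` E \<subseteq> {x \<in> carrier ?Q. x [^]\<^bsub>?Q\<^esub> p = \<one>\<^bsub>?Q\<^esub>}"
  proof -
    have "\<phi> \<one> = \<one>\<^bsub>?Q\<^esub>" using n by (auto simp: \<phi>_def normal_in_def subgroup.subset)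
    then show ?thesis using phi_in phi_pow by (auto simp: E_def)
  qed
  moreover have "finite {x \<in> carrier ?Q. x [^]\<^bsub>?Q\<^esub> p = \<one>\<^bsub>?Q\<^esub>}" using q.fin by simp
  ultimately have "card (\<phi> ` E) \<le> card {x \<in> carrier ?Q. x [^]\<^bsub>?Q\<^esub> p = \<one>\<^bsub>?Q\<^esub>}" by (rule card_mono[rotated])
  also have "\<dots> \<le> p" using q.cyclic_exponent_bound[OF N(5) p(1)] j i by simp
  finally have "card E \<le> p" using inj card_image[of \<phi> E] inj_on_subset[of \<phi> F E] by (auto simp: E_def)
  obtain U where U: "subgroup U G" "U \<subseteq> F" "card U = p" using cauchy_subgroup[OF dF(1) p] by blast
  have UE: "U \<subseteq> E" using U(2) pow_card_subgroup[OF U(1)] U(3) by (auto simp: E_def)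
  have "finite E" using subgroup_finite[OF dF(1)] by (simp add: E_def)
  then have "U = E" using card_seteq[OF _ UE] \<open>card E \<le> p\<close> U(3) by simp
  have "x \<otimes> u \<otimes> inv x \<in> E" if "x \<in> carrier G" "u \<in> E" for x u
    using dF(4)[OF that(1)] that conj_pow[of x u p, symmetric] Fc by (auto simp: E_def)
  then have "normal_in U (carrier G)" using U(1) subgroup_self dF(3) U(2) \<open>U = E\<close> by (auto simp: normal_in_def)
  moreover have "U \<noteq> {\<one>}" using U(3) prime_gt_1_nat[OF p(1)] by auto
  ultimately have "U = F" using Fmin U(2) by blast
  then show ?thesis using U(3) by simp
qed

lemma center_eq: "subgroup K G \<Longrightarrow> center (G\<lparr>carrier := K\<rparr>) = centralizer_in K K"
  by (auto simp: center_def centralizer_in_def)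

lemma normal_center:
  assumes "normal_in K (carrier G)"
  shows "normal_in (centralizer_in K K) (carrier G)"
proof -
  have "centralizer_in K K = K \<inter> centralizer_in (carrier G) K"
    using normal_inD(3)[OF assms] by (auto simp: centralizer_in_def)
  then show ?thesis using normal_in_Int[OF assms normal_in_centralizer[OF assms]] by simp
qed

text \<open>Elements of the last nontrivial term of the lower central series are central, since
  their commutators with \<open>K\<close> lie in the next, trivial term.\<close>

lemma nilpotent_center:
  assumes K: "subgroup K G" "nilpotent_group (G\<lparr>carrier := K\<rparr>)" "K \<noteq> {\<one>}"
  shows "centralizer_in K K \<noteq> {\<one>}"
proof -
  let ?K = "G\<lparr>carrier := K\<rparr>"
  interpret K: group ?K using K by (simp add: subgroup_imp_group)
  have sub: "lower_central ?K n \<subseteq> K \<and> \<one> \<in> lower_central ?K n" for n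
  proof (induction n)
    case (Suc n)
    have "(\<Union>h\<in>lower_central ?K n. \<Union>g\<in>carrier ?K. {h \<otimes>\<^bsub>?K\<^esub> g \<otimes>\<^bsub>?K\<^esub> inv\<^bsub>?K\<^esub> h \<otimes>\<^bsub>?K\<^esub> inv\<^bsub>?K\<^esub> g}) \<subseteq> carrier ?K"
      using Suc K.m_closed K.inv_closed by auto
    from K.generate_incl[OF this] show ?case using generate.one[of ?K] by simp
  qed (use K subgroup.one_closed in auto)
  define n where "n = (LEAST n. lower_central ?K n = {\<one>})"
  have "\<exists>n. lower_central ?K n = {\<one>}" using K(2) by (simp add: nilpotent_group_def)
  then have n: "lower_central ?K n = {\<one>}" unfolding n_def by (rule LeastI_ex)
  then obtain m where m: "n = Suc m" using K(3) by (cases n) auto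
  have "lower_central ?K m \<noteq> {\<one>}" using not_less_Least[of m "\<lambda>n. lower_central ?K n = {\<one>}"] m by (simp add: n_def)
  then obtain h where h: "h \<in> lower_central ?K m" "h \<noteq> \<one>" using sub[of m] by blast
  have hK: "h \<in> K" using sub h by blast
  have "h \<otimes> g = g \<otimes> h" if g: "g \<in> K" for g
  proof -
    have "h \<otimes>\<^bsub>?K\<^esub> g \<otimes>\<^bsub>?K\<^esub> inv\<^bsub>?K\<^esub> h \<otimes>\<^bsub>?K\<^esub> inv\<^bsub>?K\<^esub> g \<in> lower_central ?K (Suc m)"
      unfolding lower_central.simps by (rule generate.incl) (use h g in auto)
    then have "h \<otimes> g \<otimes> inv h \<otimes> inv g = \<one>" using n m hK g K(1) by simp
    then have "h \<otimes> g \<otimes> inv h \<otimes> inv g \<otimes> (g \<otimes> h) = \<one> \<otimes> (g \<otimes> h)" by simp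
    then show ?thesis using hK g K(1) by (simp add: word_simps subgroup.mem_carrier)
  qed
  then have "h \<in> centralizer_in K K" using hK by (auto simp: centralizer_in_def)
  then show ?thesis using h(2) by blast
qed

lemma nilpotent_abelian:
  assumes K: "subgroup K G" "\<And>x y. x \<in> K \<Longrightarrow> y \<in> K \<Longrightarrow> x \<otimes> y = y \<otimes> x"
  shows "nilpotent_group (G\<lparr>carrier := K\<rparr>)"
proof -
  let ?K = "G\<lparr>carrier := K\<rparr>"
  interpret K: group ?K using K by (simp add: subgroup_imp_group)
  have "h \<otimes>\<^bsub>?K\<^esub> g \<otimes>\<^bsub>?K\<^esub> inv\<^bsub>?K\<^esub> h \<otimes>\<^bsub>?K\<^esub> inv\<^bsub>?K\<^esub> g = \<one>" if "h \<in> K" "g \<in> K" for h g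
  proof -
    have "h \<in> carrier G" "g \<in> carrier G" using that K(1) by (auto simp: subgroup.mem_carrier)
    moreover have "h \<otimes> g \<otimes> inv h \<otimes> inv g = g \<otimes> h \<otimes> inv h \<otimes> inv g" using K(2)[OF that] by simp
    ultimately show ?thesis using K(1) that by (simp add: m_assoc cancel_inv)
  qed
  then have "(\<Union>h\<in>K. \<Union>g\<in>K. {h \<otimes>\<^bsub>?K\<^esub> g \<otimes>\<^bsub>?K\<^esub> inv\<^bsub>?K\<^esub> h \<otimes>\<^bsub>?K\<^esub> inv\<^bsub>?K\<^esub> g}) = {\<one>}"
    using subgroup.one_closed[OF K(1)] by auto
  then have "lower_central ?K 1 = generate ?K {\<one>\<^bsub>?K\<^esub>}" by simp
  then have "lower_central ?K 1 = {\<one>\<^bsub>?K\<^esub>}" using K.generate_one by simp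
  then show ?thesis unfolding nilpotent_group_def by blast
qed

section \<open>The conclusions for groups of primitive type\<close>

context
  fixes F S :: "'a set" and f n :: nat
  assumes prim: "primitive_type (carrier G) F S f n"
begin

lemmas prim_facts = primitive_typeD[OF prim]

lemma F_comm: "x \<in> F \<Longrightarrow> y \<in> F \<Longrightarrow> x \<otimes> y = y \<otimes> x"
  using prim_facts(12) by (auto simp: centralizer_in_def)

text \<open>A nontrivial center would contain \<open>F\<close>, and then all of \<open>G\<close>
  would centralize \<open>F\<close>, which is its own centralizer and proper.\<close>

lemma primitive_center: "center G = {\<one>}"
proof (rule ccontr)
  have c: "center G = centralizer_in (carrier G) (carrier G)" using center_eq[OF subgroup_self] by simp
  assume "center G \<noteq> {\<one>}"
  then have "F \<subseteq> center G" using prim_facts(11)[OF normal_center[OF normal_in_self[OF subgroup_self]]] c by simp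
  then have "centralizer_in (carrier G) F = carrier G" unfolding c by (auto simp: centralizer_in_def)
  then show False using prim_facts(12,18) by simp
qed

text \<open>The center of a nontrivial nilpotent normal subgroup \<open>K\<close> is nontrivial and
  normal in \<open>G\<close>, so it contains \<open>F\<close>. Hence \<open>K\<close> centralizes
  \<open>F\<close> and lies in \<open>F\<close>.\<close>

lemma primitive_fitting: "fitting G = F"
proof
  have "nilpotent_group (G\<lparr>carrier := F\<rparr>)" using nilpotent_abelian[OF normal_inD(1)[OF prim_facts(1)] F_comm] .
  then show "F \<subseteq> fitting G"
    unfolding fitting_def using prim_facts(1) normal_in_carrier_iff by (auto intro: generate.incl)
  have "K \<subseteq> F" if K: "K \<lhd> G" "nilpotent_group (G\<lparr>carrier := K\<rparr>)" for K
  proof (cases "K = {\<one>}")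
    case True
    then show ?thesis using subgroup.one_closed[OF normal_inD(1)[OF prim_facts(1)]] by simp
  next
    case False
    have Kn: "normal_in K (carrier G)" using K(1) normal_in_carrier_iff by simp
    have "F \<subseteq> centralizer_in K K"
      using prim_facts(11)[OF normal_center[OF Kn] nilpotent_center[OF normal_inD(1)[OF Kn] K(2) False]] .
    then have "K \<subseteq> centralizer_in (carrier G) F"
      using normal_inD(3)[OF Kn] by (fastforce simp: centralizer_in_def)
    then show ?thesis using prim_facts(12) by simp
  qed
  then show "fitting G \<subseteq> F"
    unfolding fitting_def by (intro generate_subgroup_incl normal_inD(1)[OF prim_facts(1)]) blast
qed

text \<open>The conjugates of \<open>S\<close> are all maximal. Their intersection \<open>K\<close>
  is normal and lies in \<open>S\<close>, so it does not contain \<open>F\<close> and is therefore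
  trivial.\<close>

lemma primitive_frattini: "frattini G = {\<one>}"
proof -
  define K where "K = {x \<in> carrier G. \<forall>g\<in>carrier G. inv g \<otimes> x \<otimes> g \<in> S}"
  have "subgroup K G"
  proof (rule subgroup_finI)
    show "K \<subseteq> carrier G" by (auto simp: K_def)
    show "\<one> \<in> K" using subgroup.one_closed[OF prim_facts(2)] by (simp add: K_def)
    fix x y assume xy: "x \<in> K" "y \<in> K"
    have "inv g \<otimes> (x \<otimes> y) \<otimes> g \<in> S" if g: "g \<in> carrier G" for g
    proof -
      have "(inv g \<otimes> x \<otimes> g) \<otimes> (inv g \<otimes> y \<otimes> g) \<in> S"
        by (rule subgroup.m_closed[OF prim_facts(2)]) (use xy g in \<open>auto simp: K_def\<close>)
      then show ?thesis using xy g by (simp add: K_def word_simps)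
    qed
    then show "x \<otimes> y \<in> K" using xy by (simp add: K_def)
  qed
  moreover have "y \<otimes> x \<otimes> inv y \<in> K" if y: "y \<in> carrier G" and x: "x \<in> K" for x y
  proof -
    have "inv g \<otimes> (y \<otimes> x \<otimes> inv y) \<otimes> g \<in> S" if g: "g \<in> carrier G" for g
    proof -
      have "inv (inv y \<otimes> g) \<otimes> x \<otimes> (inv y \<otimes> g) \<in> S" using x y g by (auto simp: K_def)
      then show ?thesis using x y g by (simp add: K_def word_simps)
    qed
    then show ?thesis using x y by (simp add: K_def)
  qed
  ultimately have "normal_in K (carrier G)" using subgroup_self by (auto simp: normal_in_def K_def)
  moreover have "K \<subseteq> S"
  proof
    fix x assume "x \<in> K"
    then have "x \<in> carrier G" "inv \<one> \<otimes> x \<otimes> \<one> \<in> S" by (auto simp: K_def)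
    then show "x \<in> S" by simp
  qed
  then have "\<not> F \<subseteq> K" using prim_facts(4,17) subgroup.one_closed[OF normal_inD(1)[OF prim_facts(1)]] by blast
  ultimately have K1: "K = {\<one>}" using prim_facts(11) by blast
  have "frattini G \<subseteq> K"
  proof
    fix x assume x: "x \<in> frattini G"
    then have xc: "x \<in> carrier G" by (simp add: frattini_def)
    have "inv g \<otimes> x \<otimes> g \<in> S" if g: "g \<in> carrier G" for g
    proof -
      have "maximal_in (conj_set g S) (carrier G)"
        using maximal_in_conj[OF prim_facts(15) g] conj_set_self[OF subgroup_self g] by simp
      then have "x \<in> conj_set g S" using x by (auto simp: frattini_def maximal_in_carrier_iff)
      then obtain s where s: "s \<in> S" "x = g \<otimes> s \<otimes> inv g" by (auto simp: conj_set_def)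
      have "s \<in> carrier G" using s prim_facts(3) by auto
      then have "inv g \<otimes> x \<otimes> g = s" using s(2) g by (simp add: word_simps)
      then show ?thesis using s(1) by simp
    qed
    then show "x \<in> K" using xc by (simp add: K_def)
  qed
  moreover have "\<one> \<in> frattini G"
    by (auto simp: frattini_def maximal_subgroup_def subgroup.one_closed)
  ultimately show ?thesis using K1 by blast
qed

text \<open>Two elements of \<open>S\<close> acting alike differ by an element that centralizes
  \<open>F\<close>, hence lies in \<open>F \<inter> S\<close>. The rest shows that restricted
  conjugation is a homomorphism into the bijections of \<open>F\<close>.\<close>

lemma primitive_faithful: "acts_faithfully_by_conjugation G S F"
proof -
  note dF = normal_inD[OF prim_facts(1)]
  have Fc: "x \<in> carrier G" if "x \<in> F" for x using that dF(3) by auto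
  have Sc: "x \<in> carrier G" if "x \<in> S" for x using that prim_facts(3) by auto
  define \<phi> where "\<phi> = (\<lambda>m. \<lambda>x\<in>F. m \<otimes> x \<otimes> inv m)"
  have bij: "\<phi> m \<in> Bij F" if m: "m \<in> S" for m
  proof -
    have "inj_on (\<phi> m) F" using Fc Sc[OF m] by (auto simp: inj_on_def \<phi>_def)
    moreover have "\<phi> m ` F \<subseteq> F" using dF(4) Sc[OF m] by (auto simp: \<phi>_def)
    ultimately have "bij_betw (\<phi> m) F F"
      using endo_inj_surj[OF subgroup_finite[OF dF(1)]] by (simp add: bij_betw_def)
    moreover have "\<phi> m \<in> extensional F" by (simp add: \<phi>_def)
    ultimately show ?thesis by (simp add: Bij_def)
  qed
  have "\<phi> \<in> hom (G\<lparr>carrier := S\<rparr>) (BijGroup F)"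
  proof (rule homI)
    fix x assume "x \<in> carrier (G\<lparr>carrier := S\<rparr>)"
    then show "\<phi> x \<in> carrier (BijGroup F)" using bij by (simp add: BijGroup_def)
    fix y assume xy: "x \<in> carrier (G\<lparr>carrier := S\<rparr>)" "y \<in> carrier (G\<lparr>carrier := S\<rparr>)"
    have "\<phi> (x \<otimes> y) = compose F (\<phi> x) (\<phi> y)"
    proof
      fix z
      show "\<phi> (x \<otimes> y) z = compose F (\<phi> x) (\<phi> y) z"
      proof (cases "z \<in> F")
        case True
        then have "y \<otimes> z \<otimes> inv y \<in> F" using dF(4) Sc xy by simp
        then show ?thesis using True xy Sc Fc by (simp add: compose_def \<phi>_def word_simps)
      qed (simp add: compose_def \<phi>_def)
    qed
    then show "\<phi> (x \<otimes>\<^bsub>G\<lparr>carrier := S\<rparr>\<^esub> y) = \<phi> x \<otimes>\<^bsub>BijGroup F\<^esub> \<phi> y"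
      using bij xy by (simp add: BijGroup_def)
  qed
  then have "group_action (G\<lparr>carrier := S\<rparr>) F \<phi>"
    using subgroup_imp_group[OF prim_facts(2)] group_BijGroup
    by (simp add: group_action_def group_hom_def group_hom_axioms_def)
  moreover have "inj_on \<phi> S"
  proof (rule inj_onI)
    fix x y assume xy: "x \<in> S" "y \<in> S" "\<phi> x = \<phi> y"
    have xyc: "x \<in> carrier G" "y \<in> carrier G" using xy Sc by auto
    define z where "z = inv y \<otimes> x"
    have zS: "z \<in> S" unfolding z_def using xy subgroup.m_closed[OF prim_facts(2)] subgroup.m_inv_closed[OF prim_facts(2)] by blast
    have "z \<otimes> v = v \<otimes> z" if v: "v \<in> F" for v
    proof -
      have "x \<otimes> v \<otimes> inv x = y \<otimes> v \<otimes> inv y" using fun_cong[OF xy(3), of v] v by (simp add: \<phi>_def)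
      then have "inv y \<otimes> (x \<otimes> v \<otimes> inv x) \<otimes> x = inv y \<otimes> (y \<otimes> v \<otimes> inv y) \<otimes> x" by simp
      then show ?thesis using xyc Fc[OF v] by (simp add: z_def word_simps)
    qed
    then have "z \<in> F" using prim_facts(12) Sc[OF zS] by (auto simp: centralizer_in_def)
    then have "z = \<one>" using zS prim_facts(4) by blast
    then have "y \<otimes> z = y" using xyc by simp
    then show "x = y" using xyc by (simp add: z_def cancel_inv)
  qed
  ultimately show ?thesis
    unfolding acts_faithfully_by_conjugation_def \<phi>_def[symmetric]
    by (simp add: faithful_action_def faithful_action_axioms_def)
qed

lemma primitive_minimal_normal: "minimal_normal_subgroup K G \<longleftrightarrow> K = F"
proof -
  have "minimal_normal_subgroup F G"
    unfolding minimal_normal_subgroup_def normal_in_carrier_iff using prim_facts(1,11,17) by blast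
  moreover have "K = F" if "minimal_normal_subgroup K G"
    using that prim_facts(1,11,17) unfolding minimal_normal_subgroup_def normal_in_carrier_iff by metis
  ultimately show ?thesis by blast
qed

text \<open>A trivial derived subgroup would make \<open>G\<close> its own center, which is trivial
  although \<open>F\<close> is not.\<close>

lemma primitive_derived:
  "normal_in (derived G (carrier G)) (carrier G)" "F \<subseteq> derived G (carrier G)"
proof -
  show D: "normal_in (derived G (carrier G)) (carrier G)"
    using derived_self_is_normal normal_in_carrier_iff by simp
  have "derived G (carrier G) \<noteq> {\<one>}"
  proof
    assume e: "derived G (carrier G) = {\<one>}"
    have "x \<otimes> y = y \<otimes> x" if "x \<in> carrier G" "y \<in> carrier G" for x y
    proof -
      have "x \<otimes> y \<otimes> inv x \<otimes> inv y \<in> derived G (carrier G)"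
        unfolding derived_def by (rule generate.incl) (use that in auto)
      then have "x \<otimes> y \<otimes> inv x \<otimes> inv y \<otimes> (y \<otimes> x) = \<one> \<otimes> (y \<otimes> x)" using e by simp
      then show ?thesis using that by (simp add: word_simps)
    qed
    then have "center G = carrier G" by (auto simp: center_def)
    then have "F \<subseteq> {\<one>}" using primitive_center normal_inD(3)[OF prim_facts(1)] by metis
    then show False using prim_facts(17) subgroup.one_closed[OF normal_inD(1)[OF prim_facts(1)]] by blast
  qed
  then show "F \<subseteq> derived G (carrier G)" using prim_facts(11)[OF D] by blast
qed

text \<open>The index of \<open>F\<close> in \<open>G\<close> is \<open>card S\<close>, not
  divisible by \<open>f\<close>, and the index of \<open>F\<close> in the derived subgroup divides
  it.\<close>

lemma primitive_sylow: "sylow_subgroup f F (derived_group G)"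
proof -
  note D = primitive_derived
  note dD = normal_inD[OF D(1)] and dF = normal_inD[OF prim_facts(1)]
  define D' where "D' = derived G (carrier G)"
  obtain c where c: "card D' = card F * c"
    unfolding D'_def using card_subgroup_dvd[OF dF(1) dD(1) D(2)] by (auto elim: dvdE)
  have "card D' dvd card F * card S"
    unfolding D'_def using card_subgroup_dvd[OF dD(1) subgroup_self dD(3)] prim_facts(16) by simp
  then have "c dvd card S" using c subgroup_card_pos[OF dF(1)] by simp
  then have "\<not> f dvd c" using prim_facts(9) dvd_trans by blast
  then have "multiplicity f (card D') = n"
    using c prim_facts(7) prime_gt_0_nat[OF prim_facts(6)] by (intro multiplicity_eqI) auto
  moreover have "order (derived_group G) = card D'" by (simp add: order_def D'_def)
  ultimately show ?thesis
    unfolding sylow_subgroup_def using prim_facts(6,7) subgroup_incl[OF dF(1) dD(1) D(2)] by simp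
qed

text \<open>The center of the derived subgroup is normal in \<open>G\<close>. Being nontrivial it
  contains \<open>F\<close>, so the derived subgroup centralizes \<open>F\<close> and lies in
  it.\<close>

lemma primitive_derived_center:
  assumes "center (derived_group G) \<noteq> {\<one>}"
  shows "F = derived G (carrier G)"
proof -
  note D = primitive_derived
  have "F \<subseteq> centralizer_in (derived G (carrier G)) (derived G (carrier G))"
    using prim_facts(11)[OF normal_center[OF D(1)]] assms center_eq[OF normal_inD(1)[OF D(1)]] by simp
  then have "derived G (carrier G) \<subseteq> centralizer_in (carrier G) F"
    using normal_inD(3)[OF D(1)] by (fastforce simp: centralizer_in_def)
  then show ?thesis using prim_facts(12) D(2) by simp
qed

end

end

theorem theorem1p5:
  fixes G :: "('a, 'b) monoid_scheme"
  assumes "group G"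
    and "finite (carrier G)"
    and "\<And>H. minimal_subgroup H G \<Longrightarrow> all_maximal_chains_same_length G H"
  shows "(\<not> supersolvable G \<longleftrightarrow>
            frattini G = {\<one>\<^bsub>G\<^esub>} \<and> center G = {\<one>\<^bsub>G\<^esub>} \<and>
            (\<exists>M. subgroup M G \<and>
               internal_semidirect G (fitting G) M \<and>
               acts_faithfully_by_conjugation G M (fitting G) \<and>
               (\<forall>N. minimal_normal_subgroup N G \<longleftrightarrow> N = fitting G) \<and>
               supersolvable (G\<lparr>carrier := M\<rparr>) \<and> maximal_subgroup M G \<and>
               (\<exists>p n. Factorial_Ring.prime p \<and> n \<ge> 2 \<and> card (fitting G) = p ^ n)))
       \<and> (\<not> supersolvable G \<longrightarrow>
            (\<exists>p. sylow_subgroup p (fitting G) (derived_group G)) \<and>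
            (center (derived_group G) \<noteq> {\<one>\<^bsub>G\<^esub>} \<longrightarrow>
               fitting G = carrier (derived_group G)))"
proof -
  interpret fin_group G using assms(1,2) by (simp add: fin_group_def fin_group_axioms_def)
  have prim: "\<exists>F S f n. primitive_type (carrier G) F S f n" if "\<not> supersolvable G"
  proof -
    have "\<not> supersolvable_over {\<one>\<^bsub>G\<^esub>} (carrier G)"
      using supersolvable_if_over[OF subgroup_self] that by auto
    moreover have "settled (carrier G)"
      using minimal_uniform_settled[OF fin_group_axioms minimal_uniform_carrier[OF assms(3)]] .
    ultimately show ?thesis by (simp add: settled_def)
  qed
  \<comment> \<open>For the converse of the equivalence: in a supersolvable group a minimal normal
    subgroup has prime order, whereas \<open>p ^ n\<close> with \<open>n \<ge> 2\<close> is not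
    prime.\<close>
  have not_ss: "\<not> supersolvable G"
    if "\<forall>N. minimal_normal_subgroup N G \<longleftrightarrow> N = fitting G" "prime_nat p" "n \<ge> 2" "card (fitting G) = p ^ n" for p n
  proof
    assume "supersolvable G"
    then have "card (fitting G) = p"
      using supersolvable_minimal_normal that by (simp add: dvd_power)
    then have "prime_nat (p ^ n)" using that(2,4) by simp
    then show False using that(3) by (simp add: prime_power_iff)
  qed
  show ?thesis
  proof (cases "supersolvable G")
    case True
    then show ?thesis using not_ss by blast
  next
    case False
    then obtain F S f n where p: "primitive_type (carrier G) F S f n" using prim by blast
    note d = primitive_typeD[OF p]
    have fit: "fitting G = F" using primitive_fitting[OF p] .
    have "internal_semidirect G F S"
      unfolding internal_semidirect_def normal_in_carrier_iff using d(1,2,4,5) by blast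
    then have "\<exists>M. subgroup M G \<and> internal_semidirect G (fitting G) M \<and>
        acts_faithfully_by_conjugation G M (fitting G) \<and>
        (\<forall>N. minimal_normal_subgroup N G \<longleftrightarrow> N = fitting G) \<and>
        supersolvable (G\<lparr>carrier := M\<rparr>) \<and> maximal_subgroup M G \<and>
        (\<exists>p n. prime_nat p \<and> n \<ge> 2 \<and> card (fitting G) = p ^ n)"
      unfolding fit maximal_in_carrier_iff
      using d(2,6,7,8,15) primitive_faithful[OF p] primitive_minimal_normal[OF p] supersolvable_if_over[OF d(2,14)]
      by blast
    moreover have "\<exists>p. sylow_subgroup p (fitting G) (derived_group G)"
      unfolding fit using primitive_sylow[OF p] by blast
    moreover have "center (derived_group G) \<noteq> {\<one>\<^bsub>G\<^esub>} \<longrightarrow> fitting G = carrier (derived_group G)"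
      unfolding fit using primitive_derived_center[OF p] by simp
    ultimately show ?thesis using False primitive_frattini[OF p] primitive_center[OF p] by blast
  qed
qed

end
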